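(* Fix $T>0$, $S_{\rm max}>0$, $r>0$ and an integer $N\ge 0$, and let $C_N(t)$, $t\in(0,T)$, be the $(N+1)\times(N+1)$ Legendre coefficient matrix defined in the context. Assume that $C_N\in W^{1,\infty}(0,T;\mathbb R^{(N+1)\times(N+1)})$. For $\alpha>0$ and a projected initial vector ${\bf u}^0_\delta\in\mathbb R^{N+1}$, define $$J_{\alpha,N}^\delta({\bf v})=\int_0^T|{\bf v}'(t)-C_N(t){\bf v}(t)|^2\,dt+|{\bf v}(0)-{\bf u}^0_\delta|^2+\alpha\|{\bf v}\|_{H^2(0,T;\mathbb R^{N+1})}^2,\qquad {\bf v}\in H^2(0,T;\mathbb R^{N+1}).$$ (i) (Existence and uniqueness) For every $\alpha>0$, the functional $J_{\alpha,N}^\delta$ has a unique minimizer ${\bf u}_{\alpha,N}^\delta\in H^2(0,T;\mathbb R^{N+1})$. (ii) (Stability) If ${\bf u}_{\alpha,N}^{\delta,1}$ and ${\bf u}_{\alpha,N}^{\delta,2}$ are the minimizers corresponding (for the same $\alpha>0$) to projected initial vectors $({\bf u}^0_\delta)^1$ and $({\bf u}^0_\delta)^2$ in place of ${\bf u}^0_\delta$, then $$\|{\bf u}_{\alpha,N}^{\delta,1}-{\bf u}_{\alpha,N}^{\delta,2}\|_{H^2(0,T;\mathbb R^{N+1})}\le\frac{1}{2\sqrt{\alpha}}\,|({\bf u}^0_\delta)^1-({\bf u}^0_\delta)^2|.$$ (iii) (Convergence) Let ${\bf u}^0\in\mathbb R^{N+1}$ be the exact projected initial vector and let ${\bf u}_N^\dagger$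 be the exact solution of the reduced system $$({\bf u}_N^\dagger)'(t)=C_N(t){\bf u}_N^\dagger(t),\qquad {\bf u}_N^\dagger(0)={\bf u}^0.$$ Assume that $|{\bf u}^0_\delta-{\bf u}^0|\le\delta$ for every $\delta>0$. If $\alpha=\alpha(\delta)>0$ satisfies $$\alpha(\delta)\to0,\qquad \frac{\delta^2}{\alpha(\delta)}\to0\qquad\text{as }\delta\to0,$$ then, as $\delta\to 0$, ${\bf u}_{\alpha(\delta),N}^\delta\to{\bf u}_N^\dagger$ strongly in $H^2(0,T;\mathbb R^{N+1})$. In particular, ${\bf u}_{\alpha(\delta),N}^\delta(T)\to{\bf u}_N^\dagger(T)$ in $\mathbb R^{N+1}$.
   Context: Notation: $|\cdot|$ is the Euclidean norm on $\mathbb R^{N+1}$, and $H^2(0,T;\mathbb R^{N+1})$ is the usual Sobolev (Hilbert) space with its standard norm $\|{\bf v}\|_{H^2}^2=\int_0^T(|{\bf v}|^2+|{\bf v}'|^2+|{\bf v}''|^2)\,dt$. Legendre functions: let $P_n$ be the $n$th Legendre polynomial on $(-1,1)$, $P_n(x)=\frac{1}{2^n n!}\frac{d^n}{dx^n}(x^2-1)^n$, and set $$\ell_n(S)=\sqrt{\frac{2n+1}{S_{\rm max}}}\,P_n\Big(\frac{2S}{S_{\rm max}}-1\Big),\qquad 0<S<S_{\rm max},\ n=0,1,2,\dots,$$ which is a complete orthonormal system in $L^2(0,S_{\rm max})$. Coefficient matrix: $\sigma=\sigma(t,S)$ is a given real volatility function on $(0,T)\times(0,S_{\rm max})$ and $r>0$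 is the interest rate. For $m,n\in\{0,\dots,N\}$, $$A_{mn}(t)=\int_0^{S_{\rm max}}\sigma^2(t,S)S^2\ell_n''(S)\ell_m(S)\,dS,\qquad B_{mn}=\int_0^{S_{\rm max}}S\,\ell_n'(S)\ell_m(S)\,dS,$$ and $C_N(t)=(C_{mn}(t))_{m,n=0}^N$ with $C_{mn}(t)=-\tfrac12A_{mn}(t)-rB_{mn}+r\delta_{mn}$, where $\delta_{mn}$ is the Kronecker delta. Data: $u^0\in L^2(0,S_{\rm max})$ is the exact initial profile and $u^0_\delta\in L^2(0,S_{\rm max})$ is a noisy version of it at noise level $\delta>0$. The projected vectors are ${\bf u}^0=\big(\int_0^{S_{\rm max}}u^0(S)\ell_m(S)\,dS\big)_{m=0}^N$ and ${\bf u}^0_\delta=\big(\int_0^{S_{\rm max}}u^0_\delta(S)\ell_m(S)\,dS\big)_{m=0}^N$ in $\mathbb R^{N+1}$. *)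

theory Defs
  imports "HOL-Analysis.Analysis"
begin

section \<open>Sobolev spaces on a bounded interval\<close>

text \<open>
  Elements of Lebesgue and Sobolev spaces on (0,T) are represented by functions; two functions
  represent the same element iff they agree almost everywhere on (0,T). Values outside (0,T)
  are irrelevant.
\<close>

abbreviation leb :: "real \<Rightarrow> real measure" where
  "leb T \<equiv> lebesgue_on {0<..<T}"

definition ae_eq :: "real \<Rightarrow> (real \<Rightarrow> 'a) \<Rightarrow> (real \<Rightarrow> 'a) \<Rightarrow> bool" where
  "ae_eq T v w \<longleftrightarrow> (AE t in leb T. v t = w t)"

definition L2 :: "real \<Rightarrow> (real \<Rightarrow> 'a::euclidean_space) set" where
  "L2 T = {v. v \<in> borel_measurable (leb T) \<and> integrable (leb T) (\<lambda>t. (norm (v t))\<^sup>2)}"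

definition Linf :: "real \<Rightarrow> (real \<Rightarrow> 'a::euclidean_space) set" where
  "Linf T = {v. v \<in> borel_measurable (leb T) \<and> (\<exists>M. AE t in leb T. norm (v t) \<le> M)}"

text \<open>The test functions \<open>C\<^sub>c\<^sup>1(0,T)\<close>.\<close>

definition test_functions :: "real \<Rightarrow> (real \<Rightarrow> real) set" where
  "test_functions T = {\<phi>. \<phi> C1_differentiable_on UNIV \<and>
     (\<exists>K. compact K \<and> K \<subseteq> {0<..<T} \<and> (\<forall>t. t \<notin> K \<longrightarrow> \<phi> t = 0))}"

text \<open>
  Weak derivative, as in Brezis' textbook definition of the one-dimensional Sobolev spaces.
  Integrability excludes the default value 0 of the integral of a non-integrable function;
  it is automatic for functions in \<open>L\<^sup>2\<close> or \<open>L\<^sup>\<infinity>\<close>, since the interval is bounded.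
\<close>

definition has_weak_deriv :: "real \<Rightarrow> (real \<Rightarrow> 'a::euclidean_space) \<Rightarrow> (real \<Rightarrow> 'a) \<Rightarrow> bool" where
  "has_weak_deriv T v w \<longleftrightarrow> integrable (leb T) v \<and> integrable (leb T) w \<and>
     (\<forall>\<phi>\<in>test_functions T.
        (LINT t|leb T. deriv \<phi> t *\<^sub>R v t) = - (LINT t|leb T. \<phi> t *\<^sub>R w t))"

text \<open>A representative of the weak derivative, which is unique up to null sets.\<close>

definition wderiv :: "real \<Rightarrow> (real \<Rightarrow> 'a::euclidean_space) \<Rightarrow> real \<Rightarrow> 'a" where
  "wderiv T v = (SOME w. has_weak_deriv T v w)"

definition H1 :: "real \<Rightarrow> (real \<Rightarrow> 'a::euclidean_space) set" where
  "H1 T = {v \<in> L2 T. \<exists>v1\<in>L2 T. has_weak_deriv T v v1}"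

definition H2 :: "real \<Rightarrow> (real \<Rightarrow> 'a::euclidean_space) set" where
  "H2 T = {v \<in> L2 T. \<exists>v1\<in>L2 T. \<exists>v2\<in>L2 T. has_weak_deriv T v v1 \<and> has_weak_deriv T v1 v2}"

definition W1inf :: "real \<Rightarrow> (real \<Rightarrow> 'a::euclidean_space) set" where
  "W1inf T = {v \<in> Linf T. \<exists>v1\<in>Linf T. has_weak_deriv T v v1}"

definition H2_norm :: "real \<Rightarrow> (real \<Rightarrow> 'a::euclidean_space) \<Rightarrow> real" where
  "H2_norm T v = sqrt (LINT t|leb T.
     (norm (v t))\<^sup>2 + (norm (wderiv T v t))\<^sup>2 + (norm (wderiv T (wderiv T v) t))\<^sup>2)"

text \<open>
  The representative that is continuous on [0,T], used to evaluate Sobolev functions at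
  single points such as 0 and T. It exists for functions in \<open>H1 T\<close> and is unique on [0,T].
\<close>

definition cont_rep :: "real \<Rightarrow> (real \<Rightarrow> 'a::euclidean_space) \<Rightarrow> real \<Rightarrow> 'a" where
  "cont_rep T v = (SOME g. continuous_on {0..T} g \<and> ae_eq T g v)"

section \<open>Legendre functions and the reduced system\<close>

definition legendre_P :: "nat \<Rightarrow> real \<Rightarrow> real" where
  "legendre_P n x = 1 / (2 ^ n * fact n) * (deriv ^^ n) (\<lambda>y. (y\<^sup>2 - 1) ^ n) x"

definition legendre_l :: "real \<Rightarrow> nat \<Rightarrow> real \<Rightarrow> real" where
  "legendre_l Smax n S = sqrt ((2 * real n + 1) / Smax) * legendre_P n (2 * S / Smax - 1)"

text \<open>
  If the integrand is not integrable for some t, the entry is 0 by the library's convention;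
  the volatility is otherwise unrestricted.
\<close>

definition A_coeff :: "(real \<Rightarrow> real \<Rightarrow> real) \<Rightarrow> real \<Rightarrow> nat \<Rightarrow> nat \<Rightarrow> real \<Rightarrow> real" where
  "A_coeff \<sigma> Smax m n t =
     (LINT S|leb Smax. (\<sigma> t S)\<^sup>2 * S\<^sup>2 * deriv (deriv (legendre_l Smax n)) S * legendre_l Smax m S)"

definition B_coeff :: "real \<Rightarrow> nat \<Rightarrow> nat \<Rightarrow> real" where
  "B_coeff Smax m n = (LINT S|leb Smax. S * deriv (legendre_l Smax n) S * legendre_l Smax m S)"

text \<open>
  The coordinates of \<open>real ^ 'n\<close> are numbered 0, ..., N by a bijection \<open>idx\<close> from
  \<open>'n\<close> onto \<open>{0..N}\<close>.
\<close>

definition C_mat :: "('n::finite \<Rightarrow> nat) \<Rightarrow> (real \<Rightarrow> real \<Rightarrow> real) \<Rightarrow> real \<Rightarrow> real \<Rightarrow> real \<Rightarrow> real ^ 'n ^ 'n"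
  where
  "C_mat idx \<sigma> Smax r t = (\<chi> m n. - (1 / 2) * A_coeff \<sigma> Smax (idx m) (idx n) t
     - r * B_coeff Smax (idx m) (idx n) + r * (if idx m = idx n then 1 else 0))"

definition projected :: "('n::finite \<Rightarrow> nat) \<Rightarrow> real \<Rightarrow> (real \<Rightarrow> real) \<Rightarrow> real ^ 'n" where
  "projected idx Smax f = (\<chi> m. LINT S|leb Smax. f S * legendre_l Smax (idx m) S)"

definition J :: "real \<Rightarrow> (real \<Rightarrow> real ^ 'n ^ 'n) \<Rightarrow> real ^ 'n \<Rightarrow> real \<Rightarrow> (real \<Rightarrow> real ^ 'n) \<Rightarrow> real" where
  "J T C b \<alpha> v = (LINT t|leb T. (norm (wderiv T v t - C t *v v t))\<^sup>2)
     + (norm (cont_rep T v 0 - b))\<^sup>2 + \<alpha> * (H2_norm T v)\<^sup>2"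

definition is_minimizer ::
  "real \<Rightarrow> (real \<Rightarrow> real ^ 'n ^ 'n) \<Rightarrow> real ^ 'n \<Rightarrow> real \<Rightarrow> (real \<Rightarrow> real ^ 'n) \<Rightarrow> bool" where
  "is_minimizer T C b \<alpha> v \<longleftrightarrow> is_arg_min (J T C b \<alpha>) (\<lambda>w. w \<in> H2 T) v"

text \<open>
  A coefficient matrix of class \<open>W\<^sup>1\<^sup>,\<^sup>\<infinity>\<close> is given up to null sets only, so the equation is
  required almost everywhere, with the weak derivative. Classical solutions are included.
\<close>

definition solves_reduced ::
  "real \<Rightarrow> (real \<Rightarrow> real ^ 'n ^ 'n) \<Rightarrow> real ^ 'n \<Rightarrow> (real \<Rightarrow> real ^ 'n) \<Rightarrow> bool" where
  "solves_reduced T C b u \<longleftrightarrow> u \<in> H1 T \<and> ae_eq T (wderiv T u) (\<lambda>t. C t *v u t)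
     \<and> cont_rep T u 0 = b"

end

theory Submission
  imports Defs
begin

text \<open>
  By the fundamental lemma of the calculus of variations, a function with an integrable weak
  derivative \<open>w\<close> is a.e. equal to \<open>c + \<integral>\<^sub>0\<^sup>t w\<close>, so its value at a point is controlled by the
  \<open>H\<^sup>2\<close> norm; with the Riesz-Fischer theorem this makes \<open>H\<^sup>2\<close> a Hilbert space on which the functional is
  quadratic, continuous and coercive. Minimizing sequences are Cauchy by the parallelogram law, and
  stability follows by testing the two Euler equations with the difference of the minimizers.

  Weak compactness is avoided in the convergence proof. For exact data and \<open>\<alpha> < \<beta>\<close> the Euler
  equations give \<open>\<parallel>u\<^sub>\<alpha> - u\<^sub>\<beta>\<parallel>\<^sup>2 \<le> \<parallel>u\<^sub>\<alpha>\<parallel>\<^sup>2 - \<parallel>u\<^sub>\<beta>\<parallel>\<^sup>2\<close>, and the norms are bounded by that of the exact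
  solution; so \<open>u\<^sub>\<alpha>\<close> converges as \<open>\<alpha> \<rightarrow> 0\<close>, and its limit solves the reduced system, whose solution is
  unique by Gronwall. The noise is then handled by the stability estimate, which contributes
  \<open>\<delta> / (2 \<surd>\<alpha>) \<rightarrow> 0\<close>.
\<close>

section \<open>Square-integrable functions\<close>

text \<open>\<open>wderiv\<close> and \<open>cont_rep\<close> are choices of representatives, so
  linear identities between derivatives hold only almost everywhere. The variational part is
  therefore done on an abstract carrier with two positive semidefinite forms, without vector space
  laws. The inequality between minimizers for \<alpha> < \<beta> comes from subtracting the Euler
  equations tested with z = u_\<alpha> - u_\<beta>: (\<beta> - \<alpha>) <u_\<beta>, z> is a sum of
  nonnegative terms, and |u_\<alpha>|^2 = |u_\<beta>|^2 + |z|^2 + 2 <u_\<beta>, z>. The constant 1/2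
  of the stability estimate comes from completing a square: if z is the difference of the minimizers
  and d that of the data, the initial term contributes d.z(0) - |z(0)|^2, which is at most |d|^2 /
  4. The regularity of C puts the exact solution into H2, where it can compete with the
  minimizers.\<close>

interpretation leb: finite_measure "leb T" for T
  by (rule finite_measure_lebesgue_on) simp

lemma measure_leb: "T \<ge> 0 \<Longrightarrow> measure (leb T) {0<..<T} = T"
  by (simp add: measure_restrict_space)

lemma L2_measurable: "v \<in> L2 T \<Longrightarrow> v \<in> borel_measurable (leb T)"
  by (simp add: L2_def)

lemma L2_norm2_integrable: "v \<in> L2 T \<Longrightarrow> integrable (leb T) (\<lambda>t. (norm (v t))\<^sup>2)"
  by (simp add: L2_def)

lemma L2_dominated:
  fixes v :: "real \<Rightarrow> 'a::euclidean_space"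
  assumes "v \<in> borel_measurable (leb T)" "integrable (leb T) g"
    "AE t in leb T. (norm (v t))\<^sup>2 \<le> g t"
  shows "v \<in> L2 T"
proof -
  have "integrable (leb T) (\<lambda>t. (norm (v t))\<^sup>2)"
    by (rule Bochner_Integration.integrable_bound[OF assms(2)])
      (use assms in \<open>auto elim!: eventually_mono\<close>)
  with assms show ?thesis by (simp add: L2_def)
qed

lemma L2_cong_AE:
  assumes "v \<in> L2 T" "w \<in> borel_measurable (leb T)" "AE t in leb T. v t = w t"
  shows "w \<in> L2 T"
  by (rule L2_dominated[OF assms(2) L2_norm2_integrable[OF assms(1)]]) (use assms in auto)

lemma norm_add_square_le: "(norm (x + y))\<^sup>2 \<le> 2 * (norm x)\<^sup>2 + 2 * (norm y)\<^sup>2"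
  for x y :: "'a::real_inner"
proof -
  have "0 \<le> (norm (x - y))\<^sup>2" by simp
  then show ?thesis
    by (simp add: power2_norm_eq_inner inner_diff_left inner_diff_right inner_add_left inner_add_right inner_commute)
qed

lemma L2_add_scaleR:
  assumes "v \<in> L2 T" "w \<in> L2 T"
  shows "(\<lambda>t. v t + c *\<^sub>R w t) \<in> L2 T"
proof (rule L2_dominated)
  show "integrable (leb T) (\<lambda>t. 2 * (norm (v t))\<^sup>2 + 2 * (c\<^sup>2 * (norm (w t))\<^sup>2))"
    using assms by (auto simp: L2_def)
  show "AE t in leb T. (norm (v t + c *\<^sub>R w t))\<^sup>2 \<le> 2 * (norm (v t))\<^sup>2 + 2 * (c\<^sup>2 * (norm (w t))\<^sup>2)"
    using norm_add_square_le[of "v _" "c *\<^sub>R w _"] by (auto simp: power_mult_distrib)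
  show "(\<lambda>t. v t + c *\<^sub>R w t) \<in> borel_measurable (leb T)"
    using assms[THEN L2_measurable] by measurable
qed

lemma L2_diff: "v \<in> L2 T \<Longrightarrow> w \<in> L2 T \<Longrightarrow> (\<lambda>t. v t - w t) \<in> L2 T"
  using L2_add_scaleR[of v T w "-1"] by simp

lemma L2_Pair:
  assumes "v \<in> L2 T" "w \<in> L2 T"
  shows "(\<lambda>t. (v t, w t)) \<in> L2 T"
proof (rule L2_dominated)
  show "integrable (leb T) (\<lambda>t. (norm (v t))\<^sup>2 + (norm (w t))\<^sup>2)"
    using assms by (auto simp: L2_def)
  show "(\<lambda>t. (v t, w t)) \<in> borel_measurable (leb T)"
    using assms[THEN L2_measurable] by measurable
qed (auto simp: norm_Pair)

lemma norm_fst: "norm (fst x) \<le> norm x" and norm_snd: "norm (snd x) \<le> norm x"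
  by (metis norm_fst_le prod.collapse, metis norm_snd_le prod.collapse)

lemma L2_fst_snd:
  assumes "v \<in> L2 T"
  shows "(\<lambda>t. fst (v t)) \<in> L2 T" "(\<lambda>t. snd (v t)) \<in> L2 T"
proof -
  have m: "(\<lambda>t. fst (v t)) \<in> borel_measurable (leb T)" "(\<lambda>t. snd (v t)) \<in> borel_measurable (leb T)"
    using assms[THEN L2_measurable]
    by (auto intro!: borel_measurable_continuous_on[where f=fst] borel_measurable_continuous_on[where f=snd] continuous_intros)
  show "(\<lambda>t. fst (v t)) \<in> L2 T" "(\<lambda>t. snd (v t)) \<in> L2 T"
    using m by (auto intro!: L2_dominated[OF _ L2_norm2_integrable[OF assms]] simp: norm_fst norm_snd)
qed

lemma inner_abs_le_squares: "\<bar>x \<bullet> y\<bar> \<le> (norm x)\<^sup>2 + (norm y)\<^sup>2" for x y :: "'a::real_inner"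
proof -
  have "2 * (norm x * norm y) \<le> (norm x)\<^sup>2 + (norm y)\<^sup>2"
    using sum_squares_bound[of "norm x" "norm y"] by simp
  moreover have "\<bar>x \<bullet> y\<bar> \<le> norm x * norm y" by (rule Cauchy_Schwarz_ineq2)
  moreover have "0 \<le> norm x * norm y" by simp
  ultimately show ?thesis by linarith
qed

lemma L2_inner_integrable:
  assumes "v \<in> L2 T" "w \<in> L2 T"
  shows "integrable (leb T) (\<lambda>t. v t \<bullet> w t)"
proof (rule Bochner_Integration.integrable_bound)
  show "integrable (leb T) (\<lambda>t. (norm (v t))\<^sup>2 + (norm (w t))\<^sup>2)"
    using assms by (auto simp: L2_def)
  show "(\<lambda>t. v t \<bullet> w t) \<in> borel_measurable (leb T)"
    using assms[THEN L2_measurable] by measurable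
qed (use inner_abs_le_squares[of "v _" "w _"] in auto)

lemma L2_integrable:
  assumes "v \<in> L2 T"
  shows "integrable (leb T) v"
proof (rule Bochner_Integration.integrable_bound)
  show "integrable (leb T) (\<lambda>t. 1 + (norm (v t))\<^sup>2)"
    using assms by (auto simp: L2_def)
  have "norm x \<le> 1 + (norm x)\<^sup>2" for x :: 'a
  proof -
    have "2 * norm x \<le> (norm x)\<^sup>2 + 1" using sum_squares_bound[of "norm x" 1] by simp
    then show ?thesis using norm_ge_zero[of x] by linarith
  qed
  then show "AE t in leb T. norm (v t) \<le> norm (1 + (norm (v t))\<^sup>2)" by auto
qed (use assms in \<open>simp add: L2_def\<close>)

text \<open>Expand \<open>0 \<le> \<integral> (T |v| - m)\<^sup>2\<close> with \<open>m = \<integral> |v|\<close>.\<close>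
lemma L1_le_L2:
  assumes "v \<in> L2 T" "T > 0"
  shows "(LINT t|leb T. norm (v t))\<^sup>2 \<le> T * (LINT t|leb T. (norm (v t))\<^sup>2)"
proof -
  define m where "m = (LINT t|leb T. norm (v t))"
  note i = L2_norm2_integrable[OF assms(1)] integrable_norm[OF L2_integrable[OF assms(1)]]
  have "0 \<le> (LINT t|leb T. (T * norm (v t) - m)\<^sup>2)" by simp
  also have "\<dots> = (LINT t|leb T. T\<^sup>2 * (norm (v t))\<^sup>2 - 2 * T * m * norm (v t) + m\<^sup>2)"
    by (rule Bochner_Integration.integral_cong) (auto simp: power2_eq_square algebra_simps)
  also have "\<dots> = T\<^sup>2 * (LINT t|leb T. (norm (v t))\<^sup>2) - 2 * T * m * m + m\<^sup>2 * T"
    using i assms(2) by (simp add: measure_leb m_def)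
  finally have "0 \<le> T * (T * (LINT t|leb T. (norm (v t))\<^sup>2) - m\<^sup>2)"
    by (simp add: power2_eq_square algebra_simps)
  then show ?thesis using assms(2) by (simp add: m_def zero_le_mult_iff)
qed

section \<open>Completeness of the space of square-integrable functions\<close>

lemma subseq_dominating:
  fixes N :: "nat \<Rightarrow> nat"
  obtains r where "strict_mono r" "\<And>k. N k \<le> r k"
proof
  \<comment> \<open>The thresholds \<open>N k\<close> need not be monotone; partial sums of
    \<open>Suc (N i)\<close> increase strictly and dominate every term.\<close>
  show "strict_mono (\<lambda>k. \<Sum>i\<le>k. Suc (N i))" by (rule strict_monoI_Suc) simp
  show "N k \<le> (\<Sum>i\<le>k. Suc (N i))" for k
    using member_le_sum[of k "{..k}" "\<lambda>i. Suc (N i)"] by simp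
qed

text \<open>By monotone convergence the series of norms has a finite integral, and a nonnegative
  function with finite integral is finite almost everywhere.\<close>

lemma AE_summable_norm:
  fixes d :: "nat \<Rightarrow> 'b \<Rightarrow> 'a::{banach, second_countable_topology}"
  assumes int: "\<And>k. integrable M (d k)"
    and sum: "summable (\<lambda>k. LINT t|M. norm (d k t))"
  shows "AE t in M. summable (\<lambda>k. norm (d k t))"
proof -
  have [measurable]: "\<And>k. d k \<in> borel_measurable M" using int by auto
  have "(\<integral>\<^sup>+t. (\<Sum>k. ennreal (norm (d k t))) \<partial>M) = (\<Sum>k. \<integral>\<^sup>+t. ennreal (norm (d k t)) \<partial>M)"
    by (rule nn_integral_suminf) simp
  also have "\<dots> = (\<Sum>k. ennreal (LINT t|M. norm (d k t)))"
    using int by (intro suminf_cong nn_integral_eq_integral) auto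
  also have "\<dots> = ennreal (\<Sum>k. LINT t|M. norm (d k t))"
    using sum by (intro suminf_ennreal2) auto
  finally have "(\<integral>\<^sup>+t. (\<Sum>k. ennreal (norm (d k t))) \<partial>M) \<noteq> \<infinity>" by simp
  then have "AE t in M. (\<Sum>k. ennreal (norm (d k t))) \<noteq> \<infinity>"
    by (intro nn_integral_PInf_AE) auto
  then show ?thesis
    by eventually_elim (auto intro: summable_suminf_not_top)
qed

text \<open>Fatou's lemma for the squared norms. Working with nonnegative integrals yields the
  membership of the limit together with the bound.\<close>

lemma L2_fatou:
  fixes f :: "nat \<Rightarrow> real \<Rightarrow> 'a::euclidean_space"
  assumes f: "\<And>k. f k \<in> L2 T" and g: "g \<in> borel_measurable (leb T)"
    and lim: "AE t in leb T. (\<lambda>k. f k t) \<longlonglongrightarrow> g t"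
    and bnd: "\<forall>\<^sub>F k in sequentially. (LINT t|leb T. (norm (f k t))\<^sup>2) \<le> e"
  shows "g \<in> L2 T" "(LINT t|leb T. (norm (g t))\<^sup>2) \<le> e"
proof -
  have [measurable]: "\<And>k. f k \<in> borel_measurable (leb T)" "g \<in> borel_measurable (leb T)"
    using f g by (auto simp: L2_def)
  \<comment> \<open>\<open>ennreal\<close> truncates negative numbers to 0, so the final step back
    to the reals asks for a nonnegative bound.\<close>
  have e: "e \<ge> 0"
  proof -
    obtain k where "(LINT t|leb T. (norm (f k t))\<^sup>2) \<le> e"
      using bnd by (auto simp: eventually_sequentially)
    moreover have "0 \<le> (LINT t|leb T. (norm (f k t))\<^sup>2)" by simp
    ultimately show ?thesis by linarith
  qed
  have "(\<integral>\<^sup>+t. ennreal ((norm (g t))\<^sup>2) \<partial>leb T) = (\<integral>\<^sup>+t. liminf (\<lambda>k. ennreal ((norm (f k t))\<^sup>2)) \<partial>leb T)"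
  proof (rule nn_integral_cong_AE)
    show "AE t in leb T. ennreal ((norm (g t))\<^sup>2) = liminf (\<lambda>k. ennreal ((norm (f k t))\<^sup>2))"
      using lim
    proof eventually_elim
      case (elim t)
      then have "(\<lambda>k. ennreal ((norm (f k t))\<^sup>2)) \<longlonglongrightarrow> ennreal ((norm (g t))\<^sup>2)"
        by (intro tendsto_intros)
      then show ?case by (metis lim_imp_Liminf sequentially_bot)
    qed
  qed
  also have "\<dots> \<le> liminf (\<lambda>k. \<integral>\<^sup>+t. ennreal ((norm (f k t))\<^sup>2) \<partial>leb T)"
    by (rule nn_integral_liminf) simp
  also have "\<dots> \<le> ennreal e"
  proof -
    have "(\<integral>\<^sup>+t. ennreal ((norm (f k t))\<^sup>2) \<partial>leb T) = ennreal (LINT t|leb T. (norm (f k t))\<^sup>2)" for k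
      using L2_norm2_integrable[OF f] by (intro nn_integral_eq_integral) auto
    then have "\<forall>\<^sub>F k in sequentially. (\<integral>\<^sup>+t. ennreal ((norm (f k t))\<^sup>2) \<partial>leb T) \<le> ennreal e"
      using bnd by (auto elim!: eventually_mono intro: ennreal_leI)
    then have "limsup (\<lambda>k. \<integral>\<^sup>+t. ennreal ((norm (f k t))\<^sup>2) \<partial>leb T) \<le> ennreal e"
      by (rule Limsup_bounded)
    then show ?thesis
      by (meson Liminf_le_Limsup order_trans sequentially_bot)
  qed
  finally have *: "(\<integral>\<^sup>+t. ennreal ((norm (g t))\<^sup>2) \<partial>leb T) \<le> ennreal e" .
  then have i: "integrable (leb T) (\<lambda>t. (norm (g t))\<^sup>2)"
    by (intro integrableI_bounded) (auto intro: le_less_trans)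
  then show "g \<in> L2 T" by (simp add: L2_def)
  have "ennreal (LINT t|leb T. (norm (g t))\<^sup>2) \<le> ennreal e"
    using * nn_integral_eq_integral[OF i] by simp
  then show "(LINT t|leb T. (norm (g t))\<^sup>2) \<le> e" using e by simp
qed

theorem L2_complete:
  fixes f :: "nat \<Rightarrow> real \<Rightarrow> 'a::euclidean_space"
  assumes T: "T > 0" and f: "\<And>n. f n \<in> L2 T"
    and Cau: "\<And>e. e > 0 \<Longrightarrow> \<exists>N. \<forall>m\<ge>N. \<forall>n\<ge>N. (LINT t|leb T. (norm (f m t - f n t))\<^sup>2) < e"
  obtains g r where "g \<in> L2 T" "(\<lambda>n. LINT t|leb T. (norm (f n t - g t))\<^sup>2) \<longlonglongrightarrow> 0"
    "strict_mono (r :: nat \<Rightarrow> nat)" "AE t in leb T. (\<lambda>n. f (r n) t) \<longlonglongrightarrow> g t"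
proof -
  have [measurable]: "\<And>n. f n \<in> borel_measurable (leb T)" using f by (simp add: L2_def)
  \<comment> \<open>The ratio 1/4 is the square of 1/2: by \<open>L1_le_L2\<close> the increments of
    the subsequence have L1 norms at most \<open>sqrt T * (1/2)^k\<close>, which is
    summable.\<close>
  have "\<exists>N. \<forall>m\<ge>N. \<forall>n\<ge>N. (LINT t|leb T. (norm (f m t - f n t))\<^sup>2) < (1/4)^k" for k :: nat
    by (rule Cau) simp
  then obtain N where N: "\<And>k m n. m \<ge> N k \<Longrightarrow> n \<ge> N k \<Longrightarrow> (LINT t|leb T. (norm (f m t - f n t))\<^sup>2) < (1/4)^k"
    by metis
  obtain r where r: "strict_mono r" "\<And>k. N k \<le> r k" using subseq_dominating[of N] by blast
  define d where "d k t = f (r (Suc k)) t - f (r k) t" for k t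
  have dL2: "d k \<in> L2 T" for k
    using L2_diff[OF f f, of "r (Suc k)" "r k"] by (simp add: d_def[abs_def])
  have dk: "(LINT t|leb T. norm (d k t)) \<le> sqrt T * (1/2)^k" for k
  proof -
    have "(LINT t|leb T. (norm (d k t))\<^sup>2) \<le> (1/4)^k"
      unfolding d_def using N[of k "r (Suc k)" "r k"] r(2)[of k] strict_mono_less_eq[OF r(1), of k "Suc k"]
      by (simp add: less_imp_le)
    then have "(LINT t|leb T. norm (d k t))\<^sup>2 \<le> T * (1/4)^k"
      using L1_le_L2[OF dL2[of k] T] T by (meson mult_left_mono less_imp_le order_trans)
    also have "\<dots> = (sqrt T * (1/2)^k)\<^sup>2"
      using T by (simp add: power_mult_distrib power_mult[symmetric] mult.commute[of k] power_mult power_divide)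
    finally show ?thesis by (rule power2_le_imp_le) (use T in auto)
  qed
  have "summable (\<lambda>k. LINT t|leb T. norm (d k t))"
    by (rule summable_comparison_test'[where g="\<lambda>k. sqrt T * (1/2)^k"])
      (use dk in \<open>auto intro!: summable_mult summable_geometric\<close>)
  then have "AE t in leb T. summable (\<lambda>k. norm (d k t))"
    by (intro AE_summable_norm L2_integrable dL2)
  then have conv: "AE t in leb T. convergent (\<lambda>n. f (r n) t)"
  proof eventually_elim
    case (elim t)
    then have "summable (\<lambda>k. d k t)" by (rule summable_norm_cancel)
    then have "convergent (\<lambda>n. \<Sum>k<n. d k t)" by (simp add: summable_iff_convergent)
    moreover have "(\<Sum>k<n. d k t) = f (r n) t - f (r 0) t" for n
      unfolding d_def by (rule sum_lessThan_telescope)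
    ultimately have "convergent (\<lambda>n. f (r n) t - f (r 0) t)" by simp
    then have "convergent (\<lambda>n. f (r n) t - f (r 0) t + f (r 0) t)"
      by (intro convergent_add convergent_const)
    then show ?case by simp
  qed
  define g where "g t = lim (\<lambda>n. f (r n) t)" for t
  have gm[measurable]: "g \<in> borel_measurable (leb T)"
    unfolding g_def by (rule borel_measurable_lim_metric) simp
  have lim: "AE t in leb T. (\<lambda>n. f (r n) t) \<longlonglongrightarrow> g t"
    using conv by eventually_elim (simp add: g_def convergent_LIMSEQ_iff)
  \<comment> \<open>Fatou along the subsequence, applied to \<open>f n - f (r k)\<close> for growing
    \<open>k\<close>: the Cauchy estimate passes to the limit \<open>g\<close>, and so does square
    integrability.\<close>
  have key: "(\<lambda>t. f n t - g t) \<in> L2 T \<and> (LINT t|leb T. (norm (f n t - g t))\<^sup>2) \<le> e"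
    if N: "\<forall>m\<ge>N. \<forall>n\<ge>N. (LINT t|leb T. (norm (f m t - f n t))\<^sup>2) < e" and n: "n \<ge> N" for n N e
  proof -
    have 1: "(\<lambda>t. f n t - f (r k) t) \<in> L2 T" for k by (intro L2_diff f)
    have 2: "AE t in leb T. (\<lambda>k. f n t - f (r k) t) \<longlonglongrightarrow> f n t - g t"
      using lim by eventually_elim (intro tendsto_intros)
    have "(LINT t|leb T. (norm (f n t - f (r k) t))\<^sup>2) \<le> e" if "k \<ge> N" for k
      using N n that seq_suble[OF r(1), of k] by (meson le_trans less_imp_le)
    then have 3: "\<forall>\<^sub>F k in sequentially. (LINT t|leb T. (norm (f n t - f (r k) t))\<^sup>2) \<le> e"
      by (auto simp: eventually_sequentially)
    show ?thesis using L2_fatou[OF 1 _ 2 3] by simp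
  qed
  obtain N1 where "\<forall>m\<ge>N1. \<forall>n\<ge>N1. (LINT t|leb T. (norm (f m t - f n t))\<^sup>2) < 1"
    using Cau[of 1] by auto
  then have "(\<lambda>t. f N1 t - g t) \<in> L2 T" using key by blast
  then have "(\<lambda>t. f N1 t - (f N1 t - g t)) \<in> L2 T" by (rule L2_diff[OF f])
  then have gL2: "g \<in> L2 T" by simp
  have "(\<lambda>n. LINT t|leb T. (norm (f n t - g t))\<^sup>2) \<longlonglongrightarrow> 0"
  proof (rule LIMSEQ_I)
    fix e :: real assume "e > 0"
    then obtain N where "\<forall>m\<ge>N. \<forall>n\<ge>N. (LINT t|leb T. (norm (f m t - f n t))\<^sup>2) < e/2"
      using Cau[of "e/2"] by auto
    then have "(LINT t|leb T. (norm (f n t - g t))\<^sup>2) < e" if "n \<ge> N" for n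
      using key[of N "e/2" n] that \<open>e > 0\<close> by auto
    then show "\<exists>N. \<forall>n\<ge>N. norm ((LINT t|leb T. (norm (f n t - g t))\<^sup>2) - 0) < e" by auto
  qed
  with gL2 r(1) lim show ?thesis by (intro that)
qed

section \<open>The fundamental lemma of the calculus of variations\<close>

lemma C1_differentiable_onI:
  assumes "\<And>x. (f has_real_derivative f' x) (at x)" "continuous_on UNIV f'"
  shows "f C1_differentiable_on UNIV"
  unfolding C1_differentiable_on_def
  using assms by (auto simp: has_real_derivative_iff_has_vector_derivative)

lemma C1_differentiable_onD:
  fixes f :: "real \<Rightarrow> real"
  assumes "f C1_differentiable_on UNIV"
  shows "(f has_real_derivative deriv f x) (at x)" "continuous_on UNIV (deriv f)"
proof -
  obtain D where D: "\<And>x. (f has_real_derivative D x) (at x)" "continuous_on UNIV D"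
    using assms unfolding C1_differentiable_on_def
    by (auto simp: has_real_derivative_iff_has_vector_derivative)
  moreover have "deriv f = D" using D(1) by (auto intro: DERIV_imp_deriv)
  ultimately show "(f has_real_derivative deriv f x) (at x)" "continuous_on UNIV (deriv f)" by auto
qed

section \<open>C1 cutoff functions and the indicators of intervals\<close>

lemma DERIV_max_0_square: "((\<lambda>x::real. (max 0 x)\<^sup>2) has_real_derivative 2 * max 0 x) (at x)"
proof -
  consider "x < 0" | "x = 0" | "x > 0" by linarith
  then show ?thesis
  proof cases
    case 1
    have "((\<lambda>x::real. 0) has_real_derivative 0) (at x)" by simp
    then have "((\<lambda>x::real. (max 0 x)\<^sup>2) has_real_derivative 0) (at x)"
      by (rule has_field_derivative_transform_within_open[where S="{..<0}"]) (use 1 in auto)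
    with 1 show ?thesis by simp
  next
    case 2
    have "((\<lambda>h. (max 0 h)\<^sup>2 / h) \<longlongrightarrow> 0) (at (0::real))"
    proof (rule Lim_null_comparison)
      show "\<forall>\<^sub>F h in at 0. norm ((max 0 h)\<^sup>2 / h) \<le> \<bar>h::real\<bar>"
        by (rule always_eventually) (auto simp: max_def power2_eq_square)
      show "((\<lambda>h. \<bar>h\<bar>) \<longlongrightarrow> 0) (at (0::real))"
        using tendsto_rabs[OF tendsto_ident_at[of "0::real" UNIV]] by simp
    qed
    with 2 show ?thesis by (simp add: DERIV_def)
  next
    case 3
    have "((\<lambda>x::real. x\<^sup>2) has_real_derivative 2 * x) (at x)"
      by (auto intro!: derivative_eq_intros)
    then have "((\<lambda>x::real. (max 0 x)\<^sup>2) has_real_derivative 2 * x) (at x)"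
      by (rule has_field_derivative_transform_within_open[where S="{0<..}"]) (use 3 in auto)
    with 3 show ?thesis by simp
  qed
qed

text \<open>The product \<open>q\<close> of the squared positive parts is C1 and is positive exactly
  on \<open>{a<..<b}\<close>. Hence \<open>1 - 1 / (1 + k * q)\<close> is C1, takes values in [0,1),
  and tends to 1 as \<open>k\<close> grows wherever \<open>q\<close> is positive. Test functions are
  only asked to be C1, so this rational expression replaces a smooth mollifier.\<close>

lemma C1_bump:
  fixes a b k :: real
  assumes "k \<ge> 0"
  shows "(\<lambda>t. 1 - 1 / (1 + k * ((max 0 (t - a))\<^sup>2 * (max 0 (b - t))\<^sup>2))) C1_differentiable_on UNIV"
proof -
  define q where "q t = (max 0 (t - a))\<^sup>2 * (max 0 (b - t))\<^sup>2" for t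
  define D where "D t = 2 * max 0 (t - a) * (max 0 (b - t))\<^sup>2 - (max 0 (t - a))\<^sup>2 * (2 * max 0 (b - t))" for t
  have pos: "1 + k * q t > 0" for t using assms by (intro add_pos_nonneg) (auto simp: q_def)
  have q[derivative_intros]: "(q has_real_derivative D t) (at t)" for t
  proof -
    have "((\<lambda>t. t - a) has_real_derivative 1) (at t)" "((\<lambda>t. b - t) has_real_derivative - 1) (at t)"
      by (auto intro!: derivative_eq_intros)
    from DERIV_mult[OF this[THEN DERIV_chain'[OF _ DERIV_max_0_square]]]
    show ?thesis by (simp add: algebra_simps q_def[abs_def] D_def)
  qed
  have "(\<lambda>t. 1 - 1 / (1 + k * q t)) C1_differentiable_on UNIV"
  proof (rule C1_differentiable_onI[where f'="\<lambda>t. k * D t / (1 + k * q t)\<^sup>2"])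
    show "((\<lambda>t. 1 - 1 / (1 + k * q t)) has_real_derivative k * D t / (1 + k * q t)\<^sup>2) (at t)" for t
      using pos[of t] by (auto intro!: derivative_eq_intros q simp: power2_eq_square)
    have "continuous_on UNIV q" "continuous_on UNIV D"
      unfolding q_def[abs_def] D_def[abs_def] by (intro continuous_intros)+
    then show "continuous_on UNIV (\<lambda>t. k * D t / (1 + k * q t)\<^sup>2)"
      using pos by (intro continuous_intros) (auto simp: less_imp_neq[THEN not_sym])
  qed
  then show ?thesis by (simp add: q_def)
qed

text \<open>The shift by \<open>1 / Suc k\<close> keeps the support in a compact subset of the open
  interval \<open>{a<..<b}\<close>, even for \<open>a = 0\<close> or \<open>b = T\<close>; the
  weight \<open>k\<close> pushes the values inside up to 1.\<close>

definition bump :: "real \<Rightarrow> real \<Rightarrow> nat \<Rightarrow> real \<Rightarrow> real" where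
  "bump a b k t = 1 - 1 / (1 + real k *
     ((max 0 (t - (a + 1 / Suc k)))\<^sup>2 * (max 0 (b - 1 / Suc k - t))\<^sup>2))"

lemma bump_bounds: "0 \<le> bump a b k t" "bump a b k t \<le> 1"
  by (auto simp: bump_def divide_le_eq_1 add_pos_nonneg)

lemma bump_test_function:
  assumes "0 \<le> a" "b \<le> T"
  shows "bump a b k \<in> test_functions T"
  unfolding test_functions_def
\<comment> \<open>For small \<open>k\<close> the end points may cross. The compact set is then
  empty, and so is the region where both squared factors are positive.\<close>
proof (intro CollectI conjI exI[where x="{a + 1 / Suc k .. b - 1 / Suc k}"] allI impI)
  show "bump a b k C1_differentiable_on UNIV"
    unfolding bump_def[abs_def] by (rule C1_bump) simp
  show "{a + 1 / Suc k .. b - 1 / Suc k} \<subseteq> {0<..<T}"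
  proof
    fix x assume "x \<in> {a + 1 / Suc k .. b - 1 / Suc k}"
    moreover have "1 / real (Suc k) > 0" by simp
    ultimately show "x \<in> {0<..<T}" using assms unfolding atLeastAtMost_iff greaterThanLessThan_iff by linarith
  qed
  show "bump a b k t = 0" if "t \<notin> {a + 1 / Suc k .. b - 1 / Suc k}" for t
    using that by (auto simp: bump_def max_def not_le)
qed auto

text \<open>At an inner point the product of the squared factors has a positive limit, so
  \<open>k\<close> times it tends to infinity. Elsewhere one factor is 0 for every
  \<open>k\<close>.\<close>

lemma bump_tendsto: "(\<lambda>k. bump a b k t) \<longlonglongrightarrow> indicator {a<..<b} t"
proof (cases "t \<in> {a<..<b}")
  case True
  let ?q = "\<lambda>k. (max 0 (t - (a + 1 / Suc k)))\<^sup>2 * (max 0 (b - 1 / Suc k - t))\<^sup>2"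
  have "?q \<longlonglongrightarrow> (max 0 (t - (a + 0)))\<^sup>2 * (max 0 (b - 0 - t))\<^sup>2"
    by (intro tendsto_intros LIMSEQ_Suc[OF lim_1_over_n])
  then have "?q \<longlonglongrightarrow> (t - a)\<^sup>2 * (b - t)\<^sup>2" using True by (simp add: max_def)
  then have "filterlim (\<lambda>k. ?q k * real k) at_top sequentially"
    using True by (intro filterlim_tendsto_pos_mult_at_top[OF _ _ filterlim_real_sequentially]) auto
  then have "filterlim (\<lambda>k. 1 + real k * ?q k) at_top sequentially"
    by (intro filterlim_tendsto_add_at_top[OF tendsto_const]) (simp add: mult.commute)
  then have "(\<lambda>k. 1 - inverse (1 + real k * ?q k)) \<longlonglongrightarrow> 1 - 0"
    by (intro tendsto_intros tendsto_inverse_0_at_top)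
  then show ?thesis using True by (simp add: bump_def inverse_eq_divide)
next
  case False
  have "bump a b k t = 0" for k
  proof -
    have "t - (a + 1 / Suc k) \<le> 0 \<or> b - 1 / Suc k - t \<le> 0"
    proof (cases "t \<le> a")
      case True then show ?thesis by (simp add: add_increasing2)
    next
      case ta: False then have "b \<le> t" using False by auto
      moreover have "1 / real (Suc k) > 0" by simp
      ultimately show ?thesis by linarith
    qed
    then show ?thesis by (auto simp: bump_def max_def)
  qed
  then show ?thesis using False by simp
qed

lemma test_functions_bounded:
  assumes "\<phi> \<in> test_functions T"
  obtains M where "\<And>t. \<bar>\<phi> t\<bar> \<le> M" "\<And>t. \<bar>deriv \<phi> t\<bar> \<le> M"
proof -
  obtain K where C1: "\<phi> C1_differentiable_on UNIV" and K: "compact K" "K \<subseteq> {0<..<T}" "\<And>t. t \<notin> K \<Longrightarrow> \<phi> t = 0"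
    using assms by (auto simp: test_functions_def)
  note D = C1_differentiable_onD[OF C1]
  have cont: "continuous_on UNIV \<phi>"
    by (intro continuous_at_imp_continuous_on ballI DERIV_isCont[OF D(1)])
  have "bounded (\<phi> ` K)" "bounded (deriv \<phi> ` K)"
    using cont D(2) K(1) by (auto intro!: compact_imp_bounded compact_continuous_image intro: continuous_on_subset)
  then obtain M1 M2 where M: "\<And>t. t \<in> K \<Longrightarrow> \<bar>\<phi> t\<bar> \<le> M1" "\<And>t. t \<in> K \<Longrightarrow> \<bar>deriv \<phi> t\<bar> \<le> M2"
    by (auto simp: bounded_iff)
  \<comment> \<open>The complement of \<open>K\<close> is open and \<open>\<phi>\<close> vanishes on
    it, so bounds on \<open>K\<close> are global bounds for the derivative as well.\<close>
  have "deriv \<phi> t = 0" if "t \<notin> K" for t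
  proof -
    have "((\<lambda>x::real. 0) has_real_derivative 0) (at t)" by simp
    then have "(\<phi> has_real_derivative 0) (at t)"
      by (rule has_field_derivative_transform_within_open[where S="- K"])
        (use K that in \<open>auto simp: compact_imp_closed open_Compl\<close>)
    then show ?thesis by (rule DERIV_imp_deriv)
  qed
  then have "\<bar>\<phi> t\<bar> \<le> max 0 (max M1 M2)" "\<bar>deriv \<phi> t\<bar> \<le> max 0 (max M1 M2)" for t
    using M[of t] K(3)[of t] by (cases "t \<in> K"; force)+
  then show ?thesis by (rule that)
qed

lemma borel_measurable_leb: "f \<in> borel_measurable borel \<Longrightarrow> f \<in> borel_measurable (leb T)"
  by (simp add: measurable_completion measurable_restrict_space1)

lemma test_functions_integrable_scaleR:
  fixes v :: "real \<Rightarrow> 'a::euclidean_space"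
  assumes \<phi>: "\<phi> \<in> test_functions T" and v: "integrable (leb T) v"
  shows "integrable (leb T) (\<lambda>t. \<phi> t *\<^sub>R v t)" "integrable (leb T) (\<lambda>t. deriv \<phi> t *\<^sub>R v t)"
proof -
  have C1: "\<phi> C1_differentiable_on UNIV" using \<phi> by (auto simp: test_functions_def)
  note D = C1_differentiable_onD[OF C1]
  have cont: "continuous_on UNIV \<phi>"
    by (intro continuous_at_imp_continuous_on ballI DERIV_isCont[OF D(1)])
  have m: "f \<in> borel_measurable (leb T)" if "continuous_on UNIV f" for f :: "real \<Rightarrow> real"
    by (intro borel_measurable_leb borel_measurable_continuous_onI that)
  obtain M where M: "\<And>t. \<bar>\<phi> t\<bar> \<le> M" "\<And>t. \<bar>deriv \<phi> t\<bar> \<le> M"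
    using test_functions_bounded[OF \<phi>] by blast
  have *: "integrable (leb T) (\<lambda>t. f t *\<^sub>R v t)" if "continuous_on UNIV f" "\<And>t. \<bar>f t\<bar> \<le> M" for f
  proof (rule Bochner_Integration.integrable_bound)
    show "integrable (leb T) (\<lambda>t. M *\<^sub>R v t)" using v by simp
    show "(\<lambda>t. f t *\<^sub>R v t) \<in> borel_measurable (leb T)"
      using v m[OF that(1)] by measurable
    show "AE t in leb T. norm (f t *\<^sub>R v t) \<le> norm (M *\<^sub>R v t)"
      using order_trans[OF that(2) abs_ge_self] by (auto intro!: mult_right_mono)
  qed
  show "integrable (leb T) (\<lambda>t. \<phi> t *\<^sub>R v t)" "integrable (leb T) (\<lambda>t. deriv \<phi> t *\<^sub>R v t)"
    using * cont D(2) M by auto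
qed

lemma sets_leb_borel: "A \<in> sets borel \<Longrightarrow> A \<inter> {0<..<T} \<in> sets (leb T)"
  by (simp add: sets_restrict_space_iff)

lemma indicator_integrable:
  fixes w :: "real \<Rightarrow> 'a::euclidean_space"
  assumes "integrable (leb T) w" "A \<in> sets borel"
  shows "integrable (leb T) (\<lambda>t. indicator A t *\<^sub>R w t)"
proof (rule Bochner_Integration.integrable_bound[OF assms(1)])
  have [measurable]: "(indicator A :: real \<Rightarrow> real) \<in> borel_measurable (leb T)"
    using assms by (intro borel_measurable_leb) simp
  show "(\<lambda>t. indicator A t *\<^sub>R w t) \<in> borel_measurable (leb T)" using assms(1) by measurable
qed (simp add: indicator_def)

text \<open>A Dynkin system argument: open intervals are stable under intersection and generate the
  Borel sets, so the integral of \<open>w\<close> vanishes over every Borel set and, up to null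
  sets, over every Lebesgue measurable one. A function whose integrals over all measurable sets
  vanish is zero almost everywhere.\<close>

lemma AE_zero_if_interval_integrals:
  fixes w :: "real \<Rightarrow> 'a::euclidean_space"
  assumes int: "integrable (leb T) w"
    and zero: "\<And>a b. 0 \<le> a \<Longrightarrow> b \<le> T \<Longrightarrow> (LINT t|leb T. indicator {a<..<b} t *\<^sub>R w t) = 0"
  shows "AE t in leb T. w t = 0"
proof -
  define I where "I A = (LINT t|leb T. indicator A t *\<^sub>R w t)" for A
  have box: "I {a<..<b} = 0" for a b
  proof -
    have "I {a<..<b} = I {max 0 a<..<min T b}"
      unfolding I_def by (rule Bochner_Integration.integral_cong) (auto simp: indicator_def)
    then show ?thesis using zero[of "max 0 a" "min T b"] by (simp add: I_def)
  qed
  \<comment> \<open>The induction takes complements in the whole line, so the total integral has to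
    vanish too.\<close>
  have UNIV0: "I UNIV = 0"
  proof -
    have "I UNIV = I {0<..<T}"
      unfolding I_def by (rule Bochner_Integration.integral_cong) (auto simp: indicator_def)
    then show ?thesis by (simp add: box)
  qed
  have eq: "borel = sigma UNIV (range (\<lambda>(a, b). {a<..<b::real}))"
    using borel_eq_box[where 'a=real] by (simp add: box_real)
  have borel: "I A = 0" if "A \<in> sets borel" for A
  proof -
    let ?G = "range (\<lambda>(a, b). {a<..<b::real})"
    have sets: "sets borel = sigma_sets UNIV ?G" by (subst eq) (simp add: sets_measure_of)
    have "{a<..<b} \<inter> {c<..<d} \<in> ?G" for a b c d :: real
      by (rule image_eqI[of _ _ "(max a c, min b d)"]) auto
    then have "Int_stable ?G" by (auto simp: Int_stable_def)
    moreover have "?G \<subseteq> Pow UNIV" by simp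
    moreover have "A \<in> sigma_sets UNIV ?G" using that by (simp only: sets)
    ultimately show ?thesis
    proof (induction rule: sigma_sets_induct_disjoint)
      case (basic A) then show ?case by (auto simp: box)
    next
      case empty then show ?case by (simp add: I_def)
    next
      case (compl A)
      have A: "A \<in> sets borel" using compl(1) by (simp only: sets)
      have "I (UNIV - A) = (LINT t|leb T. indicator UNIV t *\<^sub>R w t - indicator A t *\<^sub>R w t)"
        unfolding I_def by (rule Bochner_Integration.integral_cong) (auto simp: indicator_def)
      also have "\<dots> = I UNIV - I A"
        unfolding I_def by (intro Bochner_Integration.integral_diff indicator_integrable int A) simp
      finally have "I (UNIV - A) = I UNIV - I A" .
      then show ?case using compl UNIV0 by simp
    next
      case (union A)
      let ?A = "\<lambda>i. A i \<inter> {0<..<T}"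
      have A: "A i \<in> sets borel" for i
      proof -
        have "A i \<in> sigma_sets UNIV ?G" using union(2) by blast
        then show ?thesis by (simp only: sets)
      qed
      have *: "(LINT t:B \<inter> {0<..<T}|leb T. w t) = I B" for B
        unfolding set_lebesgue_integral_def I_def
        by (rule Bochner_Integration.integral_cong) (auto simp: indicator_def)
      have "(LINT t:(\<Union>i. ?A i)|leb T. w t) = (\<Sum>i. (LINT t:?A i|leb T. w t))"
      proof (rule lebesgue_integral_countable_add)
        show "?A i \<in> sets (leb T)" for i by (intro sets_leb_borel A)
        show "?A i \<inter> ?A j = {}" if "i \<noteq> j" for i j
          using union(1) that by (auto simp: disjoint_family_on_def)
        show "set_integrable (leb T) (\<Union>i. ?A i) w"
          unfolding set_integrable_def using A int
          by (intro indicator_integrable) (auto intro!: sets.countable_UN)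
      qed
      moreover have "(\<Union>i. ?A i) = (\<Union>i. A i) \<inter> {0<..<T}" by blast
      ultimately have "I (\<Union>i. A i) = (\<Sum>i. I (A i))" by (simp only: *)
      also have "\<dots> = 0" by (simp only: union(3) suminf_zero)
      finally show ?case .
    qed
  qed
  show ?thesis
  proof (rule leb.density_zero[OF int])
    fix A assume "A \<in> sets (leb T)"
    then have A: "A \<in> sets lebesgue" "A \<subseteq> {0<..<T}" by (auto simp: sets_restrict_space_iff)
    \<comment> \<open>A Lebesgue measurable set is an F-sigma set, hence a Borel set, up to a null
      set.\<close>
    obtain B N where B: "fsigma B" "N \<in> null_sets lebesgue" "B \<union> N = A"
      using lebesgue_set_almost_fsigma[OF A(1)] by metis
    have "B \<in> sets borel" using B(1)
    proof cases
      case (1 F)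
      then show ?thesis by (auto intro!: sets.countable_UN borel_closed)
    qed
    have "N \<subseteq> {0<..<T}" using B(3) A(2) by blast
    then have "N \<in> null_sets (leb T)"
      using B(2) by (simp add: null_sets_restrict_space)
    then have "AE t in leb T. t \<notin> N" by (rule AE_not_in)
    have "(LINT t:A|leb T. w t) = I B"
      unfolding set_lebesgue_integral_def I_def
    proof (rule integral_cong_AE)
      show "(\<lambda>t. indicator B t *\<^sub>R w t) \<in> borel_measurable (leb T)"
        by (intro borel_measurable_integrable indicator_integrable int) fact
      show "(\<lambda>t. indicat_real A t *\<^sub>R w t) \<in> borel_measurable (leb T)"
        using \<open>A \<in> sets (leb T)\<close> int by measurable
      show "AE t in leb T. indicat_real A t *\<^sub>R w t = indicat_real B t *\<^sub>R w t"
        using \<open>AE t in leb T. t \<notin> N\<close> by eventually_elim (use B(3) in \<open>auto simp: indicator_def\<close>)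
    qed
    also have "I B = 0" by (rule borel) fact
    finally show "(LINT t:A|leb T. w t) = 0" .
  qed
qed

text \<open>The bumps have values in [0,1] and converge pointwise to the indicator of an interval;
  dominated convergence with majorant \<open>norm (w t)\<close> reduces the claim to integrals over
  intervals.\<close>

theorem fundamental_lemma:
  fixes w :: "real \<Rightarrow> 'a::euclidean_space"
  assumes int: "integrable (leb T) w"
    and zero: "\<And>\<phi>. \<phi> \<in> test_functions T \<Longrightarrow> (LINT t|leb T. \<phi> t *\<^sub>R w t) = 0"
  shows "AE t in leb T. w t = 0"
proof (rule AE_zero_if_interval_integrals[OF int])
  fix a b :: real assume ab: "0 \<le> a" "b \<le> T"
  have "(\<lambda>k. LINT t|leb T. bump a b k t *\<^sub>R w t) \<longlonglongrightarrow> (LINT t|leb T. indicator {a<..<b} t *\<^sub>R w t)"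
  proof (rule integral_dominated_convergence[where w="\<lambda>t. norm (w t)"])
    show "AE t in leb T. (\<lambda>k. bump a b k t *\<^sub>R w t) \<longlonglongrightarrow> indicator {a<..<b} t *\<^sub>R w t"
      by (intro AE_I2 tendsto_intros bump_tendsto)
    show "AE t in leb T. norm (bump a b k t *\<^sub>R w t) \<le> norm (w t)" for k
      using bump_bounds[of a b k] by (auto intro!: mult_left_le_one_le)
    show "(\<lambda>t. bump a b k t *\<^sub>R w t) \<in> borel_measurable (leb T)" for k
      by (intro borel_measurable_integrable test_functions_integrable_scaleR(1) bump_test_function ab int)
    show "(\<lambda>t. indicat_real {a<..<b} t *\<^sub>R w t) \<in> borel_measurable (leb T)"
      by (intro borel_measurable_integrable indicator_integrable int) simp
  qed (use int in simp)
  moreover have "(LINT t|leb T. bump a b k t *\<^sub>R w t) = 0" for k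
    by (intro zero bump_test_function ab)
  ultimately show "(LINT t|leb T. indicator {a<..<b} t *\<^sub>R w t) = 0"
    by (simp add: LIMSEQ_const_iff)
qed

section \<open>Primitives and integration by parts\<close>

text \<open>The integral from 0 to \<open>t\<close>, written with an indicator inside the integral
  over the full interval. It is thus defined for all real \<open>t\<close>, constant to the left of
  0 and to the right of T, and open to Fubini and dominated convergence.\<close>

definition prim :: "real \<Rightarrow> (real \<Rightarrow> 'a::euclidean_space) \<Rightarrow> real \<Rightarrow> 'a" where
  "prim T w t = (LINT s|leb T. indicator {..t} s *\<^sub>R w s)"

lemma prim_eq_strict: 
  fixes w :: "real \<Rightarrow> 'a::euclidean_space"
  assumes w: "integrable (leb T) w"
  shows "(LINT s|leb T. indicator {..<t} s *\<^sub>R w s) = prim T w t"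
  unfolding prim_def
proof (rule integral_cong_AE)
  have "{t} \<in> null_sets lebesgue" by simp
  then have "AE s in lebesgue. s \<notin> {t}" by (rule AE_not_in)
  then have "AE s in leb T. s \<noteq> t" by (simp add: AE_restrict_space_iff eventually_mono)
  then show "AE s in leb T. indicat_real {..<t} s *\<^sub>R w s = indicat_real {..t} s *\<^sub>R w s"
    by eventually_elim (auto simp: indicator_def)
qed (intro borel_measurable_integrable indicator_integrable w; simp)+

lemma prim_norm_le:
  assumes "integrable (leb T) w"
  shows "norm (prim T w t) \<le> (LINT s|leb T. norm (w s))"
proof -
  have "norm (prim T w t) \<le> (LINT s|leb T. norm (indicator {..t} s *\<^sub>R w s))"
    unfolding prim_def by (rule integral_norm_bound)
  also have "\<dots> \<le> (LINT s|leb T. norm (w s))"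
    by (intro integral_mono integrable_norm indicator_integrable assms) (auto simp: indicator_def)
  finally show ?thesis .
qed

lemma prim_add_scaleR:
  assumes "integrable (leb T) v" "integrable (leb T) w"
  shows "prim T (\<lambda>s. v s + c *\<^sub>R w s) t = prim T v t + c *\<^sub>R prim T w t"
proof -
  have "prim T (\<lambda>s. v s + c *\<^sub>R w s) t = (LINT s|leb T. indicator {..t} s *\<^sub>R v s + c *\<^sub>R (indicator {..t} s *\<^sub>R w s))"
    unfolding prim_def by (intro Bochner_Integration.integral_cong) (auto simp: indicator_def)
  also have "\<dots> = (LINT s|leb T. indicator {..t} s *\<^sub>R v s) + (LINT s|leb T. c *\<^sub>R (indicator {..t} s *\<^sub>R w s))"
    by (intro Bochner_Integration.integral_add integrable_scaleR_right indicator_integrable assms) auto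
  finally show ?thesis by (simp only: prim_def integral_scaleR_right)
qed

lemma prim_right_end: "t \<ge> T \<Longrightarrow> prim T w t = (LINT s|leb T. w s)"
  unfolding prim_def by (intro Bochner_Integration.integral_cong) auto

lemma prim_left_end: "t \<le> 0 \<Longrightarrow> prim T w t = 0"
  unfolding prim_def
  by (subst Bochner_Integration.integral_cong[where g="\<lambda>_. 0"]) (auto simp: indicator_def)

text \<open>For each \<open>s \<noteq> t\<close> the value at \<open>s\<close> of the indicator of
  \<open>{..u n}\<close> is eventually constant, and the single point \<open>t\<close> is null; so
  dominated convergence applies.\<close>

lemma continuous_on_prim:
  fixes w :: "real \<Rightarrow> 'a::euclidean_space"
  assumes w: "integrable (leb T) w"
  shows "continuous_on UNIV (prim T w)"
proof (rule continuous_at_imp_continuous_on, rule ballI)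
  fix t :: real
  show "isCont (prim T w) t"
  proof (rule continuous_at_sequentiallyI)
    fix u :: "nat \<Rightarrow> real" assume u: "u \<longlonglongrightarrow> t"
    have "{t} \<in> null_sets lebesgue" by simp
    then have "AE s in lebesgue. s \<notin> {t}" by (rule AE_not_in)
    then have nt: "AE s in leb T. s \<noteq> t" by (simp add: AE_restrict_space_iff eventually_mono)
    show "(\<lambda>n. prim T w (u n)) \<longlonglongrightarrow> prim T w t"
      unfolding prim_def
    proof (rule integral_dominated_convergence[where w="\<lambda>s. norm (w s)"])
      show "AE s in leb T. (\<lambda>n. indicat_real {..u n} s *\<^sub>R w s) \<longlonglongrightarrow> indicat_real {..t} s *\<^sub>R w s"
        using nt
      proof eventually_elim
        case (elim s)
        have "\<forall>\<^sub>F n in sequentially. indicat_real {..u n} s *\<^sub>R w s = indicat_real {..t} s *\<^sub>R w s"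
        proof (cases "s < t")
          case True
          from order_tendstoD(1)[OF u this] show ?thesis
            by eventually_elim (use True in \<open>auto simp: indicator_def\<close>)
        next
          case False
          with elim have "t < s" by simp
          from order_tendstoD(2)[OF u this] show ?thesis
            by eventually_elim (use \<open>t < s\<close> in \<open>auto simp: indicator_def\<close>)
        qed
        then show ?case by (rule tendsto_eventually)
      qed
      show "AE s in leb T. norm (indicat_real {..u n} s *\<^sub>R w s) \<le> norm (w s)" for n
        by (auto simp: indicator_def)
    qed (use w in \<open>auto intro!: borel_measurable_integrable indicator_integrable\<close>)
  qed
qed

lemma prim_measurable: 
  assumes "integrable (leb T) w"
  shows "prim T w \<in> borel_measurable (leb T)"
  by (intro borel_measurable_leb borel_measurable_continuous_onI continuous_on_prim assms)

lemma prim_integrable: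
  assumes "integrable (leb T) w"
  shows "integrable (leb T) (prim T w)"
  by (rule leb.integrable_const_bound[where B="LINT s|leb T. norm (w s)"])
    (auto intro: prim_norm_le prim_measurable assms)

section \<open>Fubini on the square and the product rule for primitives\<close>

interpretation leb_pair: pair_sigma_finite "leb T" "leb T" for T
  by unfold_locales

text \<open>A general bounded bilinear \<open>h\<close> serves both uses made later: test function
  times vector, and matrix times vector. The bound \<open>norm a * norm b * K\<close> separates the
  variables, which gives joint integrability.\<close>

lemma integrable_bilinear_pair:
  fixes h :: "'a::euclidean_space \<Rightarrow> 'b::euclidean_space \<Rightarrow> 'c::euclidean_space"
  assumes bil: "bounded_bilinear h" and f: "integrable (leb T) f" and g: "integrable (leb T) g"
  shows "integrable (leb T \<Otimes>\<^sub>M leb T) (\<lambda>(s, t). h (f s) (g t))"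
proof -
  interpret h: bounded_bilinear h by fact
  obtain K where K: "\<And>a b. norm (h a b) \<le> norm a * norm b * K" using h.bounded by blast
  have [measurable]: "f \<in> borel_measurable (leb T)" "g \<in> borel_measurable (leb T)" using f g by auto
  have "integrable (leb T \<Otimes>\<^sub>M leb T) (\<lambda>(s, t). norm (f s) * norm (g t))"
  proof (rule leb_pair.Fubini_integrable)
    show "integrable (leb T) (\<lambda>x. LINT y|leb T. norm (case (x, y) of (s, t) \<Rightarrow> norm (f s) * norm (g t)))"
      using integrable_norm[OF f] by simp
    show "AE x in leb T. integrable (leb T) (\<lambda>y. case (x, y) of (s, t) \<Rightarrow> norm (f s) * norm (g t))"
      using integrable_norm[OF g] by simp
  qed measurable
  then have "integrable (leb T \<Otimes>\<^sub>M leb T) (\<lambda>p. (case p of (s, t) \<Rightarrow> norm (f s) * norm (g t)) * K)"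
    by simp
  then show ?thesis
  proof (rule Bochner_Integration.integrable_bound)
    have "continuous_on UNIV (\<lambda>p. h (fst p) (snd p))"
      by (intro continuous_at_imp_continuous_on ballI h.continuous continuous_intros)
    then have h: "(\<lambda>p. h (fst p) (snd p)) \<in> borel_measurable borel"
      by (rule borel_measurable_continuous_onI)
    have "(\<lambda>p. (f (fst p), g (snd p))) \<in> borel_measurable (leb T \<Otimes>\<^sub>M leb T)"
      by (intro borel_measurable_Pair) measurable
    from measurable_compose[OF this h]
    have "(\<lambda>p. h (f (fst p)) (g (snd p))) \<in> borel_measurable (leb T \<Otimes>\<^sub>M leb T)" by simp
    then show "(\<lambda>(s, t). h (f s) (g t)) \<in> borel_measurable (leb T \<Otimes>\<^sub>M leb T)"
      by (simp add: split_beta')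
    show "AE p in leb T \<Otimes>\<^sub>M leb T. norm (case p of (s, t) \<Rightarrow> h (f s) (g t))
        \<le> norm ((case p of (s, t) \<Rightarrow> norm (f s) * norm (g t)) * K)"
      by (auto intro: order_trans[OF K abs_ge_self])
  qed
qed

text \<open>Fubini on the two triangles \<open>s \<le> t\<close> and \<open>s > t\<close> of the square.\<close>
lemma integral_by_parts:
  fixes h :: "'a::euclidean_space \<Rightarrow> 'b::euclidean_space \<Rightarrow> 'c::euclidean_space"
  assumes bil: "bounded_bilinear h" and f: "integrable (leb T) f" and g: "integrable (leb T) g"
  shows "integrable (leb T) (\<lambda>t. h (prim T f t) (g t))" "integrable (leb T) (\<lambda>t. h (f t) (prim T g t))"
    "h (LINT t|leb T. f t) (LINT t|leb T. g t) =
      (LINT t|leb T. h (prim T f t) (g t)) + (LINT t|leb T. h (f t) (prim T g t))"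
proof -
  interpret h: bounded_bilinear h by fact
  let ?P = "leb T \<Otimes>\<^sub>M leb T"
  let ?H = "\<lambda>(s, t). h (f s) (g t)"
  let ?L = "\<lambda>(s, t). indicator {..t} s *\<^sub>R h (f s) (g t)"
  let ?U = "\<lambda>(s, t). indicator {..<s} t *\<^sub>R h (f s) (g t)"
  note H = integrable_bilinear_pair[OF bil f g]
  have id: "(\<lambda>x. x) \<in> borel_measurable (leb T)" by (intro borel_measurable_leb) simp
  have [measurable]: "(\<lambda>p. fst p) \<in> borel_measurable ?P" "(\<lambda>p. snd p) \<in> borel_measurable ?P"
    using measurable_compose[OF measurable_fst id] measurable_compose[OF measurable_snd id] by auto
  have "{p \<in> space ?P. fst p \<le> snd p} \<in> sets ?P" "{p \<in> space ?P. snd p < fst p} \<in> sets ?P"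
    by measurable
  from this[THEN integrable_mult_indicator, OF H]
  have "integrable ?P (\<lambda>p. indicator {p \<in> space ?P. fst p \<le> snd p} p *\<^sub>R ?H p)"
    "integrable ?P (\<lambda>p. indicator {p \<in> space ?P. snd p < fst p} p *\<^sub>R ?H p)" .
  moreover have "indicator {p \<in> space ?P. fst p \<le> snd p} p *\<^sub>R ?H p = ?L p"
    "indicator {p \<in> space ?P. snd p < fst p} p *\<^sub>R ?H p = ?U p" if "p \<in> space ?P" for p
    using that by (auto simp: indicator_def split_beta)
  ultimately have L: "integrable ?P ?L" and U: "integrable ?P ?U"
    by (simp_all cong: Bochner_Integration.integrable_cong)
  \<comment> \<open>On the triangle \<open>s \<le> t\<close> the integral over \<open>s\<close> is
    taken first and produces the primitive of \<open>f\<close>; on the other triangle the integral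
    over \<open>t\<close> comes first and produces the primitive of \<open>g\<close>, up to the null
    set \<open>{s}\<close>.\<close>
  have inner_L: "(LINT s|leb T. ?L (s, t)) = h (prim T f t) (g t)" for t
  proof -
    have "(LINT s|leb T. h (indicator {..t} s *\<^sub>R f s) (g t)) = h (prim T f t) (g t)"
      unfolding prim_def
      by (intro integral_bounded_linear h.bounded_linear_left indicator_integrable f) simp
    then show ?thesis by (simp add: h.scaleR_left)
  qed
  have inner_U: "(LINT t|leb T. ?U (s, t)) = h (f s) (prim T g s)" for s
  proof -
    have "(LINT t|leb T. h (f s) (indicator {..<s} t *\<^sub>R g t)) = h (f s) (prim T g s)"
      unfolding prim_eq_strict[OF g, symmetric]
      by (intro integral_bounded_linear h.bounded_linear_right indicator_integrable g) simp
    then show ?thesis by (simp add: h.scaleR_right)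
  qed
  show 1: "integrable (leb T) (\<lambda>t. h (prim T f t) (g t))"
    using leb_pair.integrable_snd[OF L] inner_L by (simp add: split_beta)
  show 2: "integrable (leb T) (\<lambda>t. h (f t) (prim T g t))"
    using leb_pair.integrable_fst[OF U] inner_U by simp
  have "h (LINT t|leb T. f t) (LINT t|leb T. g t) = (LINT s|leb T. h (f s) (LINT t|leb T. g t))"
    by (intro integral_bounded_linear[symmetric] h.bounded_linear_left f)
  also have "\<dots> = (LINT s|leb T. LINT t|leb T. h (f s) (g t))"
    by (intro Bochner_Integration.integral_cong integral_bounded_linear[symmetric] h.bounded_linear_right g refl)
  also have "\<dots> = (LINT p|?P. ?H p)"
    using leb_pair.integral_fst'[OF H] by simp
  also have "\<dots> = (LINT p|?P. ?L p + ?U p)"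
    by (rule Bochner_Integration.integral_cong) (auto simp: indicator_def)
  also have "\<dots> = (LINT p|?P. ?L p) + (LINT p|?P. ?U p)"
    by (rule Bochner_Integration.integral_add[OF L U])
  also have "(LINT p|?P. ?L p) = (LINT t|leb T. h (prim T f t) (g t))"
    using leb_pair.integral_snd[OF L] inner_L by simp
  also have "(LINT p|?P. ?U p) = (LINT t|leb T. h (f t) (prim T g t))"
    using leb_pair.integral_fst'[OF U] inner_U by simp
  finally show "h (LINT t|leb T. f t) (LINT t|leb T. g t) =
      (LINT t|leb T. h (prim T f t) (g t)) + (LINT t|leb T. h (f t) (prim T g t))" .
qed

text \<open>Integration by parts over the whole interval, applied to \<open>f\<close> and
  \<open>g\<close> cut off at \<open>t\<close>. The cutoff does not change the primitives at points
  \<open>s \<le> t\<close>, and at later points the integrand is 0.\<close>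

lemma prim_product:
  fixes h :: "'a::euclidean_space \<Rightarrow> 'b::euclidean_space \<Rightarrow> 'c::euclidean_space"
  assumes bil: "bounded_bilinear h" and f: "integrable (leb T) f" and g: "integrable (leb T) g"
  shows "h (prim T f t) (prim T g t) = prim T (\<lambda>s. h (prim T f s) (g s) + h (f s) (prim T g s)) t"
proof -
  interpret h: bounded_bilinear h by fact
  let ?f = "\<lambda>s. indicator {..t} s *\<^sub>R f s" and ?g = "\<lambda>s. indicator {..t} s *\<^sub>R g s"
  have i: "integrable (leb T) ?f" "integrable (leb T) ?g" by (intro indicator_integrable f g; simp)+
  have restr: "indicator {..t} s *\<^sub>R prim T (\<lambda>s. indicator {..t} s *\<^sub>R w s) s = indicator {..t} s *\<^sub>R prim T w s"
    for w :: "real \<Rightarrow> 'd::euclidean_space" and s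
    unfolding prim_def
    by (auto simp: indicator_def intro!: Bochner_Integration.integral_cong)
  have "h (prim T f t) (prim T g t) = h (LINT s|leb T. ?f s) (LINT s|leb T. ?g s)"
    by (simp add: prim_def)
  also have "\<dots> = (LINT s|leb T. h (prim T ?f s) (?g s)) + (LINT s|leb T. h (?f s) (prim T ?g s))"
    by (rule integral_by_parts(3)[OF bil i])
  also have "\<dots> = (LINT s|leb T. h (prim T ?f s) (?g s) + h (?f s) (prim T ?g s))"
    by (rule Bochner_Integration.integral_add[symmetric]) (rule integral_by_parts[OF bil i])+
  also have "\<dots> = (LINT s|leb T. h (indicator {..t} s *\<^sub>R prim T ?f s) (g s) + h (f s) (indicator {..t} s *\<^sub>R prim T ?g s))"
    by (simp add: h.scaleR_left h.scaleR_right)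
  also have "\<dots> = prim T (\<lambda>s. h (prim T f s) (g s) + h (f s) (prim T g s)) t"
    unfolding restr by (simp add: prim_def h.scaleR_left h.scaleR_right scaleR_add_right)
  finally show ?thesis .
qed

section \<open>Weak derivatives and continuous representatives\<close>

lemma AE_leb_interval_witness:
  assumes P: "AE t in leb T. P t" and ab: "a < b" "0 \<le> a" "b \<le> T"
  obtains t where "a < t" "t < b" "P t"
proof -
  have "\<exists>t. a < t \<and> t < b \<and> P t"
  proof (rule ccontr)
    assume "\<not> (\<exists>t. a < t \<and> t < b \<and> P t)"
    then have "AE t in leb T. t \<notin> {a<..<b}" using P by (auto elim!: eventually_mono)
    moreover have "{a<..<b} \<in> sets (leb T)" using ab by (auto simp: sets_restrict_space_iff)
    ultimately have "{a<..<b} \<in> null_sets (leb T)" by (simp add: AE_iff_null_sets)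
    then have "emeasure (leb T) {a<..<b} = 0" by auto
    moreover have "emeasure (leb T) {a<..<b} = emeasure lebesgue {a<..<b}"
      using ab by (intro emeasure_restrict_space) auto
    ultimately show False using ab by simp
  qed
  then show ?thesis using that by blast
qed

text \<open>Equality almost everywhere holds on a dense subset, and continuity extends it to the
  closure. This reaches the end points 0 and T, which lie outside the open interval.\<close>

lemma continuous_eq_if_ae_eq:
  fixes g1 g2 :: "real \<Rightarrow> 'a::euclidean_space"
  assumes "T > 0" "continuous_on {0..T} g1" "continuous_on {0..T} g2" "ae_eq T g1 g2" "t \<in> {0..T}"
  shows "g1 t = g2 t"
proof -
  let ?S = "{t \<in> {0<..<T}. g1 t = g2 t}"
  have "closure ?S \<subseteq> {0..T}" by (rule closure_minimal) auto
  moreover have "t \<in> closure ?S"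
    unfolding closure_approachable
  proof (intro allI impI)
    fix e :: real assume "e > 0"
    then have "max 0 (t - e) < min T (t + e)" using assms by auto
    then obtain s where "max 0 (t - e) < s" "s < min T (t + e)" "g1 s = g2 s"
      using AE_leb_interval_witness[OF assms(4)[unfolded ae_eq_def], of "max 0 (t - e)" "min T (t + e)"] by auto
    then show "\<exists>s\<in>?S. dist s t < e" by (intro bexI[of _ s]) (auto simp: dist_real_def abs_if)
  qed
  moreover have "continuous_on {0..T} (\<lambda>t. g1 t - g2 t)"
    by (intro continuous_intros assms)
  ultimately have "g1 t - g2 t = 0"
    by (elim continuous_constant_on_closure[OF continuous_on_subset, rotated 3]) auto
  then show ?thesis by simp
qed

lemma ae_eq_sym: "ae_eq T v w \<Longrightarrow> ae_eq T w v"
  unfolding ae_eq_def by (auto elim!: eventually_mono)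

lemma ae_eq_trans: "ae_eq T u v \<Longrightarrow> ae_eq T v w \<Longrightarrow> ae_eq T u w"
  unfolding ae_eq_def by (auto elim: eventually_elim2)

lemma cont_rep_eqI:
  assumes T: "T > 0" and g: "continuous_on {0..T} g" "ae_eq T g v" and t: "t \<in> {0..T}"
  shows "cont_rep T v t = g t"
proof -
  have "continuous_on {0..T} (cont_rep T v) \<and> ae_eq T (cont_rep T v) v"
    unfolding cont_rep_def by (rule someI[where x=g]) (use g in auto)
  then show ?thesis
    using continuous_eq_if_ae_eq[OF T _ g(1) _ t] ae_eq_trans[OF _ ae_eq_sym[OF g(2)]] by blast
qed

lemma continuous_integrable_leb:
  fixes g :: "real \<Rightarrow> 'a::euclidean_space"
  assumes "continuous_on UNIV g"
  shows "integrable (leb T) g"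
proof -
  have "bounded (g ` {0..T})"
    by (intro compact_imp_bounded compact_continuous_image continuous_on_subset[OF assms]) auto
  then obtain B where "\<forall>x \<in> g ` {0..T}. norm x \<le> B" unfolding bounded_iff by blast
  then show ?thesis
    by (intro leb.integrable_const_bound[where B=B] borel_measurable_leb borel_measurable_continuous_onI assms)
      (auto intro!: AE_I2)
qed

text \<open>A bridge from the Lebesgue integral in \<open>prim\<close> to the gauge integral, for
  which the fundamental theorem of calculus is stated.\<close>

lemma prim_continuous_eq_integral:
  assumes t: "0 \<le> t" "t \<le> T" and g: "continuous_on UNIV (g :: real \<Rightarrow> real)"
  shows "prim T g t = integral {0..t} g"
proof -
  have "prim T g t = integral {0<..<T} (\<lambda>s. indicator {..t} s *\<^sub>R g s)"
    unfolding prim_def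
    by (rule lebesgue_integral_eq_integral) (simp_all add: indicator_integrable[OF continuous_integrable_leb[OF g]] del: real_scaleR_def)
  also have "\<dots> = integral {0..T} (\<lambda>s. if s \<in> {..t} then g s else 0)"
    unfolding integral_open_interval_real[symmetric]
    by (rule integral_cong) (auto simp: indicator_def)
  also have "\<dots> = integral ({..t} \<inter> {0..T}) g" by (rule integral_restrict_Int)
  also have "{..t} \<inter> {0..T} = {0..t}" using t by auto
  finally show ?thesis .
qed

lemma prim_deriv:
  assumes t: "0 \<le> t" "t \<le> T" and f: "f C1_differentiable_on UNIV"
  shows "prim T (deriv f) t = f t - f 0"
proof -
  note D = C1_differentiable_onD[OF f]
  have "(deriv f has_integral f t - f 0) {0..t}"
    by (rule fundamental_theorem_of_calculus[OF t(1)])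
      (use D(1) in \<open>auto simp flip: has_real_derivative_iff_has_vector_derivative intro: DERIV_subset\<close>)
  then show ?thesis using prim_continuous_eq_integral[OF t D(2)] by (simp add: integral_unique)
qed

section \<open>Functions with a weak derivative are constants plus primitives\<close>

lemma test_functions_support:
  assumes T: "T > 0" and \<phi>: "\<phi> \<in> test_functions T"
  obtains a b where "0 < a" "a < b" "b < T" "\<And>t. t \<notin> {a..b} \<Longrightarrow> \<phi> t = 0"
proof -
  obtain K where K: "compact K" "K \<subseteq> {0<..<T}" "\<And>t. t \<notin> K \<Longrightarrow> \<phi> t = 0"
    using \<phi> by (auto simp: test_functions_def)
  \<comment> \<open>Two inner points make the set nonempty and guarantee \<open>a < b\<close>, even
    if \<open>K\<close> is empty.\<close>
  let ?K = "insert (T/3) (insert (2*T/3) K)"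
  have c: "compact ?K" "?K \<noteq> {}" "?K \<subseteq> {0<..<T}" using K T by auto
  obtain a b where ab: "a \<in> ?K" "\<And>t. t \<in> ?K \<Longrightarrow> a \<le> t" "b \<in> ?K" "\<And>t. t \<in> ?K \<Longrightarrow> t \<le> b"
    using compact_attains_inf[OF c(1,2)] compact_attains_sup[OF c(1,2)] by blast
  show ?thesis
  proof (rule that[of a b])
    show "0 < a" "b < T" using ab(1,3) c(3) by auto
    show "a < b" using ab(2)[of "T/3"] ab(4)[of "2*T/3"] T by auto
    show "\<phi> t = 0" if "t \<notin> {a..b}" for t
      using that K(3)[of t] ab(2)[of t] ab(4)[of t] by auto
  qed
qed

text \<open>Integration by parts with \<open>deriv \<phi>\<close>, whose primitive is
  \<open>\<phi>\<close> itself. As \<open>\<phi>\<close> vanishes at T, the integral of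
  \<open>deriv \<phi>\<close> is 0; this removes both the boundary term and the constant
  \<open>c\<close>.\<close>

lemma prim_has_weak_deriv:
  fixes w :: "real \<Rightarrow> 'a::euclidean_space"
  assumes T: "T > 0" and w: "integrable (leb T) w" and v: "v \<in> borel_measurable (leb T)"
    and eq: "AE t in leb T. v t = c + prim T w t"
  shows "has_weak_deriv T v w"
  unfolding has_weak_deriv_def
proof (intro conjI ballI)
  have p: "integrable (leb T) (\<lambda>t. c + prim T w t)" using prim_integrable[OF w] by simp
  have "integrable (leb T) (\<lambda>t. c + prim T w t) = integrable (leb T) v"
    by (rule integrable_cong_AE) (use v p eq in auto)
  then show iv: "integrable (leb T) v" using p by simp
  fix \<phi> assume \<phi>: "\<phi> \<in> test_functions T"
  then have C1: "\<phi> C1_differentiable_on UNIV" by (simp add: test_functions_def)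
  have di: "integrable (leb T) (deriv \<phi>)" by (intro continuous_integrable_leb C1_differentiable_onD(2) C1)
  obtain a b where ab: "0 < a" "a < b" "b < T" "\<And>t. t \<notin> {a..b} \<Longrightarrow> \<phi> t = 0"
    using test_functions_support[OF T \<phi>] by blast
  have prim\<phi>: "prim T (deriv \<phi>) t = \<phi> t" if "0 \<le> t" "t \<le> T" for t
    using prim_deriv[OF that C1] ab(4)[of 0] ab(1) by simp
  have int0: "(LINT t|leb T. deriv \<phi> t) = 0"
    using prim\<phi>[of T] ab(3) ab(4)[of T] T by (simp add: prim_right_end)
  note parts = integral_by_parts[OF bounded_bilinear_scaleR di w]
  have "(LINT t|leb T. prim T (deriv \<phi>) t *\<^sub>R w t) = (LINT t|leb T. \<phi> t *\<^sub>R w t)"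
    by (rule Bochner_Integration.integral_cong) (auto simp: prim\<phi>)
  then have 1: "(LINT t|leb T. deriv \<phi> t *\<^sub>R prim T w t) = - (LINT t|leb T. \<phi> t *\<^sub>R w t)"
    using parts(3) int0 by (simp add: eq_neg_iff_add_eq_0 add.commute)
  have "(LINT t|leb T. deriv \<phi> t *\<^sub>R v t) = (LINT t|leb T. deriv \<phi> t *\<^sub>R c + deriv \<phi> t *\<^sub>R prim T w t)"
  proof (rule integral_cong_AE)
    show "AE t in leb T. deriv \<phi> t *\<^sub>R v t = deriv \<phi> t *\<^sub>R c + deriv \<phi> t *\<^sub>R prim T w t"
      using eq by eventually_elim (simp add: scaleR_add_right)
    show "(\<lambda>t. deriv \<phi> t *\<^sub>R v t) \<in> borel_measurable (leb T)"
      using di v by measurable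
    show "(\<lambda>t. deriv \<phi> t *\<^sub>R c + deriv \<phi> t *\<^sub>R prim T w t) \<in> borel_measurable (leb T)"
      using di prim_measurable[OF w] by measurable
  qed
  also have "\<dots> = (LINT t|leb T. deriv \<phi> t) *\<^sub>R c + (LINT t|leb T. deriv \<phi> t *\<^sub>R prim T w t)"
    using di parts(2) by (subst Bochner_Integration.integral_add) auto
  finally show "(LINT t|leb T. deriv \<phi> t *\<^sub>R v t) = - (LINT t|leb T. \<phi> t *\<^sub>R w t)"
    using int0 1 by simp
qed (fact w)

text \<open>The zero integral is what makes the antiderivative vanish again to the right of the
  support, so that it is a test function too.\<close>

lemma test_functions_antiderivative:
  assumes T: "T > 0" and \<theta>: "\<theta> \<in> test_functions T" and zero: "(LINT t|leb T. \<theta> t) = 0"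
  obtains \<Phi> where "\<Phi> \<in> test_functions T" "deriv \<Phi> = \<theta>"
proof -
  obtain a b where ab: "0 < a" "a < b" "b < T" "\<And>t. t \<notin> {a..b} \<Longrightarrow> \<theta> t = 0"
    using test_functions_support[OF T \<theta>] by blast
  have C1: "\<theta> C1_differentiable_on UNIV" using \<theta> by (simp add: test_functions_def)
  have cont: "continuous_on UNIV \<theta>"
    by (intro continuous_at_imp_continuous_on ballI DERIV_isCont[OF C1_differentiable_onD(1)[OF C1]])
  then have ii: "\<theta> integrable_on {x..y}" for x y
    by (intro integrable_continuous_real) (auto intro: continuous_on_subset)
  \<comment> \<open>The base point -1 lies to the left of the support and makes every
    \<open>t \<ge> a\<close> interior to \<open>{-1..t+1}\<close>, so the derivative obtained there
    is two-sided.\<close>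
  define \<Phi> where "\<Phi> t = integral {-1..t} \<theta>" for t
  have \<Phi>_left: "\<Phi> t = 0" if "t < a" for t
  proof -
    have "\<Phi> t = integral {-1..t} (\<lambda>_. 0)"
      unfolding \<Phi>_def by (rule integral_cong) (use that ab(4) in auto)
    then show ?thesis by simp
  qed
  have \<Phi>_right: "\<Phi> t = 0" if "t > b" for t
  proof -
    have "\<Phi> t = \<Phi> 0 + integral {0..b} \<theta> + integral {b..t} \<theta>"
      unfolding \<Phi>_def using ab that
        Henstock_Kurzweil_Integration.integral_combine[OF _ _ ii, of "-1" b t]
        Henstock_Kurzweil_Integration.integral_combine[OF _ _ ii, of "-1" 0 b] by auto
    moreover have "integral {b..t} \<theta> = integral {b..t} (\<lambda>_. 0)" for t
      by (rule integral_spike[where S="{b}"]) (use ab(4) in auto)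
    moreover have "integral {0..T} \<theta> = integral {0..b} \<theta> + integral {b..T} \<theta>"
      using ab ii by (intro Henstock_Kurzweil_Integration.integral_combine[symmetric]) auto
    moreover have "integral {0..T} \<theta> = 0"
      using prim_continuous_eq_integral[of T T \<theta>] T cont zero by (simp add: prim_right_end)
    ultimately show ?thesis using \<Phi>_left[of 0] ab by simp
  qed
  have D: "(\<Phi> has_real_derivative \<theta> t) (at t)" for t
  proof (cases "t < a")
    case True
    have "((\<lambda>x::real. 0) has_real_derivative 0) (at t)" by simp
    then have "(\<Phi> has_real_derivative 0) (at t)"
      by (rule has_field_derivative_transform_within_open[where S="{..<a}"]) (use True \<Phi>_left in auto)
    then show ?thesis using True ab(4) by simp
  next
    case False
    have "(\<Phi> has_real_derivative \<theta> t) (at t within {-1..t+1})"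
      unfolding \<Phi>_def[abs_def]
      by (rule integral_has_real_derivative) (use False ab cont in \<open>auto intro: continuous_on_subset\<close>)
    moreover have "at t within {-1..t+1} = at t"
      by (rule at_within_interior) (use False ab in auto)
    ultimately show ?thesis by simp
  qed
  show ?thesis
  proof
    show "deriv \<Phi> = \<theta>" using D by (auto intro: DERIV_imp_deriv)
    have "\<Phi> C1_differentiable_on UNIV" by (rule C1_differentiable_onI[OF D cont])
    then show "\<Phi> \<in> test_functions T"
      unfolding test_functions_def using ab \<Phi>_left \<Phi>_right
      by (auto intro!: exI[of _ "{a..b}"] simp: not_le)
  qed
qed

lemma test_functions_add_scale:
  assumes "\<phi> \<in> test_functions T" "\<psi> \<in> test_functions T"
  shows "(\<lambda>t. \<phi> t + c * \<psi> t) \<in> test_functions T"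
proof -
  obtain K L where "compact K" "K \<subseteq> {0<..<T}" "\<And>t. t \<notin> K \<Longrightarrow> \<phi> t = 0"
    "compact L" "L \<subseteq> {0<..<T}" "\<And>t. t \<notin> L \<Longrightarrow> \<psi> t = 0"
    using assms by (auto simp: test_functions_def)
  then show ?thesis
    using assms unfolding test_functions_def
    by (auto intro!: exI[of _ "K \<union> L"])
qed

text \<open>Du Bois-Reymond: a test function minus the multiple of a fixed one that makes its integral vanish
  is the derivative of a test function.\<close>
lemma constant_if_weak_deriv_zero:
  fixes z :: "real \<Rightarrow> 'a::euclidean_space"
  assumes T: "T > 0" and z: "integrable (leb T) z"
    and zero: "\<And>\<phi>. \<phi> \<in> test_functions T \<Longrightarrow> (LINT t|leb T. deriv \<phi> t *\<^sub>R z t) = 0"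
  obtains c where "AE t in leb T. z t = c"
proof -
  have int1: "integrable (leb T) \<phi>" if "\<phi> \<in> test_functions T" for \<phi>
    using test_functions_integrable_scaleR(1)[OF that, of "\<lambda>_. 1::real"] by simp
  \<comment> \<open>If every test function had integral 0, the fundamental lemma applied to the
    constant 1 would give 1 = 0 almost everywhere.\<close>
  obtain \<psi> where \<psi>: "\<psi> \<in> test_functions T" "(LINT t|leb T. \<psi> t) \<noteq> 0"
  proof (rule ccontr)
    assume "\<not> thesis"
    then have "\<And>\<phi>. \<phi> \<in> test_functions T \<Longrightarrow> (LINT t|leb T. \<phi> t *\<^sub>R (1::real)) = 0" using that by auto
    then have "AE t in leb T. (1::real) = 0" by (intro fundamental_lemma) auto
    then show False using AE_leb_interval_witness[where T=T and P="\<lambda>_. False" and a=0 and b=T] T by auto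
  qed
  define I where "I = (LINT t|leb T. \<psi> t)"
  \<comment> \<open>The only candidate: testing \<open>z = c\<close> with \<open>\<psi>\<close>
    forces this value.\<close>
  define c where "c = (1 / I) *\<^sub>R (LINT t|leb T. \<psi> t *\<^sub>R z t)"
  have "AE t in leb T. z t - c = 0"
  proof (rule fundamental_lemma)
    show "integrable (leb T) (\<lambda>t. z t - c)" using z by simp
    fix \<phi> assume \<phi>: "\<phi> \<in> test_functions T"
    define m where "m = - (LINT t|leb T. \<phi> t) / I"
    note \<theta> = test_functions_add_scale[OF \<phi> \<psi>(1), of m]
    have "(LINT t|leb T. \<phi> t + m * \<psi> t) = 0"
      using int1[OF \<phi>] int1[OF \<psi>(1)] \<psi>(2) by (simp add: m_def I_def)
    then obtain \<Phi> where \<Phi>: "\<Phi> \<in> test_functions T" "deriv \<Phi> = (\<lambda>t. \<phi> t + m * \<psi> t)"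
      using test_functions_antiderivative[OF T \<theta>] by blast
    note i = test_functions_integrable_scaleR(1)[OF \<phi> z] test_functions_integrable_scaleR(1)[OF \<psi>(1) z]
    have "0 = (LINT t|leb T. \<phi> t *\<^sub>R z t + m *\<^sub>R (\<psi> t *\<^sub>R z t))"
      using zero[OF \<Phi>(1)] \<Phi>(2) by (simp add: scaleR_add_left)
    also have "\<dots> = (LINT t|leb T. \<phi> t *\<^sub>R z t) + (LINT t|leb T. m *\<^sub>R (\<psi> t *\<^sub>R z t))"
      by (intro Bochner_Integration.integral_add integrable_scaleR_right i)
    also have "(LINT t|leb T. m *\<^sub>R (\<psi> t *\<^sub>R z t)) = m *\<^sub>R (LINT t|leb T. \<psi> t *\<^sub>R z t)"
      by (rule integral_scaleR_right)
    also have "m *\<^sub>R (LINT t|leb T. \<psi> t *\<^sub>R z t) = - ((LINT t|leb T. \<phi> t) *\<^sub>R c)"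
      by (simp add: c_def m_def)
    also have "(LINT t|leb T. \<phi> t) *\<^sub>R c = (LINT t|leb T. \<phi> t *\<^sub>R c)"
      using int1[OF \<phi>] by simp
    finally show "(LINT t|leb T. \<phi> t *\<^sub>R (z t - c)) = 0"
      using i int1[OF \<phi>] by (simp add: scaleR_diff_right)
  qed
  then show ?thesis by (intro that[of c]) auto
qed

text \<open>\<open>prim T w\<close> has the weak derivative \<open>w\<close> as well, so its
  difference to \<open>v\<close> has weak derivative 0 and is constant by du Bois-Reymond.\<close>

lemma has_weak_deriv_prim:
  assumes T: "T > 0" and vw: "has_weak_deriv T v w"
  obtains c where "AE t in leb T. v t = c + prim T w t"
proof -
  have v: "integrable (leb T) v" and w: "integrable (leb T) w"
    and eq: "\<And>\<phi>. \<phi> \<in> test_functions T \<Longrightarrow> (LINT t|leb T. deriv \<phi> t *\<^sub>R v t) = - (LINT t|leb T. \<phi> t *\<^sub>R w t)"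
    using vw by (auto simp: has_weak_deriv_def)
  have "has_weak_deriv T (prim T w) w"
    by (rule prim_has_weak_deriv[where c=0]) (use T w prim_measurable in auto)
  then have p: "integrable (leb T) (prim T w)"
    and eqp: "\<And>\<phi>. \<phi> \<in> test_functions T \<Longrightarrow> (LINT t|leb T. deriv \<phi> t *\<^sub>R prim T w t) = - (LINT t|leb T. \<phi> t *\<^sub>R w t)"
    by (auto simp: has_weak_deriv_def)
  obtain c where "AE t in leb T. v t - prim T w t = c"
  proof (rule constant_if_weak_deriv_zero[OF T])
    show "integrable (leb T) (\<lambda>t. v t - prim T w t)" using v p by simp
    fix \<phi> assume \<phi>: "\<phi> \<in> test_functions T"
    show "(LINT t|leb T. deriv \<phi> t *\<^sub>R (v t - prim T w t)) = 0"
      unfolding scaleR_diff_right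
      using eq[OF \<phi>] eqp[OF \<phi>] test_functions_integrable_scaleR(2)[OF \<phi> v] test_functions_integrable_scaleR(2)[OF \<phi> p]
      by simp
  qed
  then show ?thesis by (intro that[of c]) (auto elim!: eventually_mono)
qed

text \<open>The fundamental theorem of calculus for the continuous representative. As
  \<open>cont_rep\<close> is a choice, it is identified on [0,T] by uniqueness among continuous
  functions; the constant of integration is then its value at 0.\<close>

lemma has_weak_deriv_cont_rep:
  assumes T: "T > 0" and vw: "has_weak_deriv T v w"
  shows "ae_eq T v (cont_rep T v)"
    "t \<in> {0..T} \<Longrightarrow> cont_rep T v t = cont_rep T v 0 + prim T w t"
    "AE t in leb T. v t = cont_rep T v 0 + prim T w t"
proof -
  have w: "integrable (leb T) w" using vw by (simp add: has_weak_deriv_def)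
  obtain c where c: "AE t in leb T. v t = c + prim T w t" by (rule has_weak_deriv_prim[OF T vw])
  have eq: "cont_rep T v t = c + prim T w t" if "t \<in> {0..T}" for t
    by (rule cont_rep_eqI[OF T _ _ that])
      (use c in \<open>auto intro!: continuous_intros continuous_on_subset[OF continuous_on_prim[OF w]] simp: ae_eq_def elim!: eventually_mono\<close>)
  have c0: "cont_rep T v 0 = c" using eq[of 0] T by (simp add: prim_left_end)
  with eq show "t \<in> {0..T} \<Longrightarrow> cont_rep T v t = cont_rep T v 0 + prim T w t" by simp
  show c': "AE t in leb T. v t = cont_rep T v 0 + prim T w t" using c c0 by simp
  show "ae_eq T v (cont_rep T v)"
    unfolding ae_eq_def using c' AE_space
    by eventually_elim (use eq c0 in auto)
qed

lemma cont_rep_eq_prim: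
  assumes T: "T > 0" and w: "integrable (leb T) w"
    and eq: "AE t in leb T. v t = c + prim T w t" and t: "t \<in> {0..T}"
  shows "cont_rep T v t = c + prim T w t"
  by (rule cont_rep_eqI[OF T _ _ t])
    (use eq in \<open>auto intro!: continuous_intros continuous_on_subset[OF continuous_on_prim[OF w]] simp: ae_eq_def elim!: eventually_mono\<close>)

lemma has_weak_deriv_unique:
  fixes v w1 w2 :: "real \<Rightarrow> 'a::euclidean_space"
  assumes "has_weak_deriv T v w1" "has_weak_deriv T v w2"
  shows "ae_eq T w1 w2"
proof -
  have i: "integrable (leb T) w1" "integrable (leb T) w2" using assms by (auto simp: has_weak_deriv_def)
  have "AE t in leb T. w1 t - w2 t = 0"
  proof (rule fundamental_lemma)
    fix \<phi> assume \<phi>: "\<phi> \<in> test_functions T"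
    show "(LINT t|leb T. \<phi> t *\<^sub>R (w1 t - w2 t)) = 0"
      unfolding scaleR_diff_right
      using \<phi> assms test_functions_integrable_scaleR(1)[OF \<phi> i(1)] test_functions_integrable_scaleR(1)[OF \<phi> i(2)]
      by (simp add: has_weak_deriv_def)
  qed (use i in simp)
  then show ?thesis by (simp add: ae_eq_def)
qed

lemma has_weak_deriv_wderiv:
  assumes "has_weak_deriv T v w"
  shows "has_weak_deriv T v (wderiv T v)" "ae_eq T (wderiv T v) w"
proof -
  show "has_weak_deriv T v (wderiv T v)" unfolding wderiv_def by (rule someI[of _ w]) fact
  then show "ae_eq T (wderiv T v) w" using assms by (rule has_weak_deriv_unique)
qed

lemma has_weak_deriv_cong:
  assumes "has_weak_deriv T v w" "ae_eq T v v'" "v' \<in> borel_measurable (leb T)"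
  shows "has_weak_deriv T v' w"
proof -
  have v: "integrable (leb T) v" using assms by (simp add: has_weak_deriv_def)
  have "integrable (leb T) v = integrable (leb T) v'"
    by (rule integrable_cong_AE) (use v assms in \<open>auto simp: ae_eq_def\<close>)
  then have v': "integrable (leb T) v'" using v by simp
  have "(LINT t|leb T. deriv \<phi> t *\<^sub>R v t) = (LINT t|leb T. deriv \<phi> t *\<^sub>R v' t)" if "\<phi> \<in> test_functions T" for \<phi>
    by (intro integral_cong_AE borel_measurable_integrable test_functions_integrable_scaleR(2) that v v')
      (use assms(2) in \<open>auto simp: ae_eq_def elim!: eventually_mono\<close>)
  then show ?thesis using assms v' by (simp add: has_weak_deriv_def)
qed

lemma has_weak_deriv_add_scaleR:
  assumes "has_weak_deriv T v v'" "has_weak_deriv T w w'"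
  shows "has_weak_deriv T (\<lambda>t. v t + c *\<^sub>R w t) (\<lambda>t. v' t + c *\<^sub>R w' t)"
proof -
  have i: "integrable (leb T) v" "integrable (leb T) v'" "integrable (leb T) w" "integrable (leb T) w'"
    using assms by (auto simp: has_weak_deriv_def)
  have lin: "(LINT t|leb T. f t *\<^sub>R (x t + c *\<^sub>R y t)) = (LINT t|leb T. f t *\<^sub>R x t) + c *\<^sub>R (LINT t|leb T. f t *\<^sub>R y t)"
    if "integrable (leb T) (\<lambda>t. f t *\<^sub>R x t)" "integrable (leb T) (\<lambda>t. f t *\<^sub>R y t)" for f and x y :: "real \<Rightarrow> 'a"
  proof -
    have "(LINT t|leb T. f t *\<^sub>R (x t + c *\<^sub>R y t)) = (LINT t|leb T. f t *\<^sub>R x t + c *\<^sub>R (f t *\<^sub>R y t))"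
      by (simp add: scaleR_add_right mult.commute)
    also have "\<dots> = (LINT t|leb T. f t *\<^sub>R x t) + (LINT t|leb T. c *\<^sub>R (f t *\<^sub>R y t))"
      by (intro Bochner_Integration.integral_add integrable_scaleR_right that)
    finally show ?thesis by (simp only: integral_scaleR_right)
  qed
  show ?thesis
    using assms i by (auto simp: has_weak_deriv_def lin test_functions_integrable_scaleR)
qed

text \<open>On a bounded interval L2 convergence implies L1 convergence, and test functions and
  their derivatives are bounded; so both sides of the defining identity pass to the limit.\<close>

lemma has_weak_deriv_closed:
  assumes T: "T > 0" and d: "\<And>n. has_weak_deriv T (v n) (w n)"
    and L2: "\<And>n. v n \<in> L2 T" "\<And>n. w n \<in> L2 T" "v' \<in> L2 T" "w' \<in> L2 T"
    and lim: "(\<lambda>n. LINT t|leb T. (norm (v n t - v' t))\<^sup>2) \<longlonglongrightarrow> 0" "(\<lambda>n. LINT t|leb T. (norm (w n t - w' t))\<^sup>2) \<longlonglongrightarrow> 0"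
  shows "has_weak_deriv T v' w'"
  unfolding has_weak_deriv_def
proof (intro conjI ballI L2_integrable L2)
  fix \<phi> assume \<phi>: "\<phi> \<in> test_functions T"
  obtain M where M: "\<And>t. \<bar>\<phi> t\<bar> \<le> M" "\<And>t. \<bar>deriv \<phi> t\<bar> \<le> M"
    using test_functions_bounded[OF \<phi>] by blast
  have *: "(\<lambda>n. LINT t|leb T. f t *\<^sub>R x n t) \<longlonglongrightarrow> (LINT t|leb T. f t *\<^sub>R y t)"
    if f: "\<And>t. \<bar>f t\<bar> \<le> M" "\<And>z::real \<Rightarrow> 'a. integrable (leb T) z \<Longrightarrow> integrable (leb T) (\<lambda>t. f t *\<^sub>R z t)"
      and xy: "\<And>n. x n \<in> L2 T" "y \<in> L2 T"
      and lim: "(\<lambda>n. LINT t|leb T. (norm (x n t - y t))\<^sup>2) \<longlonglongrightarrow> 0" for f x and y :: "real \<Rightarrow> 'a"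
  proof (rule Lim_transform[OF tendsto_const[of "LINT t|leb T. f t *\<^sub>R y t"]])
    have "(\<lambda>n. sqrt (T * (LINT t|leb T. (norm (x n t - y t))\<^sup>2)) * M) \<longlonglongrightarrow> sqrt (T * 0) * M"
      by (intro tendsto_intros lim)
    then have b: "(\<lambda>n. sqrt (T * (LINT t|leb T. (norm (x n t - y t))\<^sup>2)) * M) \<longlonglongrightarrow> 0" by simp
    show "(\<lambda>n. (LINT t|leb T. f t *\<^sub>R x n t) - (LINT t|leb T. f t *\<^sub>R y t)) \<longlonglongrightarrow> 0"
    proof (rule Lim_null_comparison[OF _ b], rule always_eventually, rule allI)
      fix n
      note z = L2_diff[OF xy(1)[of n] xy(2)]
      have "norm ((LINT t|leb T. f t *\<^sub>R x n t) - (LINT t|leb T. f t *\<^sub>R y t))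
          = norm (LINT t|leb T. f t *\<^sub>R (x n t - y t))"
        using f(2)[OF L2_integrable[OF xy(1)[of n]]] f(2)[OF L2_integrable[OF xy(2)]]
        by (simp add: scaleR_diff_right)
      also have "\<dots> \<le> (LINT t|leb T. norm (f t *\<^sub>R (x n t - y t)))" by (rule integral_norm_bound)
      also have "\<dots> \<le> (LINT t|leb T. norm (x n t - y t) * M)"
        by (intro integral_mono integrable_norm f(2) L2_integrable[OF z] integrable_mult_left)
          (use f(1) in \<open>auto simp: mult.commute[of _ M] intro!: mult_right_mono\<close>)
      also have "\<dots> = (LINT t|leb T. norm (x n t - y t)) * M" by simp
      also have "\<dots> \<le> sqrt (T * (LINT t|leb T. (norm (x n t - y t))\<^sup>2)) * M"
        using M(1)[of 0] L1_le_L2[OF z T] by (intro mult_right_mono real_le_rsqrt) auto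
      finally show "norm ((LINT t|leb T. f t *\<^sub>R x n t) - (LINT t|leb T. f t *\<^sub>R y t))
          \<le> sqrt (T * (LINT t|leb T. (norm (x n t - y t))\<^sup>2)) * M" .
    qed
  qed
  have 1: "(\<lambda>n. LINT t|leb T. deriv \<phi> t *\<^sub>R v n t) \<longlonglongrightarrow> (LINT t|leb T. deriv \<phi> t *\<^sub>R v' t)"
    by (intro * M L2 lim test_functions_integrable_scaleR(2)[OF \<phi>])
  have 2: "(\<lambda>n. LINT t|leb T. \<phi> t *\<^sub>R w n t) \<longlonglongrightarrow> (LINT t|leb T. \<phi> t *\<^sub>R w' t)"
    by (intro * M L2 lim test_functions_integrable_scaleR(1)[OF \<phi>])
  have "(LINT t|leb T. deriv \<phi> t *\<^sub>R v n t) = - (LINT t|leb T. \<phi> t *\<^sub>R w n t)" for n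
    using d[of n] \<phi> unfolding has_weak_deriv_def by blast
  with 1 have "(\<lambda>n. - (LINT t|leb T. \<phi> t *\<^sub>R w n t)) \<longlonglongrightarrow> (LINT t|leb T. deriv \<phi> t *\<^sub>R v' t)" by simp
  then show "(LINT t|leb T. deriv \<phi> t *\<^sub>R v' t) = - (LINT t|leb T. \<phi> t *\<^sub>R w' t)"
    using tendsto_minus[OF 2] by (rule LIMSEQ_unique)
qed

section \<open>Abstract Tikhonov regularization\<close>

lemma norm_add_scaleR_square:
  "(norm (x + c *\<^sub>R y))\<^sup>2 = (norm x)\<^sup>2 + 2 * c * (x \<bullet> y) + c\<^sup>2 * (norm y)\<^sup>2" for x y :: "'a::real_inner"
  unfolding power2_norm_eq_inner
  by (simp add: inner_add_left inner_add_right inner_commute power2_eq_square)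

text \<open>\<open>comb u c w\<close> stands for \<open>u + c w\<close>; elements at \<open>h\<close>-distance 0 are not identified.\<close>

locale psd_form =
  fixes H :: "'x set" and comb :: "'x \<Rightarrow> real \<Rightarrow> 'x \<Rightarrow> 'x" and q :: "'x \<Rightarrow> 'x \<Rightarrow> real"
  assumes comb_in: "u \<in> H \<Longrightarrow> w \<in> H \<Longrightarrow> comb u c w \<in> H"
    and comb_left: "u \<in> H \<Longrightarrow> w \<in> H \<Longrightarrow> y \<in> H \<Longrightarrow> q (comb u c w) y = q u y + c * q w y"
    and sym: "u \<in> H \<Longrightarrow> w \<in> H \<Longrightarrow> q u w = q w u"
    and nonneg: "u \<in> H \<Longrightarrow> 0 \<le> q u u"
begin

abbreviation dsq :: "'x \<Rightarrow> 'x \<Rightarrow> real" where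
  "dsq u w \<equiv> q (comb u (-1) w) (comb u (-1) w)"

lemma comb_right: "u \<in> H \<Longrightarrow> w \<in> H \<Longrightarrow> y \<in> H \<Longrightarrow> q y (comb u c w) = q y u + c * q y w"
  using comb_left[of u w y c] sym comb_in by metis

lemma comb_self:
  "u \<in> H \<Longrightarrow> w \<in> H \<Longrightarrow> q (comb u c w) (comb u c w) = q u u + 2 * c * q u w + c\<^sup>2 * q w w"
  using sym[of w u] by (simp add: comb_left comb_right comb_in power2_eq_square algebra_simps)

lemma dsq_le: "u \<in> H \<Longrightarrow> w \<in> H \<Longrightarrow> dsq u w \<le> 2 * q u u + 2 * q w w"
  using nonneg[OF comb_in[of u w 1]] by (simp add: comb_self)

lemma self_le: "u \<in> H \<Longrightarrow> w \<in> H \<Longrightarrow> q w w \<le> 2 * q u u + 2 * dsq u w"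
  using nonneg[OF comb_in[of w u "-2"]] sym[of u w] by (simp add: comb_self)

text \<open>The slack is exactly the form at \<open>(x - w) - (w - y)\<close>, by the parallelogram
  law.\<close>

lemma dsq_triangle:
  assumes "x \<in> H" "w \<in> H" "y \<in> H"
  shows "dsq x y \<le> 2 * dsq x w + 2 * dsq w y"
proof -
  have "0 \<le> q (comb (comb x (-1) w) (-1) (comb w (-1) y)) (comb (comb x (-1) w) (-1) (comb w (-1) y))"
    by (intro nonneg comb_in assms)
  then show ?thesis
    using assms sym[of x w] sym[of x y] sym[of w y]
    by (simp add: comb_left comb_right comb_in algebra_simps)
qed

end

text \<open>In the application \<open>H\<close> is H2, \<open>a u u\<close> the squared L2 norm of
  the residual \<open>u' - C u\<close>, \<open>h\<close> the H2 inner product and \<open>tr\<close>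
  the value at 0. \<open>injective\<close> expresses uniqueness for the homogeneous initial value
  problem; it identifies the limit as the parameter tends to 0.\<close>

locale tikhonov = a: psd_form H comb a + h: psd_form H comb h
  for H :: "'x set" and comb :: "'x \<Rightarrow> real \<Rightarrow> 'x \<Rightarrow> 'x" and a h :: "'x \<Rightarrow> 'x \<Rightarrow> real" +
  fixes tr :: "'x \<Rightarrow> 'v::real_inner"
  assumes nonempty: "H \<noteq> {}"
    and tr_comb: "u \<in> H \<Longrightarrow> w \<in> H \<Longrightarrow> tr (comb u c w) = tr u + c *\<^sub>R tr w"
    and bounded: "\<exists>K. \<forall>u\<in>H. a u u + (norm (tr u))\<^sup>2 \<le> K * h u u"
    and complete: "(\<And>n::nat. v n \<in> H) \<Longrightarrow>
      (\<And>e. e > 0 \<Longrightarrow> \<exists>N. \<forall>m\<ge>N. \<forall>n\<ge>N. h.dsq (v m) (v n) < e) \<Longrightarrow>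
      \<exists>u\<in>H. (\<lambda>n. h.dsq (v n) u) \<longlonglongrightarrow> 0"
    and injective: "u \<in> H \<Longrightarrow> a u u = 0 \<Longrightarrow> tr u = 0 \<Longrightarrow> h u u = 0"
begin

definition Jf :: "real \<Rightarrow> 'v \<Rightarrow> 'x \<Rightarrow> real" where
  "Jf \<alpha> b u = a u u + (norm (tr u - b))\<^sup>2 + \<alpha> * h u u"

text \<open>Half the derivative of \<open>Jf \<alpha> b\<close> at \<open>u\<close> in direction
  \<open>z\<close>; its vanishing for all \<open>z\<close> is the Euler equation. The second-order
  part is \<open>Qf \<alpha> z\<close>.\<close>

definition Bf :: "real \<Rightarrow> 'v \<Rightarrow> 'x \<Rightarrow> 'x \<Rightarrow> real" where
  "Bf \<alpha> b u z = a u z + (tr u - b) \<bullet> tr z + \<alpha> * h u z"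

definition Qf :: "real \<Rightarrow> 'x \<Rightarrow> real" where
  "Qf \<alpha> z = a z z + (norm (tr z))\<^sup>2 + \<alpha> * h z z"

definition minimizer :: "real \<Rightarrow> 'v \<Rightarrow> 'x \<Rightarrow> bool" where
  "minimizer \<alpha> b u \<longleftrightarrow> u \<in> H \<and> (\<forall>w\<in>H. Jf \<alpha> b u \<le> Jf \<alpha> b w)"

lemma Jf_comb:
  assumes "u \<in> H" "z \<in> H"
  shows "Jf \<alpha> b (comb u c z) = Jf \<alpha> b u + 2 * c * Bf \<alpha> b u z + c\<^sup>2 * Qf \<alpha> z"
proof -
  have "tr (comb u c z) - b = (tr u - b) + c *\<^sub>R tr z" by (simp add: tr_comb assms)
  then have "(norm (tr (comb u c z) - b))\<^sup>2 = (norm (tr u - b))\<^sup>2 + 2 * c * ((tr u - b) \<bullet> tr z) + c\<^sup>2 * (norm (tr z))\<^sup>2"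
    by (simp only: norm_add_scaleR_square)
  then show ?thesis
    by (simp add: Jf_def Bf_def Qf_def a.comb_self h.comb_self assms algebra_simps)
qed

text \<open>No vector space laws are assumed, so \<open>w\<close> cannot be rewritten as
  \<open>u + (w - u)\<close> in order to reuse \<open>Jf_comb\<close>; the forms and the trace are
  expanded instead.\<close>

lemma Jf_eq:
  assumes "u \<in> H" "w \<in> H"
  shows "Jf \<alpha> b w = Jf \<alpha> b u + 2 * Bf \<alpha> b u (comb w (-1) u) + Qf \<alpha> (comb w (-1) u)"
proof -
  have t: "tr w - b = (tr u - b) + 1 *\<^sub>R tr (comb w (-1) u)" by (simp add: tr_comb assms)
  have "(norm (tr w - b))\<^sup>2 = (norm (tr u - b))\<^sup>2 + 2 * ((tr u - b) \<bullet> tr (comb w (-1) u)) + (norm (tr (comb w (-1) u)))\<^sup>2"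
    unfolding t norm_add_scaleR_square by simp
  then show ?thesis
    using a.sym[OF assms] h.sym[OF assms]
    by (simp add: Jf_def Bf_def Qf_def a.comb_left a.comb_right h.comb_left h.comb_right a.comb_in assms algebra_simps)
qed

lemma Jf_nonneg: "u \<in> H \<Longrightarrow> \<alpha> > 0 \<Longrightarrow> 0 \<le> Jf \<alpha> b u"
  by (simp add: Jf_def a.nonneg h.nonneg)

lemma Qf_nonneg: "u \<in> H \<Longrightarrow> \<alpha> > 0 \<Longrightarrow> 0 \<le> Qf \<alpha> u"
  by (simp add: Qf_def a.nonneg h.nonneg)

lemma Qf_ge: "u \<in> H \<Longrightarrow> \<alpha> * h u u \<le> Qf \<alpha> u"
  by (simp add: Qf_def a.nonneg)

text \<open>Young's inequality with weight \<open>e\<close>, read off from nonnegativity of the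
  forms at \<open>z + e u\<close>, with the trace of \<open>u\<close> shifted by the data. It plays
  the role of Cauchy-Schwarz in passing to the limit along a minimizing sequence.\<close>

lemma Bf_ge:
  assumes "u \<in> H" "z \<in> H" "\<alpha> > 0" "e > 0"
  shows "- (Qf \<alpha> z / e) - e * Jf \<alpha> b u \<le> 2 * Bf \<alpha> b u z"
proof -
  have A: "0 \<le> a (comb z e u) (comb z e u)" "0 \<le> h (comb z e u) (comb z e u)"
    using a.nonneg h.nonneg a.comb_in assms by auto
  have "0 \<le> (norm (tr z + e *\<^sub>R (tr u - b)))\<^sup>2" by simp
  also have "\<dots> = (norm (tr z))\<^sup>2 + 2 * e * ((tr u - b) \<bullet> tr z) + e\<^sup>2 * (norm (tr u - b))\<^sup>2"
    by (simp add: norm_add_scaleR_square inner_commute)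
  finally have "0 \<le> Qf \<alpha> z + 2 * e * Bf \<alpha> b u z + e\<^sup>2 * Jf \<alpha> b u"
    using A(1) mult_nonneg_nonneg[OF less_imp_le[OF assms(3)] A(2)] a.sym[of z u] h.sym[of z u] assms(1,2)
    by (simp add: Jf_def Bf_def Qf_def a.comb_self h.comb_self algebra_simps)
  then have "0 \<le> (Qf \<alpha> z + 2 * e * Bf \<alpha> b u z + e\<^sup>2 * Jf \<alpha> b u) / e" using assms(4) by simp
  also have "\<dots> = Qf \<alpha> z / e + 2 * Bf \<alpha> b u z + e * Jf \<alpha> b u"
    using assms(4) by (simp add: field_simps power2_eq_square)
  finally show ?thesis by linarith
qed

lemma Cauchy_minimizing:
  assumes \<alpha>: "\<alpha> > 0" and v: "v \<in> H" "w \<in> H" and m: "\<And>u. u \<in> H \<Longrightarrow> m \<le> Jf \<alpha> b u"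
  shows "\<alpha> * h.dsq w v \<le> 2 * (Jf \<alpha> b v - m) + 2 * (Jf \<alpha> b w - m)"
proof -
  let ?z = "comb w (-1) v"
  have z: "?z \<in> H" by (intro a.comb_in v)
  \<comment> \<open>The midpoint of \<open>v\<close> and \<open>w\<close> is compared with the lower
    bound \<open>m\<close>. Eliminating \<open>Bf\<close> with the help of the expansion of
    \<open>Jf \<alpha> b w\<close> leaves a quarter of \<open>Qf\<close>.\<close>
  have "m \<le> Jf \<alpha> b (comb v (1/2) ?z)" by (intro m a.comb_in v)
  then have "m \<le> Jf \<alpha> b v + Bf \<alpha> b v ?z + Qf \<alpha> ?z / 4"
    by (simp add: Jf_comb[OF v(1) z] power2_eq_square)
  moreover have "\<alpha> * h.dsq w v \<le> Qf \<alpha> ?z" by (rule Qf_ge[OF z])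
  moreover have "Jf \<alpha> b w = Jf \<alpha> b v + 2 * Bf \<alpha> b v ?z + Qf \<alpha> ?z" by (rule Jf_eq[OF v])
  ultimately show ?thesis by argo
qed

theorem minimizer_exists:
  assumes \<alpha>: "\<alpha> > 0"
  shows "\<exists>u. minimizer \<alpha> b u"
proof -
  define m where "m = Inf (Jf \<alpha> b ` H)"
  have m: "m \<le> Jf \<alpha> b u" if "u \<in> H" for u
    unfolding m_def by (rule cInf_lower) (use that Jf_nonneg[OF _ \<alpha>] in \<open>auto intro!: bdd_belowI[of _ 0]\<close>)
  have "\<exists>u\<in>H. Jf \<alpha> b u < m + 1 / real (Suc n)" for n
  proof -
    have "Inf (Jf \<alpha> b ` H) < m + 1 / real (Suc n)" by (simp add: m_def)
    then show ?thesis using cInf_lessD[of "Jf \<alpha> b ` H"] nonempty by blast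
  qed
  then obtain v where v: "\<And>n. v n \<in> H" "\<And>n. Jf \<alpha> b (v n) < m + 1 / real (Suc n)" by metis
  have "\<exists>N. \<forall>i\<ge>N. \<forall>j\<ge>N. h.dsq (v i) (v j) < e" if e: "e > 0" for e
  proof -
    obtain N where N: "1 / real (Suc N) < \<alpha> * e / 4"
      using nat_approx_posE[of "\<alpha> * e / 4"] \<alpha> e by auto
    have small: "Jf \<alpha> b (v i) - m < \<alpha> * e / 4" if "i \<ge> N" for i
    proof -
      have "1 / real (Suc i) \<le> 1 / real (Suc N)" using that by (simp add: frac_le)
      then show ?thesis using v(2)[of i] N by linarith
    qed
    have "h.dsq (v i) (v j) < e" if "i \<ge> N" "j \<ge> N" for i j
    proof -
      have "\<alpha> * h.dsq (v i) (v j) < \<alpha> * e"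
      proof -
        have "\<alpha> * h.dsq (v i) (v j) \<le> 2 * (Jf \<alpha> b (v j) - m) + 2 * (Jf \<alpha> b (v i) - m)"
          by (rule Cauchy_minimizing[OF \<alpha> v(1) v(1) m])
        then show ?thesis using small[OF that(1)] small[OF that(2)] by argo
      qed
      then show ?thesis using \<alpha> by simp
    qed
    then show ?thesis by blast
  qed
  then obtain u where u: "u \<in> H" "(\<lambda>n. h.dsq (v n) u) \<longlonglongrightarrow> 0"
    using complete[of v] v(1) by blast
  obtain K where K: "\<And>u. u \<in> H \<Longrightarrow> a u u + (norm (tr u))\<^sup>2 \<le> K * h u u" using bounded by blast
  let ?z = "\<lambda>n. comb (v n) (-1) u"
  have z: "?z n \<in> H" for n by (intro a.comb_in v u)
  have Q: "Qf \<alpha> (?z n) \<le> (K + \<alpha>) * h.dsq (v n) u" for n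
    using K[OF z] by (simp add: Qf_def algebra_simps)
  \<comment> \<open>The linear term in the expansion of \<open>Jf\<close> at \<open>u\<close> is
    absorbed at the price of the factor \<open>1 - e\<close>. For fixed \<open>e\<close> the
    remaining error vanishes as \<open>n\<close> grows; only afterwards does \<open>e\<close> tend
    to 0.\<close>
  have le: "(1 - e) * Jf \<alpha> b u \<le> m" if e: "e > 0" for e
  proof (rule LIMSEQ_le_const)
    have "(\<lambda>n. m + 1 / real (Suc n) + (K + \<alpha>) * h.dsq (v n) u / e) \<longlonglongrightarrow> m + 0 + (K + \<alpha>) * 0 / e"
      using e by (intro tendsto_intros u LIMSEQ_Suc[OF lim_1_over_n]) auto
    then show "(\<lambda>n. m + 1 / real (Suc n) + (K + \<alpha>) * h.dsq (v n) u / e) \<longlonglongrightarrow> m" by simp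
    have "(1 - e) * Jf \<alpha> b u \<le> m + 1 / real (Suc n) + (K + \<alpha>) * h.dsq (v n) u / e" for n
    proof -
      have "Qf \<alpha> (?z n) / e \<le> (K + \<alpha>) * h.dsq (v n) u / e" using Q[of n] e by (intro divide_right_mono) auto
      then show ?thesis
        using Bf_ge[OF u(1) z \<alpha> e, of n b] Jf_eq[OF u(1) v(1), of \<alpha> b n] v(2)[of n] Qf_nonneg[OF z \<alpha>, of n]
        by (simp only: left_diff_distrib mult_1)
    qed
    then show "\<exists>N. \<forall>n\<ge>N. (1 - e) * Jf \<alpha> b u \<le> m + 1 / real (Suc n) + (K + \<alpha>) * h.dsq (v n) u / e" by blast
  qed
  have "Jf \<alpha> b u \<le> m"
  proof (rule LIMSEQ_le_const2)
    have "(\<lambda>n. (1 - 1 / real (Suc n)) * Jf \<alpha> b u) \<longlonglongrightarrow> (1 - 0) * Jf \<alpha> b u"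
      by (intro tendsto_intros LIMSEQ_Suc[OF lim_1_over_n])
    then show "(\<lambda>n. (1 - 1 / real (Suc n)) * Jf \<alpha> b u) \<longlonglongrightarrow> Jf \<alpha> b u" by simp
    show "\<exists>N. \<forall>n\<ge>N. (1 - 1 / real (Suc n)) * Jf \<alpha> b u \<le> m" by (intro exI allI impI le) simp
  qed
  then show ?thesis unfolding minimizer_def using u(1) m by (meson order_trans)
qed

theorem minimizer_Euler:
  assumes \<alpha>: "\<alpha> > 0" and u: "minimizer \<alpha> b u" and z: "z \<in> H"
  shows "Bf \<alpha> b u z = 0"
proof (rule ccontr)
  assume "Bf \<alpha> b u z \<noteq> 0"
  define B where "B = Bf \<alpha> b u z"
  define Q where "Q = Qf \<alpha> z"
  have uH: "u \<in> H" using u by (simp add: minimizer_def)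
  have Q: "Q \<ge> 0" unfolding Q_def by (rule Qf_nonneg[OF z \<alpha>])
  \<comment> \<open>The optimal step would be \<open>- B / Q\<close>. Adding 1 avoids a zero
    denominator, and \<open>Jf\<close> still changes by \<open>- (c\<^sup>2 * (Q + 2))\<close>,
    which is negative unless \<open>c = 0\<close>.\<close>
  define c where "c = - B / (Q + 1)"
  have B: "B = - c * (Q + 1)" using Q by (simp add: c_def)
  have "Jf \<alpha> b u \<le> Jf \<alpha> b (comb u c z)" using u a.comb_in[OF uH z] by (simp add: minimizer_def)
  then have "0 \<le> 2 * c * B + c\<^sup>2 * Q" by (simp add: Jf_comb[OF uH z] B_def Q_def)
  also have "\<dots> = - (c\<^sup>2 * (Q + 2))" unfolding B by (simp add: power2_eq_square algebra_simps)
  finally have "c = 0" using Q by (simp add: mult_le_0_iff)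
  then show False using B \<open>Bf \<alpha> b u z \<noteq> 0\<close> by (simp add: B_def)
qed

theorem minimizer_unique:
  assumes \<alpha>: "\<alpha> > 0" and u: "minimizer \<alpha> b u" and w: "minimizer \<alpha> b w"
  shows "h.dsq w u = 0"
proof -
  have H: "u \<in> H" "w \<in> H" using u w by (auto simp: minimizer_def)
  have z: "comb w (-1) u \<in> H" by (intro a.comb_in H)
  have "Jf \<alpha> b w \<le> Jf \<alpha> b u" using w H by (simp add: minimizer_def)
  then have "Qf \<alpha> (comb w (-1) u) \<le> 0"
    using Jf_eq[OF H, of \<alpha> b] minimizer_Euler[OF \<alpha> u z] by simp
  then have "\<alpha> * h.dsq w u \<le> 0" using Qf_ge[OF z, of \<alpha>] by linarith
  then show ?thesis using \<alpha> h.nonneg[OF z] by (simp add: mult_le_0_iff)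
qed

theorem minimizer_stable:
  assumes \<alpha>: "\<alpha> > 0" and u: "minimizer \<alpha> b1 u1" "minimizer \<alpha> b2 u2"
  shows "\<alpha> * h.dsq u1 u2 \<le> (norm (b1 - b2))\<^sup>2 / 4"
proof -
  have H: "u1 \<in> H" "u2 \<in> H" using u by (auto simp: minimizer_def)
  let ?z = "comb u1 (-1) u2"
  have z: "?z \<in> H" by (intro a.comb_in H)
  have t: "tr ?z = tr u1 - tr u2" by (simp add: tr_comb H)
  have "0 = Bf \<alpha> b1 u1 ?z - Bf \<alpha> b2 u2 ?z"
    using minimizer_Euler[OF \<alpha> u(1) z] minimizer_Euler[OF \<alpha> u(2) z] by simp
  also have "\<dots> = a ?z ?z + tr ?z \<bullet> tr ?z - (b1 - b2) \<bullet> tr ?z + \<alpha> * h ?z ?z"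
  proof -
    have "a ?z ?z = a u1 ?z - a u2 ?z" "h ?z ?z = h u1 ?z - h u2 ?z"
      using a.comb_left[OF H z, of "-1"] h.comb_left[OF H z, of "-1"] by simp_all
    moreover have "tr ?z \<bullet> tr ?z = tr u1 \<bullet> tr ?z - tr u2 \<bullet> tr ?z" by (metis t inner_diff_left)
    ultimately show ?thesis by (simp only: Bf_def) (simp add: inner_diff_left algebra_simps)
  qed
  finally have 1: "\<alpha> * h ?z ?z \<le> (b1 - b2) \<bullet> tr ?z - tr ?z \<bullet> tr ?z" using a.nonneg[OF z] by linarith
  \<comment> \<open>Completing the square at half the difference of the data produces the 1/4 here,
    and the 1/2 of the norm estimate after taking roots.\<close>
  have "0 \<le> (norm (tr ?z + (- 1 / 2) *\<^sub>R (b1 - b2)))\<^sup>2" by simp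
  also have "\<dots> = (norm (b1 - b2))\<^sup>2 / 4 - (b1 - b2) \<bullet> tr ?z + tr ?z \<bullet> tr ?z"
    unfolding norm_add_scaleR_square by (simp add: power2_eq_square inner_commute flip: power2_norm_eq_inner)
  finally show ?thesis using 1 by linarith
qed

section \<open>Convergence for exact and for noisy data\<close>

lemma minimizer_monotone:
  assumes \<alpha>: "0 < \<alpha>" "\<alpha> < \<beta>" and u: "minimizer \<alpha> b u" and w: "minimizer \<beta> b w"
  shows "h.dsq u w \<le> h u u - h w w"
proof -
  have H: "u \<in> H" "w \<in> H" using u w by (auto simp: minimizer_def)
  let ?z = "comb u (-1) w"
  have z: "?z \<in> H" by (intro a.comb_in H)
  have t: "tr ?z = tr u - tr w" by (simp add: tr_comb H)
  have "0 = Bf \<alpha> b u ?z - Bf \<beta> b w ?z"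
    using minimizer_Euler[OF _ u z] minimizer_Euler[OF _ w z] \<alpha> by simp
  also have "\<dots> = a ?z ?z + tr ?z \<bullet> tr ?z + \<alpha> * h u ?z - \<beta> * h w ?z"
  proof -
    have "a ?z ?z = a u ?z - a w ?z" using a.comb_left[OF H z, of "-1"] by simp
    moreover have "tr ?z \<bullet> tr ?z = tr u \<bullet> tr ?z - tr w \<bullet> tr ?z" by (metis t inner_diff_left)
    ultimately show ?thesis by (simp only: Bf_def) (simp add: inner_diff_left algebra_simps)
  qed
  also have "h u ?z = h ?z ?z + h w ?z"
    using h.comb_left[OF H z, of "-1"] by simp
  \<comment> \<open>The two Euler equations weight \<open>h\<close> differently. Collecting the
    surplus \<open>\<beta> - \<alpha>\<close> on \<open>h w ?z\<close> leaves three nonnegative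
    terms on the other side.\<close>
  finally have "(\<beta> - \<alpha>) * h w ?z = a ?z ?z + tr ?z \<bullet> tr ?z + \<alpha> * h ?z ?z" by (simp add: algebra_simps)
  also have "\<dots> \<ge> 0" using a.nonneg[OF z] h.nonneg[OF z] \<alpha> by simp
  finally have p: "0 \<le> (\<beta> - \<alpha>) * h w ?z" .
  then have "0 \<le> h w ?z" using \<alpha> by (auto simp: zero_le_mult_iff)
  \<comment> \<open>The difference of the squared norms is \<open>dsq u w + 2 * h w ?z\<close>, so
    the sign of \<open>h w ?z\<close> decides.\<close>
  then show ?thesis
    using h.sym[OF H] by (simp add: h.comb_left h.comb_right h.comb_in H)
qed

text \<open>The exact solution has the value \<open>\<alpha> * h udag udag\<close>, which bounds the
  norms of all minimizers. Along \<open>\<beta> n\<close> the squared norms increase to a limit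
  \<open>S\<close>, and the gap \<open>S - h (v n) (v n)\<close> controls distances. One threshold
  serves all smaller \<alpha> and all their minimizers, so an arbitrary parameter choice can be
  inserted later.\<close>

theorem exact_data_convergence:
  assumes ex: "udag \<in> H" "a udag udag = 0" "tr udag = b" and e: "e > 0"
  shows "\<exists>\<beta>>0. \<forall>\<alpha> u. 0 < \<alpha> \<longrightarrow> \<alpha> < \<beta> \<longrightarrow> minimizer \<alpha> b u \<longrightarrow> h.dsq u udag < e"
proof -
  define \<beta> where "\<beta> n = 1 / real (Suc n)" for n
  have \<beta>pos: "\<beta> n > 0" for n by (simp add: \<beta>_def)
  have \<beta>dec: "\<beta> n < \<beta> m" if "m < n" for m n using that by (simp add: \<beta>_def frac_less2)
  have \<beta>lim: "\<beta> \<longlonglongrightarrow> 0" unfolding \<beta>_def by (rule LIMSEQ_Suc[OF lim_1_over_n])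
  obtain v where v: "\<And>n. minimizer (\<beta> n) b (v n)" using minimizer_exists[OF \<beta>pos, of _ b] by metis
  have vH: "v n \<in> H" for n using v by (simp add: minimizer_def)
  have J_le: "Jf \<alpha> b u \<le> \<alpha> * h udag udag" if "minimizer \<alpha> b u" for \<alpha> u
    using that ex by (auto simp: minimizer_def Jf_def dest!: bspec[of _ _ udag])
  have h_le: "h u u \<le> h udag udag" if "minimizer \<alpha> b u" "\<alpha> > 0" for \<alpha> u
  proof -
    have "u \<in> H" using that by (simp add: minimizer_def)
    then have "\<alpha> * h u u \<le> Jf \<alpha> b u" using a.nonneg by (simp add: Jf_def)
    then have "\<alpha> * h u u \<le> \<alpha> * h udag udag" using J_le[OF that(1)] by linarith
    then show ?thesis using that(2) by simp
  qed
  have mono: "h (v m) (v m) \<le> h (v n) (v n)" if "m \<le> n" for m n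
  proof (cases "m = n")
    case False
    then have "h.dsq (v n) (v m) \<le> h (v n) (v n) - h (v m) (v m)"
      using that minimizer_monotone[OF \<beta>pos \<beta>dec v v] by simp
    then show ?thesis using h.nonneg[OF h.comb_in[OF vH vH]] by (smt (verit))
  qed simp
  then have "incseq (\<lambda>n. h (v n) (v n))" by (simp add: incseq_def)
  moreover have "h (v n) (v n) \<le> h udag udag" for n by (rule h_le[OF v \<beta>pos])
  ultimately obtain S where S: "(\<lambda>n. h (v n) (v n)) \<longlonglongrightarrow> S" "\<And>n. h (v n) (v n) \<le> S"
    using incseq_convergent[of "\<lambda>n. h (v n) (v n)"] by blast
  have below: "h.dsq u (v n) \<le> S - h (v n) (v n)" if u: "minimizer \<alpha> b u" "0 < \<alpha>" "\<alpha> < \<beta> n" for \<alpha> u n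
  proof -
    have uH: "u \<in> H" using u by (simp add: minimizer_def)
    \<comment> \<open>A still smaller parameter \<open>\<beta> k\<close> has a minimizer of at least
      the same norm, so \<open>h u u\<close> cannot exceed \<open>S\<close>.\<close>
    obtain k where k: "\<beta> k < \<alpha>" using order_tendstoD(2)[OF \<beta>lim u(2)] by (auto simp: eventually_sequentially)
    have "h.dsq (v k) u \<le> h (v k) (v k) - h u u" by (rule minimizer_monotone[OF \<beta>pos k v u(1)])
    then have "h u u \<le> S" using S(2)[of k] h.nonneg[OF h.comb_in[OF vH[of k] uH, of "-1"]] by linarith
    then show ?thesis using minimizer_monotone[OF u(2,3) u(1) v] by linarith
  qed
  have Cauchy: "\<exists>N. \<forall>m\<ge>N. \<forall>n\<ge>N. h.dsq (v m) (v n) < d" if "d > 0" for d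
  proof -
    have "S - d / 8 < S" using that by simp
    from order_tendstoD(1)[OF S(1) this] obtain N where N: "S - d / 8 < h (v N) (v N)"
      by (auto simp: eventually_sequentially)
    have near: "h.dsq (v m) (v N) \<le> d / 8 \<and> h.dsq (v N) (v m) \<le> d / 8" if "m > N" for m
    proof -
      have "h.dsq (v m) (v N) \<le> d / 8" using below[OF v \<beta>pos \<beta>dec[OF that]] N by linarith
      moreover have "h.dsq (v m) (v N) = h.dsq (v N) (v m)"
        using vH h.sym[of "v m" "v N"] by (simp add: h.comb_self)
      ultimately show ?thesis by simp
    qed
    have "h.dsq (v m) (v n) < d" if "m \<ge> Suc N" "n \<ge> Suc N" for m n
    proof -
      have "h.dsq (v m) (v N) \<le> d / 8" "h.dsq (v N) (v n) \<le> d / 8"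
        using near[of m] near[of n] that by auto
      then show ?thesis
        using h.dsq_triangle[OF vH[of m] vH[of N] vH[of n]] \<open>d > 0\<close> by argo
    qed
    then show ?thesis by blast
  qed
  obtain u where u: "u \<in> H" "(\<lambda>n. h.dsq (v n) u) \<longlonglongrightarrow> 0"
    using complete[of v] vH Cauchy by blast
  obtain K where K: "\<And>u. u \<in> H \<Longrightarrow> a u u + (norm (tr u))\<^sup>2 \<le> K * h u u" using bounded by blast
  \<comment> \<open>The misfit of \<open>v n\<close> is at most
    \<open>\<beta> n * h udag udag\<close>. Boundedness of \<open>a\<close> and \<open>tr\<close>
    with respect to \<open>h\<close> carries it over to \<open>u\<close>, which therefore solves the
    exact problem.\<close>
  have "a u u + (norm (tr u - b))\<^sup>2 \<le> 0"
  proof (rule LIMSEQ_le_const)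
    have "(\<lambda>n. 2 * (\<beta> n * h udag udag) + 2 * (K * h.dsq (v n) u)) \<longlonglongrightarrow> 2 * (0 * h udag udag) + 2 * (K * 0)"
      by (intro tendsto_intros \<beta>lim u)
    then show "(\<lambda>n. 2 * (\<beta> n * h udag udag) + 2 * (K * h.dsq (v n) u)) \<longlonglongrightarrow> 0" by simp
    have "a u u + (norm (tr u - b))\<^sup>2 \<le> 2 * (\<beta> n * h udag udag) + 2 * (K * h.dsq (v n) u)" for n
    proof -
      let ?z = "comb (v n) (-1) u"
      have z: "?z \<in> H" by (intro a.comb_in vH u)
      have "a (v n) (v n) + (norm (tr (v n) - b))\<^sup>2 \<le> Jf (\<beta> n) b (v n)"
        using h.nonneg[OF vH[of n]] \<beta>pos[of n] by (simp add: Jf_def)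
      moreover have t: "tr u - b = (tr (v n) - b) + (- tr ?z)" by (simp add: tr_comb vH u)
      have "(norm (tr u - b))\<^sup>2 \<le> 2 * (norm (tr (v n) - b))\<^sup>2 + 2 * (norm (tr ?z))\<^sup>2"
        unfolding t using norm_add_square_le[of "tr (v n) - b" "- tr ?z"] by (simp only: norm_minus_cancel)
      moreover have "a u u \<le> 2 * a (v n) (v n) + 2 * a ?z ?z" by (rule a.self_le[OF vH u(1)])
      moreover have "a ?z ?z + (norm (tr ?z))\<^sup>2 \<le> K * h ?z ?z" by (rule K[OF z])
      ultimately show ?thesis using J_le[OF v, of n] by argo
    qed
    then show "\<exists>N. \<forall>n\<ge>N. a u u + (norm (tr u - b))\<^sup>2 \<le> 2 * (\<beta> n * h udag udag) + 2 * (K * h.dsq (v n) u)" by blast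
  qed
  then have u0: "a u u = 0" "tr u = b"
    using a.nonneg[OF u(1)] zero_le_power2[of "norm (tr u - b)"]
    by (smt (verit), smt (verit) zero_eq_power2 norm_eq_zero right_minus_eq)
  \<comment> \<open>Both have zero residual and the same trace, so uniqueness puts them at distance
    0; they may still be different elements.\<close>
  have d: "h.dsq u udag = 0"
  proof (rule injective)
    show "comb u (-1) udag \<in> H" by (intro a.comb_in u ex)
    then show "a (comb u (-1) udag) (comb u (-1) udag) = 0"
      using a.dsq_le[OF u(1) ex(1)] u0 ex a.nonneg by (simp add: order_antisym)
    show "tr (comb u (-1) udag) = 0" using u0 ex by (simp add: tr_comb u)
  qed
  have "\<forall>\<^sub>F n in sequentially. S - e / 8 < h (v n) (v n)" by (rule order_tendstoD(1)[OF S(1)]) (use e in simp)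
  moreover have "\<forall>\<^sub>F n in sequentially. h.dsq (v n) u < e / 8" by (rule order_tendstoD(2)[OF u(2)]) (use e in simp)
  ultimately have "\<forall>\<^sub>F n in sequentially. S - e / 8 < h (v n) (v n) \<and> h.dsq (v n) u < e / 8"
    by (rule eventually_conj)
  then obtain N where N: "S - e / 8 < h (v N) (v N)" "h.dsq (v N) u < e / 8"
    by (auto simp: eventually_sequentially)
  show ?thesis
  proof (intro exI[of _ "\<beta> N"] conjI allI impI \<beta>pos)
    fix \<alpha> w assume w: "0 < \<alpha>" "\<alpha> < \<beta> N" "minimizer \<alpha> b w"
    have wH: "w \<in> H" using w by (simp add: minimizer_def)
    show "h.dsq w udag < e"
      using h.dsq_triangle[OF wH vH[of N] ex(1)] h.dsq_triangle[OF vH[of N] u(1) ex(1)]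
        below[OF w(3,1,2)] N d e by argo
  qed
qed

theorem noisy_data_convergence:
  assumes ex: "udag \<in> H" "a udag udag = 0" "tr udag = b"
    and b: "\<And>\<delta>. \<delta> > 0 \<Longrightarrow> norm (b\<delta> \<delta> - b) \<le> \<delta>"
    and \<alpha>: "\<And>\<delta>. \<delta> > 0 \<Longrightarrow> \<alpha> \<delta> > 0" "(\<alpha> \<longlongrightarrow> 0) (at_right 0)"
      "((\<lambda>\<delta>. \<delta>\<^sup>2 / \<alpha> \<delta>) \<longlongrightarrow> 0) (at_right 0)"
    and u: "\<And>\<delta>. \<delta> > 0 \<Longrightarrow> minimizer (\<alpha> \<delta>) (b\<delta> \<delta>) (u \<delta>)"
  shows "((\<lambda>\<delta>. h.dsq (u \<delta>) udag) \<longlongrightarrow> 0) (at_right (0::real))"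
proof (rule order_tendstoI)
  fix e :: real assume "e < 0"
  have "0 \<le> h.dsq (u \<delta>) udag" if "\<delta> > 0" for \<delta>
    using u[OF that] ex by (intro h.nonneg h.comb_in) (auto simp: minimizer_def)
  then have "\<forall>\<delta>>0. e < h.dsq (u \<delta>) udag" using \<open>e < 0\<close> by (meson less_le_trans)
  then show "\<forall>\<^sub>F \<delta> in at_right 0. e < h.dsq (u \<delta>) udag"
    by (simp add: eventually_at_right_less eventually_at_filter)
next
  fix e :: real assume e: "0 < e"
  obtain \<beta> where \<beta>: "\<beta> > 0" "\<And>\<alpha> u. 0 < \<alpha> \<Longrightarrow> \<alpha> < \<beta> \<Longrightarrow> minimizer \<alpha> b u \<Longrightarrow> h.dsq u udag < e / 4"
    using exact_data_convergence[OF ex, of "e / 4"] e by auto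
  have "\<forall>\<^sub>F \<delta> in at_right 0. \<alpha> \<delta> < \<beta>" by (rule order_tendstoD(2)[OF \<alpha>(2) \<beta>(1)])
  moreover have "\<forall>\<^sub>F \<delta> in at_right 0. \<delta>\<^sup>2 / \<alpha> \<delta> < e" by (rule order_tendstoD(2)[OF \<alpha>(3) e])
  moreover have "\<forall>\<^sub>F \<delta> in at_right (0::real). \<delta> > 0" by (rule eventually_at_right_less)
  ultimately show "\<forall>\<^sub>F \<delta> in at_right 0. h.dsq (u \<delta>) udag < e"
  proof eventually_elim
    case (elim \<delta>)
    note a\<delta> = \<alpha>(1)[OF elim(3)]
    \<comment> \<open>The minimizer for exact data and the same parameter is the intermediate point:
      stability controls the distance to it, the exact-data theorem its distance to
      \<open>udag\<close>. Each \<open>e / 4\<close> is doubled by the squared triangle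
      inequality.\<close>
    obtain w where w: "minimizer (\<alpha> \<delta>) b w" using minimizer_exists[OF a\<delta>] by blast
    have H: "u \<delta> \<in> H" "w \<in> H" using u[OF elim(3)] w by (auto simp: minimizer_def)
    have "\<alpha> \<delta> * h.dsq (u \<delta>) w \<le> (norm (b\<delta> \<delta> - b))\<^sup>2 / 4" by (rule minimizer_stable[OF a\<delta> u[OF elim(3)] w])
    also have "\<dots> \<le> \<delta>\<^sup>2 / 4" using b[OF elim(3)] by (simp add: power_mono)
    also have "\<dots> < \<alpha> \<delta> * (e / 4)" using elim(2) a\<delta> by (simp add: field_simps)
    finally have "h.dsq (u \<delta>) w < e / 4" using a\<delta> by simp
    then show ?case using h.dsq_triangle[OF H ex(1)] \<beta>(2)[OF a\<delta> elim(1) w] by linarith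
  qed
qed

end

section \<open>The space \<open>H\<^sup>2\<close>\<close>

lemma bounded_bilinear_matrix_vector: "bounded_bilinear ((*v) :: real^'n^'m \<Rightarrow> _)"
proof -
  have "bilinear ((*v) :: real^'n^'m \<Rightarrow> _)"
    unfolding bilinear_def
    by (auto intro!: linearI simp: algebra_simps scaleR_matrix_vector_assoc)
  then show ?thesis by (simp add: bilinear_conv_bounded_bilinear)
qed

lemma borel_measurable_bounded_bilinear:
  fixes h :: "'a::euclidean_space \<Rightarrow> 'b::euclidean_space \<Rightarrow> 'c::euclidean_space"
  assumes bil: "bounded_bilinear h" and f: "f \<in> borel_measurable M" and g: "g \<in> borel_measurable M"
  shows "(\<lambda>t. h (f t) (g t)) \<in> borel_measurable M"
proof (rule borel_measurable_continuous_Pair[OF f g])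
  interpret h: bounded_bilinear h by fact
  show "continuous_on UNIV (\<lambda>p. h (fst p) (snd p))"
    by (intro continuous_at_imp_continuous_on ballI h.continuous continuous_intros)
qed

lemma Linf_L2_bilinear:
  fixes h :: "'a::euclidean_space \<Rightarrow> 'b::euclidean_space \<Rightarrow> 'c::euclidean_space"
  assumes bil: "bounded_bilinear h" and A: "A \<in> Linf T" and v: "v \<in> L2 T"
  shows "(\<lambda>t. h (A t) (v t)) \<in> L2 T"
proof -
  interpret h: bounded_bilinear h by fact
  obtain K where K: "K \<ge> 0" "\<And>a b. norm (h a b) \<le> norm a * norm b * K" using h.nonneg_bounded by blast
  obtain M where M: "AE t in leb T. norm (A t) \<le> M" using A by (auto simp: Linf_def)
  show ?thesis
  proof (rule L2_dominated)
    show "(\<lambda>t. h (A t) (v t)) \<in> borel_measurable (leb T)"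
      using A v by (intro borel_measurable_bounded_bilinear[OF bil]) (auto simp: Linf_def L2_def)
    show "integrable (leb T) (\<lambda>t. (M * K)\<^sup>2 * (norm (v t))\<^sup>2)"
      using L2_norm2_integrable[OF v] by simp
    show "AE t in leb T. (norm (h (A t) (v t)))\<^sup>2 \<le> (M * K)\<^sup>2 * (norm (v t))\<^sup>2"
      using M
    proof eventually_elim
      case (elim t)
      have "norm (h (A t) (v t)) \<le> norm (A t) * norm (v t) * K" by (rule K)
      also have "\<dots> \<le> M * norm (v t) * K" using elim K(1) by (intro mult_right_mono) auto
      finally have "norm (h (A t) (v t)) \<le> M * K * norm (v t)" by (simp add: mult_ac)
      then show ?case by (metis norm_ge_zero power_mono power_mult_distrib)
    qed
  qed
qed

text \<open>Membership only provides some derivatives \<open>v1\<close> and \<open>v2\<close>. The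
  nested choices of \<open>wderiv\<close> agree with them almost everywhere and inherit square
  integrability, once \<open>v2\<close> has been transferred from \<open>v1\<close> to
  \<open>wderiv T v\<close>.\<close>

lemma H2D:
  assumes "v \<in> H2 T"
  shows "has_weak_deriv T v (wderiv T v)" "has_weak_deriv T (wderiv T v) (wderiv T (wderiv T v))"
    "v \<in> L2 T" "wderiv T v \<in> L2 T" "wderiv T (wderiv T v) \<in> L2 T"
proof -
  obtain v1 v2 where v: "v \<in> L2 T" "v1 \<in> L2 T" "v2 \<in> L2 T" "has_weak_deriv T v v1" "has_weak_deriv T v1 v2"
    using assms by (auto simp: H2_def)
  show "v \<in> L2 T" by fact
  note w1 = has_weak_deriv_wderiv[OF v(4)]
  show "has_weak_deriv T v (wderiv T v)" by (rule w1)
  have m1: "wderiv T v \<in> borel_measurable (leb T)" using w1(1) by (auto simp: has_weak_deriv_def)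
  show "wderiv T v \<in> L2 T"
    by (rule L2_cong_AE[OF v(2) m1]) (use ae_eq_sym[OF w1(2)] in \<open>simp add: ae_eq_def\<close>)
  have "has_weak_deriv T (wderiv T v) v2" by (rule has_weak_deriv_cong[OF v(5) ae_eq_sym[OF w1(2)] m1])
  note w2 = has_weak_deriv_wderiv[OF this]
  show "has_weak_deriv T (wderiv T v) (wderiv T (wderiv T v))" by (rule w2)
  have m2: "wderiv T (wderiv T v) \<in> borel_measurable (leb T)" using w2(1) by (auto simp: has_weak_deriv_def)
  show "wderiv T (wderiv T v) \<in> L2 T"
    by (rule L2_cong_AE[OF v(3) m2]) (use ae_eq_sym[OF w2(2)] in \<open>simp add: ae_eq_def\<close>)
qed

lemma H2I: 
  "v \<in> L2 T \<Longrightarrow> v1 \<in> L2 T \<Longrightarrow> v2 \<in> L2 T \<Longrightarrow> has_weak_deriv T v v1 \<Longrightarrow> has_weak_deriv T v1 v2 \<Longrightarrow> v \<in> H2 T"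
  by (auto simp: H2_def)

text \<open>Embeds H2 into an L2 space with values in a product type, whose inner product is the sum
  over the components. The H2 form is then one L2 form, and completeness can be taken from
  \<open>L2_complete\<close>.\<close>

definition jet :: "real \<Rightarrow> (real \<Rightarrow> 'a::euclidean_space) \<Rightarrow> real \<Rightarrow> 'a \<times> 'a \<times> 'a" where
  "jet T v t = (v t, wderiv T v t, wderiv T (wderiv T v) t)"

lemma jet_eqI:
  assumes "has_weak_deriv T v v1" "has_weak_deriv T v1 v2"
  shows "AE t in leb T. jet T v t = (v t, v1 t, v2 t)"
proof -
  note w1 = has_weak_deriv_wderiv[OF assms(1)]
  have m1: "wderiv T v \<in> borel_measurable (leb T)" using w1(1) by (auto simp: has_weak_deriv_def)
  have "has_weak_deriv T (wderiv T v) v2" by (rule has_weak_deriv_cong[OF assms(2) ae_eq_sym[OF w1(2)] m1])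
  note w2 = has_weak_deriv_wderiv[OF this]
  show ?thesis
    using w1(2) w2(2) unfolding ae_eq_def by eventually_elim (simp add: jet_def)
qed

lemma jet_L2: "v \<in> H2 T \<Longrightarrow> jet T v \<in> L2 T"
  unfolding jet_def[abs_def] by (intro L2_Pair H2D)

definition comb :: "(real \<Rightarrow> 'a::euclidean_space) \<Rightarrow> real \<Rightarrow> (real \<Rightarrow> 'a) \<Rightarrow> real \<Rightarrow> 'a" where
  "comb u c w t = u t + c *\<^sub>R w t"

lemma H2_comb: "u \<in> H2 T \<Longrightarrow> w \<in> H2 T \<Longrightarrow> comb u c w \<in> H2 T"
  unfolding comb_def[abs_def]
  by (rule H2I; (rule L2_add_scaleR has_weak_deriv_add_scaleR; rule H2D; assumption))

text \<open>The identity is almost everywhere only, since \<open>wderiv\<close> picks a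
  representative for each function separately.\<close>

lemma jet_comb:
  assumes "u \<in> H2 T" "w \<in> H2 T"
  shows "AE t in leb T. jet T (comb u c w) t = jet T u t + c *\<^sub>R jet T w t"
proof -
  have "AE t in leb T. jet T (\<lambda>t. u t + c *\<^sub>R w t) t = (u t + c *\<^sub>R w t, wderiv T u t + c *\<^sub>R wderiv T w t,
      wderiv T (wderiv T u) t + c *\<^sub>R wderiv T (wderiv T w) t)"
    by (intro jet_eqI has_weak_deriv_add_scaleR H2D assms)
  then show ?thesis by (simp add: comb_def[abs_def] jet_def)
qed

section \<open>The two quadratic forms of the functional\<close>

definition hform :: "real \<Rightarrow> (real \<Rightarrow> 'a::euclidean_space) \<Rightarrow> (real \<Rightarrow> 'a) \<Rightarrow> real" where
  "hform T u w = (LINT t|leb T. jet T u t \<bullet> jet T w t)"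

lemma hform_self: "hform T u u = (LINT t|leb T. (norm (jet T u t))\<^sup>2)"
  by (simp add: hform_def power2_norm_eq_inner)

lemma H2_norm_eq: "H2_norm T v = sqrt (hform T v v)"
  by (simp add: H2_norm_def hform_self jet_def norm_Pair add.assoc)

text \<open>The residual \<open>v' - C v\<close>, with \<open>p\<close> in the role of \<open>(v, v', v'')\<close>.\<close>
definition resid :: "(real \<Rightarrow> real^'n^'n) \<Rightarrow> real \<Rightarrow> (real^'n) \<times> (real^'n) \<times> (real^'n) \<Rightarrow> real^'n" where
  "resid C t p = fst (snd p) - C t *v fst p"

lemma resid_add_scaleR: "resid C t (p + c *\<^sub>R p') = resid C t p + c *\<^sub>R resid C t p'"
  by (simp add: resid_def algebra_simps)

definition aform :: "real \<Rightarrow> (real \<Rightarrow> real^'n^'n) \<Rightarrow> (real \<Rightarrow> real^'n) \<Rightarrow> (real \<Rightarrow> real^'n) \<Rightarrow> real" where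
  "aform T C u w = (LINT t|leb T. resid C t (jet T u t) \<bullet> resid C t (jet T w t))"

lemma resid_L2: 
  assumes "C \<in> Linf T" "u \<in> H2 T"
  shows "(\<lambda>t. resid C t (jet T u t)) \<in> L2 T"
  unfolding resid_def jet_def fst_conv snd_conv
  by (intro L2_diff H2D assms Linf_L2_bilinear[OF bounded_bilinear_matrix_vector])

text \<open>One computation behind the linearity of both \<open>hform\<close> and
  \<open>aform\<close>, whose first argument splits only almost everywhere.\<close>

lemma integral_inner_add_scaleR:
  assumes "f \<in> L2 T" "g \<in> L2 T" "k \<in> L2 T" "e \<in> borel_measurable (leb T)"
    and eq: "AE t in leb T. e t = f t + c *\<^sub>R g t"
  shows "(LINT t|leb T. e t \<bullet> k t) = (LINT t|leb T. f t \<bullet> k t) + c * (LINT t|leb T. g t \<bullet> k t)"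
proof -
  note i = L2_inner_integrable[OF assms(1,3)] L2_inner_integrable[OF assms(2,3)]
  note [measurable] = assms(4) L2_measurable[OF assms(3)]
  have "(LINT t|leb T. e t \<bullet> k t) = (LINT t|leb T. f t \<bullet> k t + c * (g t \<bullet> k t))"
  proof (rule integral_cong_AE)
    show "AE t in leb T. e t \<bullet> k t = f t \<bullet> k t + c * (g t \<bullet> k t)"
      using eq by eventually_elim (simp add: inner_add_left)
    show "(\<lambda>t. f t \<bullet> k t + c * (g t \<bullet> k t)) \<in> borel_measurable (leb T)"
      using i by auto
  qed measurable
  also have "\<dots> = (LINT t|leb T. f t \<bullet> k t) + c * (LINT t|leb T. g t \<bullet> k t)"
    using i by simp
  finally show ?thesis .
qed

lemma psd_form_hform: "psd_form (H2 T) comb (hform T)"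
proof
  fix u w y :: "real \<Rightarrow> 'a" and c assume H: "u \<in> H2 T" "w \<in> H2 T"
  show "comb u c w \<in> H2 T" by (intro H2_comb H)
  show "hform T u w = hform T w u" by (simp add: hform_def inner_commute)
  assume y: "y \<in> H2 T"
  show "hform T (comb u c w) y = hform T u y + c * hform T w y"
    unfolding hform_def
    by (intro integral_inner_add_scaleR jet_L2 H y jet_comb L2_measurable[OF jet_L2] H2_comb)
qed (simp add: hform_self)

lemma psd_form_aform:
  assumes C: "C \<in> Linf T"
  shows "psd_form (H2 T) comb (aform T C)"
proof
  fix u w y :: "real \<Rightarrow> real^'a" and c assume H: "u \<in> H2 T" "w \<in> H2 T"
  show "comb u c w \<in> H2 T" by (intro H2_comb H)
  show "aform T C u w = aform T C w u" by (simp add: aform_def inner_commute)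
  have eq: "AE t in leb T. resid C t (jet T (comb u c w) t) = resid C t (jet T u t) + c *\<^sub>R resid C t (jet T w t)"
    using jet_comb[OF H, of c] by eventually_elim (simp add: resid_add_scaleR)
  assume y: "y \<in> H2 T"
  show "aform T C (comb u c w) y = aform T C u y + c * aform T C w y"
    unfolding aform_def
    by (intro integral_inner_add_scaleR resid_L2 C H y eq L2_measurable[OF resid_L2] H2_comb)
qed (simp add: aform_def)

text \<open>\<open>cont_rep\<close> is a choice and not visibly linear; the representation by
  primitives makes it so on [0,T].\<close>

lemma cont_rep_comb:
  assumes T: "T > 0" and H: "u \<in> H2 T" "w \<in> H2 T" and t: "t \<in> {0..T}"
  shows "cont_rep T (comb u c w) t = cont_rep T u t + c *\<^sub>R cont_rep T w t"
proof -
  note du = has_weak_deriv_cont_rep[OF T H2D(1)[OF H(1)]] and dw = has_weak_deriv_cont_rep[OF T H2D(1)[OF H(2)]]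
  note i = H2D(4)[OF H(1), THEN L2_integrable] H2D(4)[OF H(2), THEN L2_integrable]
  have "cont_rep T (comb u c w) t = (cont_rep T u 0 + c *\<^sub>R cont_rep T w 0) + prim T (\<lambda>s. wderiv T u s + c *\<^sub>R wderiv T w s) t"
  proof (rule cont_rep_eq_prim[OF T _ _ t])
    show "integrable (leb T) (\<lambda>s. wderiv T u s + c *\<^sub>R wderiv T w s)" using i by simp
    show "AE t in leb T. comb u c w t = (cont_rep T u 0 + c *\<^sub>R cont_rep T w 0) + prim T (\<lambda>s. wderiv T u s + c *\<^sub>R wderiv T w s) t"
      using du(3) dw(3) by eventually_elim (simp add: comb_def prim_add_scaleR[OF i] algebra_simps)
  qed
  then show ?thesis
    using du(2)[OF t] dw(2)[OF t] by (simp add: prim_add_scaleR[OF i] algebra_simps)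
qed

text \<open>The Sobolev embedding. Averaging \<open>|u(0)| \<le> |u(s)| + ||u'||_1\<close> over
  \<open>s\<close> and then moving from 0 to \<open>t\<close> gives the bound
  \<open>||u||_1 / T + 2 * ||u'||_1\<close>. Squaring and \<open>L1_le_L2\<close> turn this into the
  constant \<open>2 / T\<^sup>2 * T + 8 * T\<close>.\<close>

lemma cont_rep_bound:
  assumes T: "T > 0" and u: "u \<in> H2 T" and t: "t \<in> {0..T}"
  shows "(norm (cont_rep T u t))\<^sup>2 \<le> (2 / T + 8 * T) * hform T u u"
proof -
  let ?I = "\<lambda>f. LINT s|leb T. norm (f s)"
  note d = has_weak_deriv_cont_rep[OF T H2D(1)[OF u]]
  note i = H2D(3)[OF u, THEN L2_integrable, THEN integrable_norm] H2D(4)[OF u, THEN L2_integrable]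
  have "T * norm (cont_rep T u 0) = (LINT s|leb T. norm (cont_rep T u 0))" using T by (simp add: measure_leb)
  also have "\<dots> \<le> (LINT s|leb T. norm (u s) + ?I (wderiv T u))"
  proof (rule integral_mono_AE)
    show "AE s in leb T. norm (cont_rep T u 0) \<le> norm (u s) + ?I (wderiv T u)"
      using d(3)
    proof eventually_elim
      case (elim s)
      have "norm (cont_rep T u 0) \<le> norm (u s) + norm (prim T (wderiv T u) s)"
        unfolding elim by (metis add_diff_cancel_right' norm_triangle_ineq4)
      then show ?case using prim_norm_le[OF i(2), of s] by linarith
    qed
  qed (use i in auto)
  also have "\<dots> = ?I u + T * ?I (wderiv T u)" using i T by (simp add: measure_leb)
  finally have "norm (cont_rep T u 0) \<le> ?I u / T + ?I (wderiv T u)" using T by (simp add: field_simps)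
  moreover have "norm (cont_rep T u t) \<le> norm (cont_rep T u 0) + norm (prim T (wderiv T u) t)"
    unfolding d(2)[OF t] by (rule norm_triangle_ineq)
  ultimately have "norm (cont_rep T u t) \<le> ?I u / T + 2 * ?I (wderiv T u)"
    using prim_norm_le[OF i(2), of t] by linarith
  then have "(norm (cont_rep T u t))\<^sup>2 \<le> (?I u / T + 2 * ?I (wderiv T u))\<^sup>2" by (intro power_mono) auto
  also have "\<dots> \<le> 2 * (?I u / T)\<^sup>2 + 2 * (2 * ?I (wderiv T u))\<^sup>2"
    using norm_add_square_le[of "?I u / T" "2 * ?I (wderiv T u)"] by (simp only: real_norm_def power2_abs)
  also have "\<dots> = 2 / T\<^sup>2 * (?I u)\<^sup>2 + 8 * (?I (wderiv T u))\<^sup>2" by (simp add: power_divide power_mult_distrib)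
  also have "\<dots> \<le> 2 / T\<^sup>2 * (T * hform T u u) + 8 * (T * hform T u u)"
  proof (intro add_mono mult_left_mono)
    have le: "(?I f)\<^sup>2 \<le> T * hform T u u" if f: "f \<in> L2 T" "\<And>s. norm (f s) \<le> norm (jet T u s)" for f :: "real \<Rightarrow> 'a"
    proof -
      have "(?I f)\<^sup>2 \<le> T * (LINT s|leb T. (norm (f s))\<^sup>2)" by (rule L1_le_L2[OF f(1) T])
      also have "\<dots> \<le> T * hform T u u"
        unfolding hform_self using T
        by (intro mult_left_mono integral_mono L2_norm2_integrable f jet_L2 u power_mono) auto
      finally show ?thesis .
    qed
    show "(?I u)\<^sup>2 \<le> T * hform T u u" "(?I (wderiv T u))\<^sup>2 \<le> T * hform T u u"
      using norm_fst[of "jet T u _"] order_trans[OF norm_fst norm_snd, of "jet T u _"]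
      by (auto intro!: le H2D u simp: jet_def)
  qed (use T in auto)
  also have "\<dots> = (2 / T + 8 * T) * hform T u u" using T by (simp add: field_simps power2_eq_square)
  finally show ?thesis .
qed

lemma aform_bound:
  fixes C :: "real \<Rightarrow> real^'n^'n"
  assumes C: "C \<in> Linf T"
  obtains K where "\<And>u. u \<in> H2 T \<Longrightarrow> aform T C u u \<le> K * hform T u u"
proof -
  obtain k where k: "k \<ge> 0" "\<And>(A::real^'n^'n) x. norm (A *v x) \<le> norm A * norm x * k"
    using bounded_bilinear.nonneg_bounded[OF bounded_bilinear_matrix_vector] by metis
  obtain M where M: "AE t in leb T. norm (C t) \<le> M" using C by (auto simp: Linf_def)
  have "aform T C u u \<le> (2 + 2 * (M * k)\<^sup>2) * hform T u u" if u: "u \<in> H2 T" for u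
  proof -
    have "aform T C u u = (LINT t|leb T. (norm (resid C t (jet T u t)))\<^sup>2)"
      by (simp add: aform_def power2_norm_eq_inner)
    also have "\<dots> \<le> (LINT t|leb T. (2 + 2 * (M * k)\<^sup>2) * (norm (jet T u t))\<^sup>2)"
    proof (rule integral_mono_AE)
      show "AE t in leb T. (norm (resid C t (jet T u t)))\<^sup>2 \<le> (2 + 2 * (M * k)\<^sup>2) * (norm (jet T u t))\<^sup>2"
        using M
      proof eventually_elim
        case (elim t)
        define p where "p = jet T u t"
        have "norm (C t *v fst p) \<le> norm (C t) * norm (fst p) * k" by (rule k)
        also have "\<dots> \<le> M * norm p * k"
          using elim k(1) norm_fst[of p] order_trans[OF norm_ge_zero elim] by (intro mult_right_mono mult_mono) auto
        finally have 1: "(norm (C t *v fst p))\<^sup>2 \<le> (M * k)\<^sup>2 * (norm p)\<^sup>2"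
          by (metis mult.assoc mult.commute norm_ge_zero power_mono power_mult_distrib)
        have 2: "(norm (fst (snd p)))\<^sup>2 \<le> (norm p)\<^sup>2"
          using order_trans[OF norm_fst norm_snd, of p] by (intro power_mono) auto
        have "(norm (resid C t p))\<^sup>2 \<le> 2 * (norm (fst (snd p)))\<^sup>2 + 2 * (norm (C t *v fst p))\<^sup>2"
          unfolding resid_def using norm_add_square_le[of "fst (snd p)" "- (C t *v fst p)"] by simp
        also have "\<dots> \<le> 2 * (norm p)\<^sup>2 + 2 * ((M * k)\<^sup>2 * (norm p)\<^sup>2)" using 1 2 by linarith
        also have "\<dots> = (2 + 2 * (M * k)\<^sup>2) * (norm p)\<^sup>2" by (simp add: distrib_right)
        finally show ?case by (simp add: p_def)
      qed
    qed (use L2_norm2_integrable[OF resid_L2[OF C u]] L2_norm2_integrable[OF jet_L2[OF u]] in auto)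
    finally show ?thesis by (simp add: hform_self)
  qed
  then show ?thesis by (rule that)
qed

lemma hform_comb_eq:
  assumes "u \<in> H2 T" "w \<in> H2 T"
  shows "hform T (comb u (-1) w) (comb u (-1) w) = (LINT t|leb T. (norm (jet T u t - jet T w t))\<^sup>2)"
  unfolding hform_self
proof (rule integral_cong_AE)
  show "AE t in leb T. (norm (jet T (comb u (-1) w) t))\<^sup>2 = (norm (jet T u t - jet T w t))\<^sup>2"
    using jet_comb[OF assms, of "-1"] by eventually_elim simp
qed (use assms[THEN jet_L2, THEN L2_measurable] L2_measurable[OF jet_L2[OF H2_comb[OF assms]]] in measurable)

text \<open>The jets converge in L2. Closedness of the weak derivative, used for each pair of
  consecutive components, shows that their limit is again the jet of a function, up to a null
  set.\<close>

lemma H2_complete: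
  fixes v :: "nat \<Rightarrow> real \<Rightarrow> 'a::euclidean_space"
  assumes T: "T > 0" and v: "\<And>n. v n \<in> H2 T"
    and Cau: "\<And>e. e > 0 \<Longrightarrow> \<exists>N. \<forall>m\<ge>N. \<forall>n\<ge>N. hform T (comb (v m) (-1) (v n)) (comb (v m) (-1) (v n)) < e"
  shows "\<exists>u\<in>H2 T. (\<lambda>n. hform T (comb (v n) (-1) u) (comb (v n) (-1) u)) \<longlonglongrightarrow> 0"
proof -
  obtain g where g: "g \<in> L2 T" "(\<lambda>n. LINT t|leb T. (norm (jet T (v n) t - g t))\<^sup>2) \<longlonglongrightarrow> 0"
    by (rule L2_complete[OF T jet_L2[OF v]]) (use Cau in \<open>auto simp: hform_comb_eq v\<close>)
  have comp: "(\<lambda>n. LINT t|leb T. (norm (P (jet T (v n) t) - P (g t)))\<^sup>2) \<longlonglongrightarrow> 0"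
    if P: "\<And>x y. norm (P x - P y) \<le> norm (x - y)" "\<And>n. (\<lambda>t. P (jet T (v n) t)) \<in> L2 T" "(\<lambda>t. P (g t)) \<in> L2 T"
    for P :: "'a \<times> 'a \<times> 'a \<Rightarrow> 'a"
  proof (rule tendsto_sandwich[OF _ _ tendsto_const g(2)])
    show "\<forall>\<^sub>F n in sequentially. (LINT t|leb T. (norm (P (jet T (v n) t) - P (g t)))\<^sup>2) \<le> (LINT t|leb T. (norm (jet T (v n) t - g t))\<^sup>2)"
      by (intro always_eventually allI integral_mono L2_norm2_integrable L2_diff P g jet_L2 v power_mono) auto
  qed simp
  define g0 where "g0 t = fst (g t)" for t
  define g1 where "g1 t = fst (snd (g t))" for t
  define g2 where "g2 t = snd (snd (g t))" for t
  have gL2: "g0 \<in> L2 T" "g1 \<in> L2 T" "g2 \<in> L2 T"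
    unfolding g0_def[abs_def] g1_def[abs_def] g2_def[abs_def] by (intro L2_fst_snd g)+
  have lip: "norm (fst x - fst y) \<le> norm (x - y)" "norm (fst (snd x) - fst (snd y)) \<le> norm (x - y)"
    "norm (snd (snd x) - snd (snd y)) \<le> norm (x - y)" for x y :: "'a \<times> 'a \<times> 'a"
    using norm_fst[of "x - y"] order_trans[OF norm_fst norm_snd, of "x - y"] order_trans[OF norm_snd norm_snd, of "x - y"]
    by simp_all
  have 0: "(\<lambda>n. LINT t|leb T. (norm (v n t - g0 t))\<^sup>2) \<longlonglongrightarrow> 0"
    using comp[OF lip(1)] H2D(3)[OF v] gL2(1) by (simp add: jet_def g0_def[abs_def])
  have 1: "(\<lambda>n. LINT t|leb T. (norm (wderiv T (v n) t - g1 t))\<^sup>2) \<longlonglongrightarrow> 0"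
    using comp[OF lip(2)] H2D(4)[OF v] gL2(2) by (simp add: jet_def g1_def[abs_def])
  have 2: "(\<lambda>n. LINT t|leb T. (norm (wderiv T (wderiv T (v n)) t - g2 t))\<^sup>2) \<longlonglongrightarrow> 0"
    using comp[OF lip(3)] H2D(5)[OF v] gL2(3) by (simp add: jet_def g2_def[abs_def])
  have w: "has_weak_deriv T g0 g1" "has_weak_deriv T g1 g2"
    by (rule has_weak_deriv_closed[OF T H2D(1)[OF v] _ _ _ _ 0 1] has_weak_deriv_closed[OF T H2D(2)[OF v] _ _ _ _ 1 2],
      (intro H2D v gL2)+)+
  have H: "g0 \<in> H2 T" by (rule H2I[OF gL2 w])
  have j: "AE t in leb T. jet T g0 t = g t"
    using jet_eqI[OF w] by eventually_elim (simp add: g0_def g1_def g2_def)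
  have "hform T (comb (v n) (-1) g0) (comb (v n) (-1) g0) = (LINT t|leb T. (norm (jet T (v n) t - g t))\<^sup>2)" for n
    unfolding hform_comb_eq[OF v H]
  proof (rule integral_cong_AE)
    show "AE t in leb T. (norm (jet T (v n) t - jet T g0 t))\<^sup>2 = (norm (jet T (v n) t - g t))\<^sup>2"
      using j by eventually_elim simp
  qed (use jet_L2[OF H, THEN L2_measurable] jet_L2[OF v, THEN L2_measurable] g(1)[THEN L2_measurable] in measurable)
  then show ?thesis using g(2) H by (intro bexI[of _ g0]) simp_all
qed

text \<open>Gronwall's inequality, by maximizing \<open>exp (- 2 N t) |g t|\<close>.\<close>
lemma Gronwall_zero:
  fixes g :: "real \<Rightarrow> real"
  assumes N: "N > 0" and g: "continuous_on {0..T} g" "\<And>t. t \<in> {0..T} \<Longrightarrow> 0 \<le> g t" "integrable (leb T) g"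
    and le: "\<And>t. t \<in> {0..T} \<Longrightarrow> g t \<le> N * prim T g t" and t: "t \<in> {0..T}"
  shows "g t = 0"
proof -
  let ?E = "\<lambda>s. exp (2 * N * s)"
  have "compact {0..T}" "{0..T} \<noteq> {}" using t by auto
  moreover have "continuous_on {0..T} (\<lambda>s. g s / ?E s)" by (intro continuous_intros g) auto
  ultimately obtain t0 where t0: "t0 \<in> {0..T}" "\<And>s. s \<in> {0..T} \<Longrightarrow> g s / ?E s \<le> g t0 / ?E t0"
    using continuous_attains_sup by (metis (no_types, lifting))
  define m where "m = g t0 / ?E t0"
  have m: "g s \<le> m * ?E s" if "s \<in> {0..T}" for s
    using t0(2)[OF that] by (simp add: m_def divide_le_eq)
  have D: "((?E) has_real_derivative 2 * N * ?E s) (at s)" for s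
    by (auto intro!: derivative_eq_intros)
  have C1: "?E C1_differentiable_on UNIV"
    by (rule C1_differentiable_onI[OF D]) (intro continuous_intros)
  have dE: "deriv ?E = (\<lambda>s. 2 * N * ?E s)" by (rule ext) (rule DERIV_imp_deriv[OF D])
  \<comment> \<open>The bound \<open>g s \<le> m * exp (2 * N * s)\<close> is integrated up to the
    maximum point. The 2 in the exponent leads to \<open>2 * g t0 \<le> g t0 - m\<close>, hence to
    \<open>g t0 \<le> - m\<close>.\<close>
  have "2 * N * prim T g t0 = (LINT s|leb T. 2 * N * (indicator {..t0} s *\<^sub>R g s))"
    unfolding prim_def by simp
  also have "\<dots> \<le> (LINT s|leb T. indicator {..t0} s *\<^sub>R (m * deriv ?E s))"
  proof (rule integral_mono)
    show "integrable (leb T) (\<lambda>s. 2 * N * (indicator {..t0} s *\<^sub>R g s))"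
      using indicator_integrable[OF g(3), of "{..t0}"] by (intro integrable_mult_right) simp
    show "integrable (leb T) (\<lambda>s. indicator {..t0} s *\<^sub>R (m * deriv ?E s))"
      by (intro indicator_integrable continuous_integrable_leb) (auto simp: dE intro!: continuous_intros)
    show "2 * N * (indicator {..t0} s *\<^sub>R g s) \<le> indicator {..t0} s *\<^sub>R (m * deriv ?E s)"
      if "s \<in> space (leb T)" for s
      using m[of s] that N by (auto simp: indicator_def dE mult.left_commute[of m])
  qed
  finally have "2 * N * prim T g t0 \<le> prim T (\<lambda>s. m * deriv ?E s) t0" by (simp add: prim_def)
  also have "prim T (\<lambda>s. m * deriv ?E s) t0 = m * (?E t0 - ?E 0)"
    using prim_deriv[OF _ _ C1, of t0 T] t0(1) 
    by (simp add: prim_def mult.left_commute)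
  finally have "2 * g t0 \<le> m * ?E t0 - m" using le[OF t0(1)] by (simp add: algebra_simps)
  also have "m * ?E t0 = g t0" by (simp add: m_def)
  finally have "g t0 \<le> - m" by simp
  moreover have "m \<ge> 0" using g(2)[OF t0(1)] by (simp add: m_def)
  ultimately have "g t0 \<le> 0" by linarith
  then have "m \<le> 0" by (simp add: m_def divide_nonpos_pos)
  then have "g t \<le> 0" using m[OF t] by (meson exp_ge_zero mult_nonpos_nonneg order_trans)
  then show ?thesis using g(2)[OF t] by simp
qed

section \<open>The reduced system\<close>

lemma AE_zero_if_integral_square_zero:
  assumes "v \<in> L2 T" "(LINT t|leb T. (norm (v t))\<^sup>2) = 0"
  shows "AE t in leb T. v t = 0"
proof -
  have "AE t in leb T. (norm (v t))\<^sup>2 = 0"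
    using integral_nonneg_eq_0_iff_AE[OF L2_norm2_integrable[OF assms(1)]] assms(2) by simp
  then show ?thesis by simp
qed

text \<open>Both factors are constants plus primitives almost everywhere, and
  \<open>prim_product\<close> writes their product in the same form. The derivative \<open>w\<close>
  is built from these representatives, since their integrability is known.\<close>

lemma has_weak_deriv_bilinear:
  fixes h :: "'a::euclidean_space \<Rightarrow> 'b::euclidean_space \<Rightarrow> 'c::euclidean_space"
  assumes T: "T > 0" and bil: "bounded_bilinear h"
    and A: "has_weak_deriv T A A'" and v: "has_weak_deriv T v v'"
  shows "\<exists>w. has_weak_deriv T (\<lambda>t. h (A t) (v t)) w \<and>
    (AE t in leb T. w t = h (A t) (v' t) + h (A' t) (v t))"
proof -
  interpret h: bounded_bilinear h by fact
  have i: "integrable (leb T) A'" "integrable (leb T) v'" "integrable (leb T) A" "integrable (leb T) v"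
    using A v by (auto simp: has_weak_deriv_def)
  obtain a where a: "AE t in leb T. A t = a + prim T A' t" by (rule has_weak_deriv_prim[OF T A])
  obtain b where b: "AE t in leb T. v t = b + prim T v' t" by (rule has_weak_deriv_prim[OF T v])
  define w where "w t = h a (v' t) + h (A' t) b + (h (prim T A' t) (v' t) + h (A' t) (prim T v' t))" for t
  note parts = integral_by_parts(1,2)[OF bil i(1,2)]
  have ia: "integrable (leb T) (\<lambda>t. h a (v' t))" "integrable (leb T) (\<lambda>t. h (A' t) b)"
    by (intro integrable_bounded_linear[OF h.bounded_linear_right] integrable_bounded_linear[OF h.bounded_linear_left] i)+
  then have wi: "integrable (leb T) w" unfolding w_def using parts by simp
  have p1: "prim T (\<lambda>t. h a (v' t)) t = h a (prim T v' t)" for t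
  proof -
    have "prim T (\<lambda>t. h a (v' t)) t = (LINT s|leb T. h a (indicator {..t} s *\<^sub>R v' s))"
      by (simp add: prim_def h.scaleR_right)
    also have "\<dots> = h a (prim T v' t)"
      unfolding prim_def by (intro integral_bounded_linear h.bounded_linear_right indicator_integrable i) simp
    finally show ?thesis .
  qed
  have p2: "prim T (\<lambda>t. h (A' t) b) t = h (prim T A' t) b" for t
  proof -
    have "prim T (\<lambda>t. h (A' t) b) t = (LINT s|leb T. h (indicator {..t} s *\<^sub>R A' s) b)"
      by (simp add: prim_def h.scaleR_left)
    also have "\<dots> = h (prim T A' t) b"
      unfolding prim_def by (intro integral_bounded_linear h.bounded_linear_left indicator_integrable i) simp
    finally show ?thesis .
  qed
  have pw: "prim T w t = h a (prim T v' t) + h (prim T A' t) b + h (prim T A' t) (prim T v' t)" for t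
  proof -
    have "prim T w t = prim T (\<lambda>s. h a (v' s) + h (A' s) b) t
        + prim T (\<lambda>s. h (prim T A' s) (v' s) + h (A' s) (prim T v' s)) t"
      using prim_add_scaleR[where c=1, of T "\<lambda>s. h a (v' s) + h (A' s) b" "\<lambda>s. h (prim T A' s) (v' s) + h (A' s) (prim T v' s)" t]
        ia parts by (simp add: w_def[abs_def])
    also have "prim T (\<lambda>s. h a (v' s) + h (A' s) b) t = h a (prim T v' t) + h (prim T A' t) b"
      using prim_add_scaleR[where c=1, OF ia] by (simp add: p1 p2)
    finally show ?thesis by (simp add: prim_product[OF bil i(1,2)])
  qed
  have "has_weak_deriv T (\<lambda>t. h (A t) (v t)) w"
  proof (rule prim_has_weak_deriv[OF T wi])
    show "(\<lambda>t. h (A t) (v t)) \<in> borel_measurable (leb T)"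
      using i by (intro borel_measurable_bounded_bilinear[OF bil]) auto
    show "AE t in leb T. h (A t) (v t) = h a b + prim T w t"
      using a b by eventually_elim (simp add: pw h.add_left h.add_right)
  qed
  moreover have "AE t in leb T. w t = h (A t) (v' t) + h (A' t) (v t)"
    using a b by eventually_elim (simp add: w_def h.add_left h.add_right)
  ultimately show ?thesis by blast
qed

text \<open>Bootstrapping: \<open>u'\<close> equals \<open>C u\<close>, which by the product rule
  has the weak derivative \<open>C u' + C' u\<close>. This lies in L2 because \<open>C\<close> and
  \<open>C'\<close> are essentially bounded.\<close>

lemma solves_reduced_H2:
  fixes C :: "real \<Rightarrow> real^'n^'n"
  assumes T: "T > 0" and C: "C \<in> W1inf T" and u: "solves_reduced T C b u"
  shows "u \<in> H2 T"
proof -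
  obtain C1 where C1: "C \<in> Linf T" "C1 \<in> Linf T" "has_weak_deriv T C C1"
    using C by (auto simp: W1inf_def)
  obtain u1 where u1: "u \<in> L2 T" "u1 \<in> L2 T" "has_weak_deriv T u u1"
    using u by (auto simp: solves_reduced_def H1_def)
  note w1 = has_weak_deriv_wderiv[OF u1(3)]
  have ode: "ae_eq T (wderiv T u) (\<lambda>t. C t *v u t)" using u by (simp add: solves_reduced_def)
  have m: "wderiv T u \<in> borel_measurable (leb T)" using w1(1) by (auto simp: has_weak_deriv_def)
  note bil = bounded_bilinear_matrix_vector
  have L: "wderiv T u \<in> L2 T"
    by (rule L2_cong_AE[OF Linf_L2_bilinear[OF bil C1(1) u1(1)] m]) (use ae_eq_sym[OF ode] in \<open>simp add: ae_eq_def\<close>)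
  obtain w where w: "has_weak_deriv T (\<lambda>t. C t *v u t) w"
    "AE t in leb T. w t = C t *v u1 t + C1 t *v u t"
    using has_weak_deriv_bilinear[OF T bil C1(3) u1(3)] by blast
  have "(\<lambda>t. C t *v u1 t + 1 *\<^sub>R (C1 t *v u t)) \<in> L2 T"
    by (intro L2_add_scaleR Linf_L2_bilinear[OF bil] C1 u1)
  then have "w \<in> L2 T"
    by (rule L2_cong_AE) (use w in \<open>auto simp: has_weak_deriv_def elim!: eventually_mono\<close>)
  moreover have "has_weak_deriv T (wderiv T u) w"
    by (rule has_weak_deriv_cong[OF w(1) ae_eq_sym[OF ode] m])
  ultimately show ?thesis using H2I[OF u1(1) L _ w1(1)] by blast
qed

text \<open>With initial value 0, \<open>u\<close> is almost everywhere the primitive of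
  \<open>u'\<close>, and \<open>|u'| \<le> N |u|\<close>. Gronwall's inequality is applied to the
  norm of this primitive, which is continuous.\<close>

lemma ode_uniqueness:
  fixes C :: "real \<Rightarrow> real^'n^'n"
  assumes T: "T > 0" and C: "C \<in> Linf T" and u: "u \<in> H2 T"
    and ode: "AE t in leb T. wderiv T u t = C t *v u t" and init: "cont_rep T u 0 = 0"
  shows "AE t in leb T. u t = 0"
proof -
  obtain k where k: "k \<ge> 0" "\<And>(A::real^'n^'n) x. norm (A *v x) \<le> norm A * norm x * k"
    using bounded_bilinear.nonneg_bounded[OF bounded_bilinear_matrix_vector] by metis
  obtain M where M: "AE t in leb T. norm (C t) \<le> M" using C by (auto simp: Linf_def)
  define N where "N = \<bar>M\<bar> * k + 1"
  have N: "N > 0" using k(1) by (simp add: N_def add_nonneg_pos)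
  note d = has_weak_deriv_cont_rep[OF T H2D(1)[OF u]]
  note i = H2D(4)[OF u, THEN L2_integrable]
  let ?p = "prim T (wderiv T u)"
  have up: "AE t in leb T. u t = ?p t" using d(3) init by simp
  have bd: "AE t in leb T. norm (wderiv T u t) \<le> N * norm (?p t)"
    using up ode M
  proof eventually_elim
    case (elim t)
    have "norm (C t *v u t) \<le> norm (C t) * norm (u t) * k" by (rule k)
    also have "\<dots> \<le> \<bar>M\<bar> * norm (u t) * k" using elim(3) k(1) by (intro mult_right_mono) auto
    also have "\<dots> \<le> N * norm (u t)" by (simp add: N_def algebra_simps)
    finally show ?case using elim(1,2) by simp
  qed
  have np: "integrable (leb T) (\<lambda>t. norm (?p t))" by (intro integrable_norm prim_integrable i)
  have p0: "norm (?p t) = 0" if t: "t \<in> {0..T}" for t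
  proof (rule Gronwall_zero[where g="\<lambda>t. norm (?p t)" and T=T and N=N, OF N _ _ np _ t])
    show "continuous_on {0..T} (\<lambda>t. norm (?p t))"
      by (intro continuous_on_norm continuous_on_subset[OF continuous_on_prim[OF i]]) simp
    show "norm (?p s) \<le> N * prim T (\<lambda>t. norm (?p t)) s" for s
    proof -
      have "norm (?p s) \<le> (LINT r|leb T. norm (indicator {..s} r *\<^sub>R wderiv T u r))"
        unfolding prim_def by (rule integral_norm_bound)
      also have "\<dots> \<le> (LINT r|leb T. N * (indicator {..s} r *\<^sub>R norm (?p r)))"
      proof (rule integral_mono_AE)
        show "integrable (leb T) (\<lambda>r. norm (indicator {..s} r *\<^sub>R wderiv T u r))"
          by (intro integrable_norm indicator_integrable i) simp
        show "integrable (leb T) (\<lambda>r. N * (indicator {..s} r *\<^sub>R norm (?p r)))"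
          by (intro integrable_mult_right indicator_integrable np) simp
        show "AE r in leb T. norm (indicator {..s} r *\<^sub>R wderiv T u r) \<le> N * (indicator {..s} r *\<^sub>R norm (?p r))"
          using bd by eventually_elim (auto simp: indicator_def)
      qed
      also have "\<dots> = N * prim T (\<lambda>t. norm (?p t)) s" by (simp add: prim_def[of T "\<lambda>t. norm (?p t)"])
      finally show ?thesis .
    qed
  qed simp
  show ?thesis using up AE_space
  proof eventually_elim
    case (elim t)
    then show ?case using p0[of t] by simp
  qed
qed

theorem tikhonov_H2:
  fixes C :: "real \<Rightarrow> real^'n^'n"
  assumes T: "T > 0" and C: "C \<in> Linf T"
  shows "tikhonov (H2 T) comb (aform T C) (hform T) (\<lambda>v. cont_rep T v 0)"
proof (intro tikhonov.intro psd_form_aform[OF C] psd_form_hform tikhonov_axioms.intro)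
  have zero: "has_weak_deriv T (\<lambda>_. 0) (\<lambda>_. 0 :: real^'n)" by (simp add: has_weak_deriv_def)
  moreover have L0: "(\<lambda>_. 0) \<in> L2 T" by (simp add: L2_def)
  ultimately show "H2 T \<noteq> ({} :: (real \<Rightarrow> real^'n) set)" using H2I[OF L0 L0 L0 zero zero] by blast
  show "cont_rep T (comb u c w) 0 = cont_rep T u 0 + c *\<^sub>R cont_rep T w 0" if "u \<in> H2 T" "w \<in> H2 T"
    for u w :: "real \<Rightarrow> real^'n" and c
    using cont_rep_comb[OF T that, of 0] T by simp
  obtain K where K: "\<And>u. u \<in> H2 T \<Longrightarrow> aform T C u u \<le> K * hform T u u"
    using aform_bound[OF C] by blast
  show "\<exists>K. \<forall>u\<in>H2 T. aform T C u u + (norm (cont_rep T u 0))\<^sup>2 \<le> K * hform T u u"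
  proof (intro exI[of _ "K + (2 / T + 8 * T)"] ballI)
    fix u :: "real \<Rightarrow> real^'n" assume u: "u \<in> H2 T"
    show "aform T C u u + (norm (cont_rep T u 0))\<^sup>2 \<le> (K + (2 / T + 8 * T)) * hform T u u"
      using K[OF u] cont_rep_bound[OF T u, of 0] T unfolding distrib_right[of K] by simp
  qed
  show "\<exists>u\<in>H2 T. (\<lambda>n. hform T (comb (v n) (-1) u) (comb (v n) (-1) u)) \<longlonglongrightarrow> 0"
    if "\<And>n. v n \<in> H2 T"
      "\<And>e. e > 0 \<Longrightarrow> \<exists>N. \<forall>m\<ge>N. \<forall>n\<ge>N. hform T (comb (v m) (-1) (v n)) (comb (v m) (-1) (v n)) < e"
    for v :: "nat \<Rightarrow> real \<Rightarrow> real^'n"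
    by (rule H2_complete[OF T that])
  \<comment> \<open>Zero residual is the differential equation almost everywhere, so
    \<open>u\<close> vanishes almost everywhere. Then 0 is a weak derivative of \<open>u\<close>,
    and the whole jet vanishes.\<close>
  show "hform T u u = 0" if u: "u \<in> H2 T" and a0: "aform T C u u = 0" and t0: "cont_rep T u 0 = 0"
    for u :: "real \<Rightarrow> real^'n"
  proof -
    have "(LINT t|leb T. (norm (resid C t (jet T u t)))\<^sup>2) = 0"
      using a0 by (simp add: aform_def power2_norm_eq_inner)
    then have "AE t in leb T. resid C t (jet T u t) = 0"
      by (rule AE_zero_if_integral_square_zero[OF resid_L2[OF C u]])
    then have "AE t in leb T. wderiv T u t = C t *v u t"
      by (auto simp: resid_def jet_def elim!: eventually_mono)
    then have u0: "AE t in leb T. u t = 0" by (rule ode_uniqueness[OF T C u _ t0])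
    have "ae_eq T (\<lambda>_. 0) u" using u0 by (auto simp: ae_eq_def elim!: eventually_mono)
    then have "has_weak_deriv T u (\<lambda>_. 0)"
      by (rule has_weak_deriv_cong[OF zero]) (rule L2_measurable[OF H2D(3)[OF u]])
    from jet_eqI[OF this zero] u0 have "AE t in leb T. jet T u t = 0"
      by eventually_elim (simp add: zero_prod_def)
    then have "(LINT t|leb T. (norm (jet T u t))\<^sup>2) = 0"
      by (intro integral_eq_zero_AE) (auto elim!: eventually_mono)
    then show ?thesis by (simp add: hform_self)
  qed
qed

lemma ae_eq_if_hform_zero:
  assumes "u \<in> H2 T" "w \<in> H2 T" "hform T (comb w (-1) u) (comb w (-1) u) = 0"
  shows "ae_eq T w u"
proof -
  have "AE t in leb T. jet T w t - jet T u t = 0"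
    using assms(3) unfolding hform_comb_eq[OF assms(2,1)]
    by (rule AE_zero_if_integral_square_zero[OF L2_diff[OF jet_L2[OF assms(2)] jet_L2[OF assms(1)]]])
  then show ?thesis by (auto simp: ae_eq_def jet_def zero_prod_def elim!: eventually_mono)
qed

theorem theorem4p1:
  fixes T Smax r :: real and N :: nat and idx :: "'n::finite \<Rightarrow> nat"
    and \<sigma> :: "real \<Rightarrow> real \<Rightarrow> real" and C :: "real \<Rightarrow> real ^ 'n ^ 'n"
  defines "C \<equiv> C_mat idx \<sigma> Smax r"
  assumes "T > 0" and "Smax > 0" and "r > 0"
    and "bij_betw idx UNIV {0..N}"
    and "C \<in> W1inf T"
  shows
    "(\<forall>\<alpha>>0. \<forall>f\<in>L2 Smax.
        \<exists>u. is_minimizer T C (projected idx Smax f) \<alpha> u \<and>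
          (\<forall>w. is_minimizer T C (projected idx Smax f) \<alpha> w \<longrightarrow> ae_eq T w u))
     \<and>
     (\<forall>\<alpha>>0. \<forall>f1\<in>L2 Smax. \<forall>f2\<in>L2 Smax. \<forall>u1 u2.
        is_minimizer T C (projected idx Smax f1) \<alpha> u1 \<longrightarrow>
        is_minimizer T C (projected idx Smax f2) \<alpha> u2 \<longrightarrow>
        H2_norm T (\<lambda>t. u1 t - u2 t)
          \<le> 1 / (2 * sqrt \<alpha>) * norm (projected idx Smax f1 - projected idx Smax f2))
     \<and>
     (\<forall>u0\<in>L2 Smax. \<forall>(u0\<delta> :: real \<Rightarrow> real \<Rightarrow> real) udag
         (\<alpha> :: real \<Rightarrow> real) (u :: real \<Rightarrow> real \<Rightarrow> real ^ 'n).
        solves_reduced T C (projected idx Smax u0) udag \<longrightarrow>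
        (\<forall>\<delta>>0. u0\<delta> \<delta> \<in> L2 Smax) \<longrightarrow>
        (\<forall>\<delta>>0. norm (projected idx Smax (u0\<delta> \<delta>) - projected idx Smax u0) \<le> \<delta>) \<longrightarrow>
        (\<forall>\<delta>>0. \<alpha> \<delta> > 0) \<longrightarrow>
        (\<alpha> \<longlongrightarrow> 0) (at_right 0) \<longrightarrow>
        ((\<lambda>\<delta>. \<delta>\<^sup>2 / \<alpha> \<delta>) \<longlongrightarrow> 0) (at_right 0) \<longrightarrow>
        (\<forall>\<delta>>0. is_minimizer T C (projected idx Smax (u0\<delta> \<delta>)) (\<alpha> \<delta>) (u \<delta>)) \<longrightarrow>
        udag \<in> H2 T \<and>
        ((\<lambda>\<delta>. H2_norm T (\<lambda>t. u \<delta> t - udag t)) \<longlongrightarrow> 0) (at_right 0) \<and>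
        ((\<lambda>\<delta>. cont_rep T (u \<delta>) T) \<longlongrightarrow> cont_rep T udag T) (at_right 0))"
proof -
  have T: "T > 0" and W: "C \<in> W1inf T" by fact+
  then have C: "C \<in> Linf T" by (simp add: W1inf_def)
  interpret P: tikhonov "H2 T" comb "aform T C" "hform T" "\<lambda>v. cont_rep T v 0"
    by (rule tikhonov_H2[OF T C])
  \<comment> \<open>\<open>H2_norm\<close> is a square root; nonnegativity of \<open>hform\<close>
    on the diagonal is what lets its square return \<open>hform\<close>.\<close>
  have J: "J T C b \<alpha> v = P.Jf \<alpha> b v" if "v \<in> H2 T" for b \<alpha> v
    using P.h.nonneg[OF that]
    by (simp add: J_def P.Jf_def H2_norm_eq aform_def power2_norm_eq_inner resid_def jet_def)
  have min: "is_minimizer T C b \<alpha> v \<longleftrightarrow> P.minimizer \<alpha> b v" for b \<alpha> v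
    by (auto simp: is_minimizer_def is_arg_min_def P.minimizer_def J not_less)
  have diff: "(\<lambda>t. v t - w t) = comb v (-1) w" for v w :: "real \<Rightarrow> real^'n"
    by (simp add: comb_def fun_eq_iff)
  have existence: "\<exists>u. P.minimizer \<alpha> b u \<and> (\<forall>w. P.minimizer \<alpha> b w \<longrightarrow> ae_eq T w u)" if \<alpha>: "\<alpha> > 0" for \<alpha> b
  proof -
    obtain u where u: "P.minimizer \<alpha> b u" using P.minimizer_exists[OF \<alpha>] by blast
    have "ae_eq T w u" if "P.minimizer \<alpha> b w" for w
      using P.minimizer_unique[OF \<alpha> u that] u that
      by (intro ae_eq_if_hform_zero) (auto simp: P.minimizer_def)
    with u show ?thesis by blast
  qed
  have stability: "H2_norm T (comb u1 (-1) u2) \<le> 1 / (2 * sqrt \<alpha>) * norm (b1 - b2)"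
    if "\<alpha> > 0" "P.minimizer \<alpha> b1 u1" "P.minimizer \<alpha> b2 u2" for \<alpha> b1 b2 u1 u2
  proof -
    have "hform T (comb u1 (-1) u2) (comb u1 (-1) u2) \<le> (1 / (2 * sqrt \<alpha>) * norm (b1 - b2))\<^sup>2"
      using P.minimizer_stable[OF that] that(1) by (simp add: power_mult_distrib power_divide field_simps)
    then show ?thesis unfolding H2_norm_eq using that(1) by (intro real_le_lsqrt) auto
  qed
  have convergence: "udag \<in> H2 T \<and> ((\<lambda>\<delta>. H2_norm T (comb (u \<delta>) (-1) udag)) \<longlongrightarrow> 0) (at_right 0) \<and>
        ((\<lambda>\<delta>. cont_rep T (u \<delta>) T) \<longlongrightarrow> cont_rep T udag T) (at_right 0)"
    if sol: "solves_reduced T C b udag" and b: "\<forall>\<delta>>0. norm (b\<delta> \<delta> - b) \<le> \<delta>"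
      and \<alpha>: "\<forall>\<delta>>0. \<alpha> \<delta> > 0" "(\<alpha> \<longlongrightarrow> 0) (at_right 0)" "((\<lambda>\<delta>. \<delta>\<^sup>2 / \<alpha> \<delta>) \<longlongrightarrow> 0) (at_right 0)"
      and u: "\<forall>\<delta>>0. P.minimizer (\<alpha> \<delta>) (b\<delta> \<delta>) (u \<delta>)"
    for b b\<delta> udag and \<alpha> :: "real \<Rightarrow> real" and u
  proof (intro conjI)
    \<comment> \<open>The weak differentiability of \<open>C\<close> enters here and makes the exact
      solution an admissible competitor.\<close>
    show H: "udag \<in> H2 T" by (rule solves_reduced_H2[OF T W sol])
    have "aform T C udag udag = 0"
    proof -
      have "AE t in leb T. resid C t (jet T udag t) = 0"
        using sol by (auto simp: solves_reduced_def ae_eq_def resid_def jet_def elim!: eventually_mono)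
      then show ?thesis unfolding aform_def by (intro integral_eq_zero_AE) (auto elim!: eventually_mono)
    qed
    moreover have "cont_rep T udag 0 = b" using sol by (simp add: solves_reduced_def)
    ultimately have lim: "((\<lambda>\<delta>. hform T (comb (u \<delta>) (-1) udag) (comb (u \<delta>) (-1) udag)) \<longlongrightarrow> 0) (at_right 0)"
      using P.noisy_data_convergence[OF H, of b b\<delta> \<alpha> u] b \<alpha> u by blast
    show "((\<lambda>\<delta>. H2_norm T (comb (u \<delta>) (-1) udag)) \<longlongrightarrow> 0) (at_right 0)"
      unfolding H2_norm_eq using tendsto_real_sqrt[OF lim] by simp
    \<comment> \<open>Evaluation at T is linear and bounded by the H2 norm, so strong convergence
      carries over to the terminal values.\<close>
    have "((\<lambda>\<delta>. cont_rep T (u \<delta>) T - cont_rep T udag T) \<longlongrightarrow> 0) (at_right 0)"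
    proof (rule Lim_null_comparison)
      show "((\<lambda>\<delta>. sqrt ((2 / T + 8 * T) * hform T (comb (u \<delta>) (-1) udag) (comb (u \<delta>) (-1) udag))) \<longlongrightarrow> 0) (at_right 0)"
        using tendsto_real_sqrt[OF tendsto_mult_right_zero[OF lim]] by simp
      have "norm (cont_rep T (u \<delta>) T - cont_rep T udag T)
          \<le> sqrt ((2 / T + 8 * T) * hform T (comb (u \<delta>) (-1) udag) (comb (u \<delta>) (-1) udag))" if "\<delta> > 0" for \<delta>
      proof -
        have uH: "u \<delta> \<in> H2 T" using u that by (simp add: P.minimizer_def)
        have "cont_rep T (comb (u \<delta>) (-1) udag) T = cont_rep T (u \<delta>) T - cont_rep T udag T"
          using cont_rep_comb[OF T uH H, of T "-1"] T by simp
        then show ?thesis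
          using cont_rep_bound[OF T H2_comb[OF uH H, of "-1"], of T] T by (intro real_le_rsqrt) simp
      qed
      then show "\<forall>\<^sub>F \<delta> in at_right 0. norm (cont_rep T (u \<delta>) T - cont_rep T udag T)
          \<le> sqrt ((2 / T + 8 * T) * hform T (comb (u \<delta>) (-1) udag) (comb (u \<delta>) (-1) udag))"
        using eventually_at_right_less[of "0::real"] by (auto elim!: eventually_mono)
    qed
    then show "((\<lambda>\<delta>. cont_rep T (u \<delta>) T) \<longlongrightarrow> cont_rep T udag T) (at_right 0)"
      by (rule LIM_zero_cancel)
  qed
  show ?thesis
    unfolding min diff
  proof (rule conjI[OF _ conjI])
    show "\<forall>\<alpha>>0. \<forall>f\<in>L2 Smax. \<exists>u. P.minimizer \<alpha> (projected idx Smax f) u \<and>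
        (\<forall>w. P.minimizer \<alpha> (projected idx Smax f) w \<longrightarrow> ae_eq T w u)"
      using existence by blast
  next
    show "\<forall>\<alpha>>0. \<forall>f1\<in>L2 Smax. \<forall>f2\<in>L2 Smax. \<forall>u1 u2.
        P.minimizer \<alpha> (projected idx Smax f1) u1 \<longrightarrow> P.minimizer \<alpha> (projected idx Smax f2) u2 \<longrightarrow>
        H2_norm T (comb u1 (-1) u2)
          \<le> 1 / (2 * sqrt \<alpha>) * norm (projected idx Smax f1 - projected idx Smax f2)"
      using stability by blast
  qed (intro ballI allI impI, rule convergence)
qed

end
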